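(* Let $(X,\mu)$ be a probability space equipped with an ergodic and aperiodic measure-preserving action of $\mathbb{R}^d$. Let $1\leq m\leq d-1$ and let $M$ be a compact $m$-dimensional $\mathscr{C}^1$ submanifold of $\mathbb{R}^d$ such that $M\cap\pi$ is a non-empty open set in $M$ for some $m$-dimensional affine subspace $\pi$ of $\mathbb{R}^d$ which does not contain the origin. Then the measure $\mu$ is not $(M,L^\infty(X))$-generic. In particular, for every $m=1,\dots,d-1$, there exists no ergodic and aperiodic measure-preserving action of $\mathbb{R}^d$ on a probability space $(X,\mu)$ for which $\mu$ is $(m,L^\infty(X))$-generic.
   Context: The action of $\boldsymbol a\in\mathbb{R}^d$ on $x\in X$ is written $\boldsymbol a.x$; actions are understood to be measurable, i.e. $(\boldsymbol a,x)\mapsto\boldsymbol a.x$ is measurable. The action is aperiodic if there is a set $N\subset X$ with $\mu(N)=0$ such that $\boldsymbol a.x\neq x$ for all $x\in X\setminus N$ and all $\boldsymbol a\in\mathbb{R}^d\setminus\{\boldsymbol 0\}$. Submanifolds are allowed to have boundary. $\mathrm{vol}_m$ denotes the $m$-dimensional volume measure induced by the Euclidean metric on $\mathbb{R}^d$, $tM=\{t\boldsymbol a:\boldsymbol a\in M\}$, and $\mu(f)=\int_X f\,d\mu$. Let $M\subset\mathbb{R}^d$ be a compact $m$-dimensional $\mathscr{C}^1$ submanifold and let $\mathcal{F}\subset L^1(X)$ be a collection of functions. A measure $\nu$ on $X$ (possibly equal to $\mu$) is $(M,\mathcal{F})$-generic if for every $f\in\mathcal{F}$ and for $\nu$-almost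 every $x\in X$ $$\frac{1}{t^m\,\mathrm{vol}_m(M)}\int_{tM}f(\boldsymbol a.x)\,d\mathrm{vol}_m(\boldsymbol a)\to\mu(f)\quad\text{as }t\to\infty .$$ A measure $\nu$ is $(m,\mathcal{F})$-generic if it is $(M,\mathcal{F})$-generic for all compact $m$-dimensional $\mathscr{C}^1$ submanifolds $M$ of $\mathbb{R}^d$.
   Formalization: The probability space is also assumed countably separated off a null set (true of all standard spaces); for arbitrary probability spaces the claim fails, e.g. translation on R^d with the trivial sigma-algebra. *)

theory Defs
  imports "HOL-Probability.Probability"
begin

text \<open>
  \<^bold>\<open>Submanifolds and their volume.\<close>
  The dimension \<open>m\<close> is carried by the index type \<open>'m\<close>, so that \<open>m = CARD('m)\<close> and
  \<open>\<real>\<^sup>m\<close> is \<open>real ^ 'm\<close>; an argument \<open>TYPE('m)\<close> selects it.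

  A chart of \<open>M\<close> is a \<open>C\<^sup>1\<close> local parametrization on a relatively open subset of a closed
  coordinate half-space. Charts at interior points of \<open>M\<close> have their domain inside the open
  half-space. At boundary points \<open>C\<^sup>1\<close> means, as usual, that there is a \<open>C\<^sup>1\<close> extension to a
  neighbourhood; \<open>\<phi>\<close> itself is such an extension.
\<close>

definition C1_chart ::
    "(real ^ 'd) set \<Rightarrow> (real ^ 'm) set \<Rightarrow> (real ^ 'm \<Rightarrow> real ^ 'd) \<Rightarrow> bool" where
  "C1_chart M W \<phi> \<longleftrightarrow>
     (\<exists>i. openin (top_of_set {x. 0 \<le> x $ i}) W) \<and>
     (\<exists>U. open U \<and> W \<subseteq> U \<and> \<phi> differentiable_on U \<and>
          continuous_on U (\<lambda>x. jacobian \<phi> (at x))) \<and>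
     (\<forall>x\<in>W. inj (frechet_derivative \<phi> (at x))) \<and>
     (\<exists>\<psi>. homeomorphism W (\<phi> ` W) \<phi> \<psi>) \<and>
     openin (top_of_set M) (\<phi> ` W)"

text \<open>
  Submanifolds are embedded, may have boundary, and are nonempty: the averages over \<open>t M\<close>
  make no sense for \<open>M = {}\<close>.
\<close>

definition C1_submanifold :: "'m::finite itself \<Rightarrow> (real ^ 'd) set \<Rightarrow> bool" where
  "C1_submanifold _ M \<longleftrightarrow>
     M \<noteq> {} \<and> (\<forall>p\<in>M. \<exists>W (\<phi> :: real ^ 'm \<Rightarrow> real ^ 'd). C1_chart M W \<phi> \<and> p \<in> \<phi> ` W)"

text \<open>The density \<open>sqrt (det g)\<close>, where \<open>g\<close> is the Euclidean metric pulled back along \<open>\<phi>\<close>.\<close>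

definition volume_density :: "(real ^ 'm \<Rightarrow> real ^ 'd) \<Rightarrow> real ^ 'm \<Rightarrow> real" where
  "volume_density \<phi> x =
     sqrt (det (transpose (jacobian \<phi> (at x)) ** jacobian \<phi> (at x)))"

text \<open>
  The volume measure on \<open>M\<close> induced by the Euclidean metric, as a Borel measure on \<open>\<real>\<^sup>d\<close>
  concentrated on \<open>M\<close>: it is the unique one given in every chart by \<open>sqrt (det g) dx\<close>.
\<close>

definition is_volume_measure ::
    "'m::finite itself \<Rightarrow> (real ^ 'd) set \<Rightarrow> (real ^ 'd) measure \<Rightarrow> bool" where
  "is_volume_measure _ M V \<longleftrightarrow>
     sets V = sets borel \<and> emeasure V (- M) = 0 \<and>
     (\<forall>W (\<phi> :: real ^ 'm \<Rightarrow> real ^ 'd) B.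
        C1_chart M W \<phi> \<and> B \<in> sets borel \<and> B \<subseteq> \<phi> ` W \<longrightarrow>
        emeasure V B = (\<integral>\<^sup>+x\<in>W \<inter> \<phi> -` B. ennreal (volume_density \<phi> x) \<partial>lborel))"

definition vol :: "'m::finite itself \<Rightarrow> (real ^ 'd) set \<Rightarrow> (real ^ 'd) measure" where
  "vol m M = (THE V. is_volume_measure m M V)"


text \<open>\<^bold>\<open>Actions of \<open>\<real>\<^sup>d\<close>.\<close>\<close>

definition measure_preserving_action ::
    "'x measure \<Rightarrow> (real ^ 'd \<Rightarrow> 'x \<Rightarrow> 'x) \<Rightarrow> bool" where
  "measure_preserving_action \<mu> act \<longleftrightarrow>
     (\<lambda>(a, x). act a x) \<in> borel \<Otimes>\<^sub>M \<mu> \<rightarrow>\<^sub>M \<mu> \<and>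
     (\<forall>x\<in>space \<mu>. act 0 x = x) \<and>
     (\<forall>a b. \<forall>x\<in>space \<mu>. act (a + b) x = act a (act b x)) \<and>
     (\<forall>a. distr \<mu> \<mu> (act a) = \<mu>)"

definition ergodic_action :: "'x measure \<Rightarrow> (real ^ 'd \<Rightarrow> 'x \<Rightarrow> 'x) \<Rightarrow> bool" where
  "ergodic_action \<mu> act \<longleftrightarrow>
     (\<forall>A\<in>sets \<mu>. (\<forall>a. act a -` A \<inter> space \<mu> = A) \<longrightarrow> measure \<mu> A = 0 \<or> measure \<mu> A = 1)"

definition aperiodic_action :: "'x measure \<Rightarrow> (real ^ 'd \<Rightarrow> 'x \<Rightarrow> 'x) \<Rightarrow> bool" where
  "aperiodic_action \<mu> act \<longleftrightarrow>
     (\<exists>N\<in>null_sets \<mu>. \<forall>x\<in>space \<mu> - N. \<forall>a. a \<noteq> 0 \<longrightarrow> act a x \<noteq> x)"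

text \<open>
  Probability spaces in ergodic theory are tacitly standard (Lebesgue spaces). Only the following
  consequence is demanded: up to a null set, countably many measurable sets separate the points.
  Every standard Borel space and every Lebesgue space has this property. It cannot be dropped:
  on \<open>X = \<real>\<^sup>d\<close> with the sigma-algebra \<open>{{}, X}\<close>, translation is ergodic and aperiodic, but all
  measurable functions are constant.
\<close>

definition countably_separated :: "'x measure \<Rightarrow> bool" where
  "countably_separated \<mu> \<longleftrightarrow>
     (\<exists>N\<in>null_sets \<mu>. \<exists>A :: nat \<Rightarrow> 'x set. range A \<subseteq> sets \<mu> \<and>
        (\<forall>x\<in>space \<mu> - N. \<forall>y\<in>space \<mu> - N. x \<noteq> y \<longrightarrow> (\<exists>n. x \<in> A n \<longleftrightarrow> y \<notin> A n)))"


text \<open>\<^bold>\<open>Genericity.\<close> As the averages are pointwise, \<open>L\<^sup>\<infinity>\<close> consists of functions, not of classes.\<close>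

definition L_infinity :: "'x measure \<Rightarrow> ('x \<Rightarrow> real) set" where
  "L_infinity \<mu> = {f \<in> borel_measurable \<mu>. \<exists>C. AE x in \<mu>. \<bar>f x\<bar> \<le> C}"

definition generic ::
    "'m::finite itself \<Rightarrow> 'x measure \<Rightarrow> (real ^ 'd \<Rightarrow> 'x \<Rightarrow> 'x) \<Rightarrow> (real ^ 'd) set \<Rightarrow>
     ('x \<Rightarrow> real) set \<Rightarrow> 'x measure \<Rightarrow> bool" where
  "generic m \<mu> act M F \<nu> \<longleftrightarrow>
     sets \<nu> = sets \<mu> \<and>
     (\<forall>f\<in>F. AE x in \<nu>.
        ((\<lambda>t::real. 1 / (t ^ CARD('m) * measure (vol m M) M) *
                    (LINT a:(*\<^sub>R) t ` M|vol m ((*\<^sub>R) t ` M). f (act a x)))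
          \<longlongrightarrow> (\<integral>x. f x \<partial>\<mu>)) at_top)"

definition dim_generic ::
    "'m::finite itself \<Rightarrow> 'x measure \<Rightarrow> (real ^ 'd \<Rightarrow> 'x \<Rightarrow> 'x) \<Rightarrow>
     ('x \<Rightarrow> real) set \<Rightarrow> 'x measure \<Rightarrow> bool" where
  "dim_generic m \<mu> act F \<nu> \<longleftrightarrow>
     (\<forall>M. C1_submanifold m M \<and> compact M \<longrightarrow> generic m \<mu> act M F \<nu>)"

end

theory Submission
  imports Defs
begin

text \<open>
  The averages over \<open>t M\<close> of the indicator of a suitable small set \<open>A \<subseteq> X\<close> are large at arbitrarily
  large times, for almost every starting point. The reason is that the flat piece \<open>P = M \<inter> \<pi>\<close> occupies
  a fixed proportion \<open>\<kappa> > 0\<close> of \<open>M\<close> and, after dilation by \<open>t\<close>, lies in a single hyperplane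
  \<open>{a. a \<bullet> w = t}\<close>, where \<open>w\<close> is chosen with \<open>p \<bullet> w = 1\<close> on \<open>\<pi>\<close>. This is where \<open>0 \<notin> \<pi>\<close> enters: the dilates
  of \<open>\<pi>\<close> are distinct parallel planes. So a thin slab around one hyperplane, of negligible volume,
  contains \<open>b + t P\<close> for every \<open>b\<close> in the unit ball, if \<open>t\<close> is adjusted to \<open>b\<close>.

  To copy this picture into \<open>X\<close>, aperiodicity yields a set \<open>C\<close> of positive measure that does not
  return to itself at times \<open>a\<close> with \<open>\<delta>' \<le> |a| \<le> 2\<close> (\<open>exists_nonreturning_subset\<close>). The proof smooths the
  separating sets along orbits, so that the functions used to tell \<open>x\<close> from \<open>a.x\<close> are continuous in
  \<open>a\<close>, and then uses compactness in \<open>a\<close>. Spreading \<open>C\<close> over the unit ball and over the slab gives sets \<open>E\<close>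
  and \<open>A\<close> with \<open>\<mu> A \<le> \<epsilon> \<mu> E\<close> such that for every \<open>x \<in> E\<close> there is a time \<open>t \<ge> T\<close> with
  \<open>p.x \<in> A\<close> for all \<open>p \<in> t P\<close> (\<open>flat_pieces_absorbed_locally\<close>). As this can be done inside any set of
  positive measure, an exhaustion makes \<open>E\<close> conull while \<open>\<mu> A \<le> \<epsilon>\<close> (\<open>flat_pieces_absorbed_ae\<close>), and a
  union over \<open>T = 0, 1, 2, ...\<close> with summable \<open>\<epsilon>\<close> gives one small set that works for all \<open>T\<close>
  (\<open>flat_pieces_absorbed_infinitely_often\<close>). At the times found, the average over \<open>t M\<close> of its indicator
  is at least \<open>\<kappa>\<close>, but the limit would have to be \<open>\<mu> A < \<kappa>\<close> (\<open>not_generic_of_flat_piece\<close>).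

  To compare the volumes of \<open>t P\<close> and \<open>t M\<close>, one has to know that the volume measure exists, is unique,
  scales by \<open>t ^ m\<close> and is positive on \<open>P\<close>. Existence rests on the agreement of chart integrals on
  overlaps (\<open>chart_integral_le\<close>), which is the change of variables formula for the transition maps.

  For the second claim of the theorem it remains to exhibit a compact submanifold with a flat piece
  off the origin: an \<open>m\<close>-dimensional unit ball in an affine plane that avoids the origin
  (\<open>exists_flat_submanifold_off_origin\<close>).
\<close>

section \<open>Volumes of Borel sets in boxes\<close>

text \<open>
  Boxes are closed under intersection and generate the Borel sets, so two Borel sets with equal
  volume in every box are the same set up to a null set.
\<close>
lemma AE_mem_iff_of_measure_boxes_eq:
  fixes Y Y' :: "'a::euclidean_space set"
  assumes [measurable]: "Y \<in> sets borel" "Y' \<in> sets borel"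
    and eq: "\<And>l u. measure lborel (Y \<inter> box l u) = measure lborel (Y' \<inter> box l u)"
  shows "AE b in lborel. b \<in> Y \<longleftrightarrow> b \<in> Y'"
proof -
  let ?E = "range (\<lambda>(a, b). box a b::'a set)"
  have fin: "emeasure lborel (Z \<inter> box l u) < \<infinity>" if "Z \<in> sets borel" for Z and l u :: 'a
  proof -
    have "emeasure lborel (Z \<inter> box l u) \<le> emeasure lborel (box l u)"
      by (rule emeasure_mono) auto
    also have "\<dots> < \<infinity>" by (simp add: emeasure_lborel_box_eq)
    finally show ?thesis .
  qed
  have d: "emeasure (density lborel (indicator Z)) X = emeasure lborel (Z \<inter> X)"
    if "Z \<in> sets borel" "X \<in> sets borel" for Z X :: "'a set"
    using that by (simp add: emeasure_density flip: indicator_inter_arith)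
  have box: "emeasure (density lborel (indicator Y)) (box l u) = emeasure (density lborel (indicator Y')) (box l u)" for l u
  proof -
    have "emeasure lborel (Y \<inter> box l u) = emeasure lborel (Y' \<inter> box l u)"
      using eq[of l u] fin[of Y l u] fin[of Y' l u]
      by (simp add: emeasure_eq_ennreal_measure less_top)
    then show ?thesis by (simp only: d assms borel_open[OF open_box])
  qed
  have "density lborel (indicator Y) = density lborel (indicator Y')"
  proof (rule measure_eqI_generator_eq)
    show "Int_stable ?E"
      by (auto simp: Int_stable_def box_Int_box)
    show "?E \<subseteq> Pow UNIV" "sets (density lborel (indicator Y)) = sigma_sets UNIV ?E"
       "sets (density lborel (indicator Y')) = sigma_sets UNIV ?E"
      by (simp_all add: borel_eq_box)
    let ?A = "\<lambda>n::nat. box (- (real n *\<^sub>R One)) (real n *\<^sub>R One) :: 'a set"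
    show "range ?A \<subseteq> ?E" "(\<Union>i. ?A i) = UNIV"
      unfolding UN_box_eq_UNIV by auto
    show "emeasure (density lborel (indicator Y)) (?A i) \<noteq> \<infinity>" for i
      using fin[of Y] by (simp add: d less_top)
    show "emeasure (density lborel (indicator Y)) X = emeasure (density lborel (indicator Y')) X" if "X \<in> ?E" for X
      using that box by auto
  qed
  then have "AE b in lborel. indicator Y b = (indicator Y' b :: ennreal)"
    by (subst (asm) sigma_finite_measure.density_unique_iff[OF sigma_finite_lborel]) auto
  then show ?thesis
    by eventually_elim (auto split: split_indicator_asm)
qed

text \<open>
  The indefinite integral of an indicator function is continuous in both corners of the box. This is
  what turns merely measurable functions on an orbit into continuous ones.
\<close>
lemma continuous_measure_Int_box:
  fixes Y :: "'a::euclidean_space set"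
  assumes [measurable]: "Y \<in> sets borel"
  shows "continuous_on UNIV (\<lambda>p. measure lborel (Y \<inter> box (fst p) (snd p)))"
proof -
  define f where "f = (indicator Y :: 'a \<Rightarrow> real)"
  have lm: "Y \<inter> box l u \<in> lmeasurable" for l u
    by (intro bounded_set_imp_lmeasurable) (auto intro: bounded_subset[OF bounded_box])
  have eq: "measure lborel (Y \<inter> box l u) = integral (cbox l u) f" for l u
  proof -
    have "integral (cbox l u) f = integral (box l u) f"
      by (rule integral_open_interval[symmetric])
    also have "\<dots> = measure lebesgue (Y \<inter> box l u)"
      unfolding f_def using lm by (simp add: integral_indicator Int_commute)
    finally show ?thesis by simp
  qed
  show ?thesis
    unfolding continuous_on_eq_continuous_at[OF open_UNIV]
  proof (rule ballI)
    fix p :: "'a \<times> 'a"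
    obtain l u where p: "p = (l, u)" by fastforce
    \<comment> \<open>The indefinite integral is only known to be continuous inside a fixed box, so one that contains
      all boxes with corners near those of the given box is chosen.\<close>
    obtain r where r: "r > 0" "norm l \<le> r" "norm u \<le> r"
      by (metis max.cobounded1 max.cobounded2 max.strict_coboundedI1 norm_not_less_zero zero_less_one max_def linorder_not_le order.strict_trans1)
    let ?R = "(r + 1) *\<^sub>R (One::'a)"
    have inside: "z \<in> cbox (- ?R) ?R" if "norm z \<le> r + 1" for z
      using that Basis_le_norm[of _ z] by (fastforce simp: mem_box)
    have "f integrable_on cbox (- ?R) ?R"
      unfolding f_def integrable_on_indicator
      by (intro bounded_set_imp_lmeasurable) (auto intro: bounded_subset[OF bounded_cbox])
    from indefinite_integral_uniformly_continuous[OF this]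
    have "continuous_on (cbox (- ?R, - ?R) (?R, ?R)) (\<lambda>p. measure lborel (Y \<inter> box (fst p) (snd p)))"
      unfolding eq by (rule uniformly_continuous_imp_continuous)
    then have "continuous_on (ball l 1 \<times> ball u 1) (\<lambda>p. measure lborel (Y \<inter> box (fst p) (snd p)))"
    proof (rule continuous_on_subset)
      show "ball l 1 \<times> ball u 1 \<subseteq> cbox (- ?R, - ?R) (?R, ?R)"
      proof (rule subsetI)
        fix q assume "q \<in> ball l 1 \<times> ball u 1"
        then obtain a b where q: "q = (a, b)" "a \<in> ball l 1" "b \<in> ball u 1"
          by auto
        then have "norm a \<le> r + 1" "norm b \<le> r + 1"
          using r norm_triangle_sub[of a l] norm_triangle_sub[of b u] by (auto simp: dist_norm norm_minus_commute)
        then show "q \<in> cbox (- ?R, - ?R) (?R, ?R)"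
          using inside by (simp add: q(1) cbox_Pair_eq)
      qed
    qed
    then show "isCont (\<lambda>p. measure lborel (Y \<inter> box (fst p) (snd p))) p"
      by (rule continuous_on_interior) (simp add: p interior_open open_Times)
  qed
qed

section \<open>Orbits of a measure-preserving action\<close>

lemma lborel_ae_neq_bot: "ae_filter (lborel :: 'a::euclidean_space measure) \<noteq> bot"
  by (simp add: ae_filter_eq_bot_iff)

locale preserving_action = prob_space \<mu> for \<mu> :: "'x measure" +
  fixes act :: "real ^ 'd::finite \<Rightarrow> 'x \<Rightarrow> 'x"
  assumes preserving: "measure_preserving_action \<mu> act"
begin

lemma measurable_act [measurable (raw)]:
  assumes [measurable]: "f \<in> N \<rightarrow>\<^sub>M borel" "g \<in> N \<rightarrow>\<^sub>M \<mu>"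
  shows "(\<lambda>z. act (f z) (g z)) \<in> N \<rightarrow>\<^sub>M \<mu>"
proof -
  have [measurable]: "(\<lambda>(a, x). act a x) \<in> borel \<Otimes>\<^sub>M \<mu> \<rightarrow>\<^sub>M \<mu>"
    using preserving by (simp add: measure_preserving_action_def)
  have "(\<lambda>z. (\<lambda>(a, x). act a x) (f z, g z)) \<in> N \<rightarrow>\<^sub>M \<mu>"
    by measurable
  then show ?thesis by simp
qed

lemma act_in_space [simp]: "x \<in> space \<mu> \<Longrightarrow> act a x \<in> space \<mu>"
  using measurable_space[OF measurable_act[of "\<lambda>_. a" \<mu> "\<lambda>x. x"]] by auto

lemma act_zero [simp]: "x \<in> space \<mu> \<Longrightarrow> act 0 x = x"
  using preserving by (simp add: measure_preserving_action_def)

lemma act_act [simp]: "x \<in> space \<mu> \<Longrightarrow> act a (act b x) = act (a + b) x"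
  using preserving by (simp add: measure_preserving_action_def)

lemma distr_act: "distr \<mu> \<mu> (act a) = \<mu>"
  using preserving by (simp add: measure_preserving_action_def)

lemma nn_integral_act:
  assumes [measurable]: "f \<in> borel_measurable \<mu>"
  shows "(\<integral>\<^sup>+x. f (act a x) \<partial>\<mu>) = (\<integral>\<^sup>+x. f x \<partial>\<mu>)"
  by (subst (2) distr_act[of a, symmetric], subst nn_integral_distr) auto

lemma emeasure_act:
  assumes [measurable]: "A \<in> sets \<mu>"
  shows "emeasure \<mu> {x \<in> space \<mu>. act a x \<in> A} = emeasure \<mu> A"
  by (subst (2) distr_act[of a, symmetric], subst emeasure_distr)
     (auto intro!: arg_cong[of _ _ "emeasure \<mu>"])

lemma visits_measurable [measurable (raw)]:
  assumes [measurable]: "A \<in> sets \<mu>" and [simp]: "x \<in> space \<mu>"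
  shows "{b. act b x \<in> A} \<in> sets borel"
proof -
  have "Measurable.pred borel (\<lambda>b. act b x \<in> A)"
    by measurable
  then show ?thesis by (simp add: pred_def)
qed

text \<open>
  For every fixed \<open>b\<close> almost every \<open>x\<close> has \<open>act b x\<close> outside the null set, since the action
  preserves \<open>\<mu>\<close>; Fubini exchanges the two quantifiers.
\<close>
lemma AE_orbit_avoids_null_set:
  assumes N: "N \<in> null_sets \<mu>"
  shows "AE x in \<mu>. AE b in lborel. act b x \<notin> N"
proof -
  interpret P: pair_sigma_finite lborel \<mu> ..
  have [measurable]: "N \<in> sets \<mu>" using N by auto
  have "AE b in lborel. AE x in \<mu>. act b x \<notin> N"
  proof (rule AE_I2)
    fix b :: "real ^ 'd"
    have "emeasure \<mu> {x \<in> space \<mu>. act b x \<in> N} = 0"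
      using N by (simp add: emeasure_act null_setsD1)
    then show "AE x in \<mu>. act b x \<notin> N"
      by (subst AE_iff_measurable[OF _ refl]) auto
  qed
  then show ?thesis
    by (subst (asm) P.AE_commute) measurable
qed

text \<open>
  Moving the base point along its orbit translates the set of visiting times. Hence the volume of the
  visits in a fixed box depends on the shift exactly as on the corners of the box, and so
  continuously.
\<close>
lemma measure_visits_act:
  fixes A :: "'x set" and l u a :: "real ^ 'd"
  assumes [measurable]: "A \<in> sets \<mu>" and x: "x \<in> space \<mu>"
  shows "measure lborel ({b. act b (act a x) \<in> A} \<inter> box l u)
       = measure lborel ({b. act b x \<in> A} \<inter> box (l + a) (u + a))"
proof -
  have "measure lborel ({b. act b x \<in> A} \<inter> box (l + a) (u + a))
      = measure (distr lborel borel ((+) a)) ({b. act b x \<in> A} \<inter> box (l + a) (u + a))"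
    by (simp only: lborel_distr_plus)
  also have "\<dots> = measure lborel ({b. act b (act a x) \<in> A} \<inter> box l u)"
    using x by (subst measure_distr)
      (auto simp: mem_box algebra_simps intro!: arg_cong[of _ _ "measure lborel"])
  finally show ?thesis by simp
qed

text \<open>
  If all visiting patterns of \<open>x\<close> and \<open>act a x\<close> agreed almost everywhere, then at a time \<open>b\<close> that avoids
  the exceptional null sets the points \<open>act b x\<close> and \<open>act a (act b x)\<close> would not be separated by any
  \<open>A n\<close>. They would coincide, contrary to aperiodicity. Comparing patterns rather than the points
  themselves is what makes the conclusion hold for all \<open>a\<close> at once: the null set of bad \<open>x\<close> does not
  depend on \<open>a\<close>.
\<close>
lemma AE_translates_separated:
  assumes sep: "countably_separated \<mu>" and aper: "aperiodic_action \<mu> act"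
  obtains A :: "nat \<Rightarrow> 'x set" where "range A \<subseteq> sets \<mu>"
    "AE x in \<mu>. \<forall>a. a \<noteq> 0 \<longrightarrow>
       (\<exists>n. \<not> (AE b in lborel. act b x \<in> A n \<longleftrightarrow> act b (act a x) \<in> A n))"
proof -
  obtain N A where N: "N \<in> null_sets \<mu>" and A: "range A \<subseteq> sets \<mu>"
    and sepA: "\<And>x y. x \<in> space \<mu> - N \<Longrightarrow> y \<in> space \<mu> - N \<Longrightarrow> x \<noteq> y \<Longrightarrow> \<exists>n::nat. x \<in> A n \<longleftrightarrow> y \<notin> A n"
    using sep unfolding countably_separated_def by metis
  obtain N' where N': "N' \<in> null_sets \<mu>"
    and ap: "\<And>x a. x \<in> space \<mu> - N' \<Longrightarrow> a \<noteq> 0 \<Longrightarrow> act a x \<noteq> x"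
    using aper unfolding aperiodic_action_def by metis
  have [measurable]: "N \<in> sets \<mu>" "N' \<in> sets \<mu>" using N N' by auto
  have "AE x in \<mu>. AE b in lborel. act b x \<notin> N \<union> N'"
    by (rule AE_orbit_avoids_null_set) (use N N' in auto)
  then have "AE x in \<mu>. \<forall>a. a \<noteq> 0 \<longrightarrow>
       (\<exists>n. \<not> (AE b in lborel. act b x \<in> A n \<longleftrightarrow> act b (act a x) \<in> A n))"
  proof (rule AE_mp[OF _ AE_I2], intro impI allI)
    fix x and a :: "real ^ 'd"
    assume x: "x \<in> space \<mu>" and avoid: "AE b in lborel. act b x \<notin> N \<union> N'" and a: "a \<noteq> 0"
    show "\<exists>n. \<not> (AE b in lborel. act b x \<in> A n \<longleftrightarrow> act b (act a x) \<in> A n)"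
    proof (rule ccontr)
      assume "\<nexists>n. \<not> (AE b in lborel. act b x \<in> A n \<longleftrightarrow> act b (act a x) \<in> A n)"
      then have "AE b in lborel. \<forall>n. act b x \<in> A n \<longleftrightarrow> act b (act a x) \<in> A n"
        by (simp add: AE_all_countable)
      moreover have "AE b in lborel. act (b + a) x \<notin> N \<union> N'"
      proof -
        have "AE b in distr lborel borel ((+) a). act b x \<notin> N \<union> N'"
          using avoid by (simp only: lborel_distr_plus)
        then show ?thesis
          by (subst (asm) AE_distr_iff) (use x in \<open>auto simp: add.commute\<close>)
      qed
      ultimately have "AE b in lborel. act a (act b x) = act b x \<and> act b x \<notin> N'"
        using avoid
      proof eventually_elim
        case (elim b)
        have "act (b + a) x = act b x"
          using sepA[of "act (b + a) x" "act b x"] elim x by auto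
        then show ?case
          using x elim by (simp add: add.commute)
      qed
      then obtain b where "act a (act b x) = act b x" "act b x \<notin> N'"
        using eventually_happens'[OF lborel_ae_neq_bot] by blast
      then show False using ap[of "act b x" a] x a by auto
    qed
  qed
  with A show thesis by (rule that)
qed

end

section \<open>Comparison of superlevel sets\<close>

lemma emeasure_ray_below: "emeasure lborel {s::real. 0 < s \<and> ennreal s < y} = y"
proof (cases y)
  case (real r)
  then have "{s::real. 0 < s \<and> ennreal s < y} = {0<..<r}"
    by (auto simp: ennreal_less_iff)
  then show ?thesis using real by simp
next
  case top
  have "{s::real. 0 < s \<and> ennreal s < y} = {0<..}"
    using top by auto
  have "(SUP n. ennreal (real n)) \<le> emeasure lborel {0::real<..}"
  proof (rule SUP_least)
    fix n :: nat
    have "ennreal (real n) = emeasure lborel {0<..<real n}" by simp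
    also have "\<dots> \<le> emeasure lborel {0::real<..}" by (rule emeasure_mono) auto
    finally show "ennreal (real n) \<le> emeasure lborel {0::real<..}" .
  qed
  then have "emeasure lborel {0::real<..} = \<top>"
    by (simp add: ennreal_of_nat_eq_real_of_nat[symmetric] ennreal_SUP_of_nat_eq_top top_unique)
  with \<open>{s::real. 0 < s \<and> ennreal s < y} = {0<..}\<close> show ?thesis using top by simp
qed

text \<open>
  The layer cake formula, as Fubini for the region under the graph.
\<close>
lemma (in sigma_finite_measure) nn_integral_superlevel:
  assumes [measurable]: "f \<in> borel_measurable M"
  shows "(\<integral>\<^sup>+x. f x \<partial>M) = (\<integral>\<^sup>+s. indicator {0<..} s * emeasure M {x \<in> space M. ennreal s < f x} \<partial>lborel)"
proof -
  interpret P: pair_sigma_finite M "lborel :: real measure" ..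
  have "(\<integral>\<^sup>+x. f x \<partial>M) = (\<integral>\<^sup>+x. \<integral>\<^sup>+s. indicator {0<..} s * indicator {s. ennreal s < f x} s \<partial>lborel \<partial>M)"
  proof (rule nn_integral_cong)
    fix x
    have "(\<integral>\<^sup>+s. indicator {0<..} s * indicator {s. ennreal s < f x} s \<partial>lborel)
        = (\<integral>\<^sup>+s. indicator {s. 0 < s \<and> ennreal s < f x} s \<partial>lborel)"
      by (intro nn_integral_cong) (auto split: split_indicator)
    also have "\<dots> = emeasure lborel {s. 0 < s \<and> ennreal s < f x}"
      by (rule nn_integral_indicator) measurable
    finally have "(\<integral>\<^sup>+s. indicator {0<..} s * indicator {s. ennreal s < f x} s \<partial>lborel)
        = emeasure lborel {s. 0 < s \<and> ennreal s < f x}" .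
    then show "f x = (\<integral>\<^sup>+s. indicator {0<..} s * indicator {s. ennreal s < f x} s \<partial>lborel)"
      by (simp add: emeasure_ray_below)
  qed
  also have "\<dots> = (\<integral>\<^sup>+s. \<integral>\<^sup>+x. indicator {0<..} s * indicator {s. ennreal s < f x} s \<partial>M \<partial>lborel)"
    by (rule P.Fubini'[symmetric]) measurable
  also have "\<dots> = (\<integral>\<^sup>+s. indicator {0<..} s * emeasure M {x \<in> space M. ennreal s < f x} \<partial>lborel)"
  proof (rule nn_integral_cong)
    fix s :: real
    have "(\<integral>\<^sup>+x. indicator {0<..} s * indicator {s. ennreal s < f x} s \<partial>M)
        = (\<integral>\<^sup>+x. indicator {0<..} s * indicator {x \<in> space M. ennreal s < f x} x \<partial>M)"
      by (intro nn_integral_cong) (auto split: split_indicator)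
    also have "\<dots> = indicator {0<..} s * (\<integral>\<^sup>+x. indicator {x \<in> space M. ennreal s < f x} x \<partial>M)"
      by (rule nn_integral_cmult) measurable
    also have "(\<integral>\<^sup>+x. indicator {x \<in> space M. ennreal s < f x} x \<partial>M) = emeasure M {x \<in> space M. ennreal s < f x}"
      by (rule nn_integral_indicator) measurable
    finally show "(\<integral>\<^sup>+x. indicator {0<..} s * indicator {s. ennreal s < f x} s \<partial>M)
        = indicator {0<..} s * emeasure M {x \<in> space M. ennreal s < f x}" .
  qed
  finally show ?thesis .
qed

text \<open>
  An inequality between two integrals holds at some level between the measures of the superlevel sets,
  because otherwise the layer cake formula would give the reverse inequality of the integrals.
\<close>
lemma (in sigma_finite_measure) exists_superlevel_less:
  assumes [measurable]: "f \<in> borel_measurable M" "g \<in> borel_measurable M"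
    and less: "(\<integral>\<^sup>+x. f x \<partial>M) < e * (\<integral>\<^sup>+x. g x \<partial>M)"
  shows "\<exists>s::real>0.
    emeasure M {x \<in> space M. ennreal s < f x} < e * emeasure M {x \<in> space M. ennreal s < g x}"
proof (rule ccontr)
  assume contra: "\<not> ?thesis"
  have le: "e * emeasure M {x \<in> space M. ennreal s < g x} \<le> emeasure M {x \<in> space M. ennreal s < f x}"
    if "s > 0" for s using contra that by (meson linorder_not_le)
  have "e * (\<integral>\<^sup>+x. g x \<partial>M)
      = (\<integral>\<^sup>+s. e * (indicator {0<..} s * emeasure M {x \<in> space M. ennreal s < g x}) \<partial>lborel)"
    by (subst nn_integral_superlevel) (auto simp: nn_integral_cmult)
  also have "\<dots> \<le> (\<integral>\<^sup>+s. indicator {0<..} s * emeasure M {x \<in> space M. ennreal s < f x} \<partial>lborel)"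
    by (intro nn_integral_mono) (use le in \<open>auto split: split_indicator\<close>)
  also have "\<dots> = (\<integral>\<^sup>+x. f x \<partial>M)"
    by (simp add: nn_integral_superlevel)
  finally show False using less by simp
qed

section \<open>Occupation times and sets without returns\<close>

context preserving_action begin

text \<open>
  The time that the orbit of \<open>x\<close> spends in \<open>A\<close> during \<open>S\<close>. The integral form is defined for all \<open>x\<close> and
  makes joint measurability immediate.
\<close>
definition occupation :: "(real ^ 'd) set \<Rightarrow> 'x set \<Rightarrow> 'x \<Rightarrow> ennreal" where
  "occupation S A x = (\<integral>\<^sup>+b. indicator S b * indicator A (act b x) \<partial>lborel)"

lemma occupation_measurable [measurable]:
  assumes [measurable]: "S \<in> sets borel" "A \<in> sets \<mu>"
  shows "occupation S A \<in> borel_measurable \<mu>"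
  unfolding occupation_def[abs_def] by measurable

lemma occupation_eq_emeasure:
  assumes [measurable]: "S \<in> sets borel" "A \<in> sets \<mu>" and [simp]: "x \<in> space \<mu>"
  shows "occupation S A x = emeasure lborel ({b. act b x \<in> A} \<inter> S)"
proof -
  have "occupation S A x = (\<integral>\<^sup>+b. indicator ({b. act b x \<in> A} \<inter> S) b \<partial>lborel)"
    unfolding occupation_def by (intro nn_integral_cong) (auto split: split_indicator)
  also have "\<dots> = emeasure lborel ({b. act b x \<in> A} \<inter> S)"
    by (rule nn_integral_indicator) measurable
  finally show ?thesis .
qed

lemma nn_integral_occupation:
  assumes [measurable]: "S \<in> sets borel" "A \<in> sets \<mu>"
  shows "(\<integral>\<^sup>+x. occupation S A x \<partial>\<mu>) = emeasure lborel S * emeasure \<mu> A"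
proof -
  interpret P: pair_sigma_finite "lborel :: (real ^ 'd) measure" \<mu> ..
  have "(\<integral>\<^sup>+x. occupation S A x \<partial>\<mu>) = (\<integral>\<^sup>+b. \<integral>\<^sup>+x. indicator S b * indicator A (act b x) \<partial>\<mu> \<partial>lborel)"
    unfolding occupation_def by (rule P.Fubini') measurable
  also have "\<dots> = (\<integral>\<^sup>+b. indicator S b * emeasure \<mu> A \<partial>lborel)"
    by (intro nn_integral_cong) (simp add: nn_integral_cmult nn_integral_act[where f = "indicator A"])
  also have "\<dots> = emeasure lborel S * emeasure \<mu> A"
    by (simp add: nn_integral_multc)
  finally show ?thesis .
qed

text \<open>
  The functions record the volumes of the visits to the separating sets \<open>A n\<close> in boxes whose corners
  range over a countable dense set. If all of them agree at \<open>x\<close> and \<open>act a x\<close>, then by continuity in the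
  corners the visiting patterns have equal volume in every box, and so agree almost everywhere.
\<close>
lemma orbit_continuous_separating_functions:
  assumes sep: "countably_separated \<mu>" and aper: "aperiodic_action \<mu> act"
  obtains F :: "nat \<Rightarrow> 'x \<Rightarrow> real" where "\<And>i. F i \<in> borel_measurable \<mu>"
    "\<And>i x. x \<in> space \<mu> \<Longrightarrow> continuous_on UNIV (\<lambda>a. F i (act a x))"
    "AE x in \<mu>. \<forall>a. a \<noteq> 0 \<longrightarrow> (\<exists>i. F i (act a x) \<noteq> F i x)"
proof -
  obtain A :: "nat \<Rightarrow> 'x set" where A: "range A \<subseteq> sets \<mu>"
    and AE: "AE x in \<mu>. \<forall>a. a \<noteq> 0 \<longrightarrow>
       (\<exists>n. \<not> (AE b in lborel. act b x \<in> A n \<longleftrightarrow> act b (act a x) \<in> A n))"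
    using AE_translates_separated[OF sep aper] .
  have [measurable]: "A n \<in> sets \<mu>" for n using A by auto
  obtain T :: "((real ^ 'd) \<times> (real ^ 'd)) set" where T: "countable T" "UNIV \<subseteq> closure T"
    by (rule separable[of UNIV]) auto
  have "T \<noteq> {}" using T by auto
  define q where "q = from_nat_into T"
  have q: "range q = T"
    unfolding q_def by (rule range_from_nat_into[OF \<open>T \<noteq> {}\<close> \<open>countable T\<close>])
  define G where "G n l u x = measure lborel ({b. act b x \<in> A n} \<inter> box l u)" for n l u x
  define F where "F i = G (fst (prod_decode i)) (fst (q (snd (prod_decode i)))) (snd (q (snd (prod_decode i))))" for i
  have G_shift: "G n l u (act a x) = G n (l + a) (u + a) x" if "x \<in> space \<mu>" for n l u a x
    unfolding G_def using that by (rule measure_visits_act[rotated]) measurable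
  have G_cont: "continuous_on UNIV (\<lambda>p. G n (fst p) (snd p) x)" if "x \<in> space \<mu>" for n x
    unfolding G_def using that by (intro continuous_measure_Int_box) measurable
  show thesis
  proof (rule that[of F])
    fix i
    have "(\<lambda>x. enn2real (occupation (box l u) (A n) x)) \<in> borel_measurable \<mu>" for n l u
      by measurable
    moreover have "enn2real (occupation (box l u) (A n) x) = G n l u x" if "x \<in> space \<mu>" for n l u x
      unfolding G_def measure_def using that by (simp add: occupation_eq_emeasure)
    ultimately have "G n l u \<in> borel_measurable \<mu>" for n l u
      by (subst measurable_cong[of _ "G n l u" "\<lambda>x. enn2real (occupation (box l u) (A n) x)"]) auto
    then show "F i \<in> borel_measurable \<mu>" by (simp add: F_def)
  next
    fix i x assume x: "x \<in> space \<mu>"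
    have "continuous_on UNIV (\<lambda>a. G n (l + a) (u + a) x)" for n l u
      using continuous_on_compose2[OF G_cont[OF x, of n], of UNIV "\<lambda>a. (l + a, u + a)"]
      by (simp add: continuous_intros)
    then show "continuous_on UNIV (\<lambda>a. F i (act a x))"
      by (simp add: F_def G_shift[OF x])
  next
    show "AE x in \<mu>. \<forall>a. a \<noteq> 0 \<longrightarrow> (\<exists>i. F i (act a x) \<noteq> F i x)"
    proof (rule AE_mp[OF AE AE_I2], intro impI allI)
      fix x and a :: "real ^ 'd"
      assume x: "x \<in> space \<mu>" and a: "a \<noteq> 0"
        and "\<forall>a. a \<noteq> 0 \<longrightarrow> (\<exists>n. \<not> (AE b in lborel. act b x \<in> A n \<longleftrightarrow> act b (act a x) \<in> A n))"
      then obtain n where n: "\<not> (AE b in lborel. act b x \<in> A n \<longleftrightarrow> act b (act a x) \<in> A n)"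
        by auto
      show "\<exists>i. F i (act a x) \<noteq> F i x"
      proof (rule ccontr)
        assume "\<nexists>i. F i (act a x) \<noteq> F i x"
        then have all: "F i (act a x) = F i x" for i by auto
        have onT: "G n (fst p) (snd p) (act a x) = G n (fst p) (snd p) x" if pT: "p \<in> T" for p
        proof -
          obtain k where "q k = p" using pT q by auto
          then show ?thesis using all[of "prod_encode (n, k)"] by (simp add: F_def)
        qed
        have cl: "closed {p. G n (fst p) (snd p) (act a x) = G n (fst p) (snd p) x}"
          by (intro closed_Collect_eq G_cont) (use x in auto)
        have eq: "G n (fst p) (snd p) (act a x) = G n (fst p) (snd p) x" for p
          using closure_minimal[OF _ cl, of T] T onT by blast
        have "AE b in lborel. b \<in> {b. act b x \<in> A n} \<longleftrightarrow> b \<in> {b. act b (act a x) \<in> A n}"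
        proof (rule AE_mem_iff_of_measure_boxes_eq)
          show "measure lborel ({b. act b x \<in> A n} \<inter> box l u) = measure lborel ({b. act b (act a x) \<in> A n} \<inter> box l u)" for l u
            using eq[of "(l, u)"] by (simp add: G_def)
        qed (use x in measurable)
        with n show False by simp
      qed
    qed
  qed
qed

text \<open>
  A local cross-section. For a good point \<open>x\<close> the continuous functions \<open>F i\<close> move \<open>x\<close> at every time
  \<open>a \<in> K\<close>, so by compactness of \<open>K\<close> finitely many of them move it by at least some \<open>1 / (n + 1)\<close>,
  uniformly in \<open>a\<close>. Cutting \<open>Z\<close> into the countably many cells on which \<open>n\<close> and the integer parts of
  \<open>(n + 1) * F i\<close> are constant leaves no room for a return at a time in \<open>K\<close>, and one of the cells has
  positive measure.
\<close>
lemma exists_nonreturning_subset: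
  assumes sep: "countably_separated \<mu>" and aper: "aperiodic_action \<mu> act"
    and K: "compact K" "0 \<notin> K" and Z [measurable]: "Z \<in> sets \<mu>" and pos: "emeasure \<mu> Z > 0"
  obtains C where "C \<in> sets \<mu>" "C \<subseteq> Z" "emeasure \<mu> C > 0"
    "\<And>x a. x \<in> C \<Longrightarrow> a \<in> K \<Longrightarrow> act a x \<notin> C"
proof -
  obtain F :: "nat \<Rightarrow> 'x \<Rightarrow> real" where F [measurable]: "\<And>i. F i \<in> borel_measurable \<mu>"
    and cont: "\<And>i x. x \<in> space \<mu> \<Longrightarrow> continuous_on UNIV (\<lambda>a. F i (act a x))"
    and AE: "AE x in \<mu>. \<forall>a. a \<noteq> 0 \<longrightarrow> (\<exists>i. F i (act a x) \<noteq> F i x)"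
    by (rule orbit_continuous_separating_functions[OF sep aper]) (rule that)
  obtain D where D: "countable D" "D \<subseteq> K" "K \<subseteq> closure D"
    by (rule separable[of K])
  define U where "U n x = {a. \<exists>i<n. \<bar>F i (act a x) - F i x\<bar> > 1 / (real n + 1)}" for n x
  \<comment> \<open>The lower bound is demanded only on the dense set \<open>D\<close>, for measurability of the cell; it extends to
    \<open>K\<close> by continuity along the orbit. The list \<open>cs\<close> holds the integer parts.\<close>
  define cell where "cell n cs = {x \<in> Z. (\<forall>a\<in>D. \<exists>i<n. \<bar>F i (act a x) - F i x\<bar> \<ge> 1 / (real n + 1))
      \<and> (\<forall>i<n. \<lfloor>(real n + 1) * F i x\<rfloor> = cs ! i)}" for n cs
  have Zsp: "Z \<subseteq> space \<mu>" using sets.sets_into_space[OF Z] .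
  have cell_sets: "cell n cs \<in> sets \<mu>" for n cs
  proof -
    have "cell n cs = {x \<in> space \<mu>. x \<in> Z \<and> (\<forall>a\<in>D. \<exists>i\<in>{..<n}. \<bar>F i (act a x) - F i x\<bar> \<ge> 1 / (real n + 1))
        \<and> (\<forall>i\<in>{..<n}. \<lfloor>(real n + 1) * F i x\<rfloor> = cs ! i)}"
      using Zsp by (auto simp: cell_def)
    also have "\<dots> \<in> sets \<mu>"
      using D(1) by measurable
    finally show ?thesis .
  qed
  have cover: "AE x in \<mu>. x \<in> Z \<longrightarrow> (\<exists>n cs. x \<in> cell n cs)"
  proof (rule AE_mp[OF AE AE_I2], intro impI)
    fix x assume x: "x \<in> space \<mu>" "x \<in> Z" and moves: "\<forall>a. a \<noteq> 0 \<longrightarrow> (\<exists>i. F i (act a x) \<noteq> F i x)"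
    have U_mono: "U m x \<subseteq> U n x" if "m \<le> n" for m n
    proof -
      have "1 / (real n + 1) \<le> 1 / (real m + 1)" using that by (simp add: field_simps)
      then show ?thesis
        unfolding U_def using that by (smt (verit) Collect_mono order.strict_trans2)
    qed
    have U_open: "open (U n x)" for n
    proof -
      have "open {a. \<bar>F i (act a x) - F i x\<bar> > 1 / (real n + 1)}" for i
        by (intro open_Collect_less continuous_intros cont x)
      moreover have "U n x = (\<Union>i<n. {a. \<bar>F i (act a x) - F i x\<bar> > 1 / (real n + 1)})"
        by (auto simp: U_def)
      ultimately show ?thesis by auto
    qed
    have "K \<subseteq> (\<Union>n. U n x)"
    proof
      fix a assume "a \<in> K"
      then have "a \<noteq> 0" using K(2) by auto
      then obtain i where i: "F i (act a x) \<noteq> F i x" using moves by auto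
      then obtain n where n: "1 / (real n + 1) < \<bar>F i (act a x) - F i x\<bar>"
        using reals_Archimedean[of "\<bar>F i (act a x) - F i x\<bar>"] by (auto simp: inverse_eq_divide add.commute)
      define N where "N = max n (Suc i)"
      have "1 / (real N + 1) \<le> 1 / (real n + 1)" by (simp add: N_def field_simps)
      then have "a \<in> U N x" unfolding U_def using n by (auto simp: N_def intro!: exI[of _ i])
      then show "a \<in> (\<Union>n. U n x)" by auto
    qed
    note K_cover = this
    obtain J where J: "finite J" "K \<subseteq> (\<Union>n\<in>J. U n x)"
    proof (rule compactE_image[OF K(1), of UNIV "\<lambda>n. U n x"])
      show "open (U n x)" for n by (rule U_open)
      show "K \<subseteq> (\<Union>n. U n x)" by (rule K_cover)
    qed (rule that)
    define n where "n = Max (insert 0 J)"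
    have "K \<subseteq> U n x"
    proof
      fix a assume "a \<in> K"
      then obtain m where "m \<in> J" "a \<in> U m x" using J by auto
      moreover have "m \<le> n" using \<open>m \<in> J\<close> J(1) by (simp add: n_def)
      ultimately show "a \<in> U n x" using U_mono by blast
    qed
    have "\<exists>i<n. 1 / (real n + 1) \<le> \<bar>F i (act a x) - F i x\<bar>" if "a \<in> D" for a
    proof -
      have "a \<in> U n x" using that D(2) \<open>K \<subseteq> U n x\<close> by auto
      then obtain i where "i < n" "1 / (real n + 1) < \<bar>F i (act a x) - F i x\<bar>"
        by (auto simp: U_def)
      then show ?thesis by (intro exI[of _ i]) simp
    qed
    then have "x \<in> cell n (map (\<lambda>i. \<lfloor>(real n + 1) * F i x\<rfloor>) [0..<n])"
      using x by (simp add: cell_def)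
    then show "\<exists>n cs. x \<in> cell n cs" by blast
  qed
  have "\<exists>n cs. emeasure \<mu> (cell n cs) \<noteq> 0"
  proof (rule ccontr)
    assume "\<nexists>n cs. emeasure \<mu> (cell n cs) \<noteq> 0"
    then have "(\<Union>(n, cs)\<in>UNIV. cell n cs) \<in> null_sets \<mu>"
      by (intro null_sets_UN') (auto simp: null_sets_def cell_sets)
    then have "AE x in \<mu>. x \<notin> (\<Union>(n, cs)\<in>UNIV. cell n cs)" by (rule AE_not_in)
    with cover have "AE x in \<mu>. x \<notin> Z" by eventually_elim auto
    then have "emeasure \<mu> Z = 0"
      by (subst (asm) AE_iff_measurable[OF Z]) (use Zsp in auto)
    with pos show False by simp
  qed
  then obtain n cs where pos: "emeasure \<mu> (cell n cs) > 0" by (auto simp: zero_less_iff_neq_zero)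
  show thesis
  proof (rule that[OF cell_sets _ pos])
    show "cell n cs \<subseteq> Z" by (auto simp: cell_def)
    fix x a assume x: "x \<in> cell n cs" and a: "a \<in> K"
    have xs: "x \<in> space \<mu>" using x Zsp by (auto simp: cell_def)
    have "closed (\<Union>i<n. {a. 1 / (real n + 1) \<le> \<bar>F i (act a x) - F i x\<bar>})"
      by (intro closed_UN ballI closed_Collect_le continuous_intros cont xs) auto
    moreover have "D \<subseteq> (\<Union>i<n. {a. 1 / (real n + 1) \<le> \<bar>F i (act a x) - F i x\<bar>})"
      using x by (auto simp: cell_def)
    ultimately have "a \<in> (\<Union>i<n. {a. 1 / (real n + 1) \<le> \<bar>F i (act a x) - F i x\<bar>})"
      using D(3) a closure_minimal by blast
    then obtain i where i: "i < n" "1 / (real n + 1) \<le> \<bar>F i (act a x) - F i x\<bar>" by auto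
    show "act a x \<notin> cell n cs"
    proof
      assume "act a x \<in> cell n cs"
      then have "\<lfloor>(real n + 1) * F i (act a x)\<rfloor> = \<lfloor>(real n + 1) * F i x\<rfloor>"
        using x i(1) by (simp add: cell_def)
      then have "\<bar>(real n + 1) * F i (act a x) - (real n + 1) * F i x\<bar> < 1"
        by linarith
      then have "(real n + 1) * \<bar>F i (act a x) - F i x\<bar> < 1"
        by (simp add: abs_mult flip: right_diff_distrib)
      with i(2) show False by (simp add: field_simps)
    qed
  qed
qed

end

section \<open>Thin slabs and maximal elements\<close>

text \<open>
  As the slab gets thinner it shrinks to a piece of a hyperplane, which is a null set.
\<close>
lemma thin_slab_exists:
  fixes w :: "'a::euclidean_space"
  assumes "w \<noteq> 0" and "\<eta> > 0"
  obtains \<delta> where "0 < \<delta>" "\<delta> < 1" "emeasure lborel {a. norm a \<le> R \<and> \<bar>a \<bullet> w + k\<bar> \<le> \<delta>} < \<eta>"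
proof -
  define S where "S n = {a. norm a \<le> R \<and> \<bar>a \<bullet> w + k\<bar> \<le> 1 / (real n + 2)}" for n
  have S_closed: "closed (S n)" for n
  proof -
    have "S n = cball 0 R \<inter> {a. \<bar>a \<bullet> w + k\<bar> \<le> 1 / (real n + 2)}"
      by (auto simp: S_def)
    then show ?thesis
      by (auto intro!: closed_Int closed_Collect_le continuous_intros)
  qed
  have Sn: "S n \<in> sets lborel" for n using S_closed[of n] by auto
  have "(\<lambda>n. emeasure lborel (S n)) \<longlonglongrightarrow> emeasure lborel (\<Inter>n. S n)"
  proof (rule Lim_emeasure_decseq)
    show "range S \<subseteq> sets lborel" using Sn by auto
    show "decseq S"
      unfolding decseq_def S_def
    proof (intro allI impI subsetI)
      fix m n :: nat and a :: 'a
      assume "m \<le> n" and a: "a \<in> {a. norm a \<le> R \<and> \<bar>a \<bullet> w + k\<bar> \<le> 1 / (real n + 2)}"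
      then have "1 / (real n + 2) \<le> 1 / (real m + 2)" by (simp add: field_simps)
      then show "a \<in> {a. norm a \<le> R \<and> \<bar>a \<bullet> w + k\<bar> \<le> 1 / (real m + 2)}" using a by simp
    qed
    fix n
    have "emeasure lborel (S n) \<le> emeasure lborel (cball 0 R :: 'a set)"
      by (rule emeasure_mono) (auto simp: S_def)
    also have "\<dots> < \<infinity>" by (rule emeasure_lborel_cball_finite)
    finally show "emeasure lborel (S n) \<noteq> \<infinity>" by simp
  qed
  moreover have "emeasure lborel (\<Inter>n. S n) = 0"
  proof -
    have "(\<Inter>n. S n) \<subseteq> {a. w \<bullet> a = - k}"
    proof
      fix a assume a: "a \<in> (\<Inter>n. S n)"
      have "\<bar>a \<bullet> w + k\<bar> \<le> 0"
      proof (rule ccontr)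
        assume "\<not> \<bar>a \<bullet> w + k\<bar> \<le> 0"
        then obtain n where "inverse (real (Suc n)) < \<bar>a \<bullet> w + k\<bar>"
          using reals_Archimedean[of "\<bar>a \<bullet> w + k\<bar>"] by auto
        moreover have "\<bar>a \<bullet> w + k\<bar> \<le> 1 / (real n + 2)" using a by (auto simp: S_def)
        moreover have "1 / (real n + 2) \<le> inverse (real (Suc n))" by (simp add: field_simps)
        ultimately show False by simp
      qed
      then show "a \<in> {a. w \<bullet> a = - k}" by (simp add: inner_commute)
    qed
    moreover have "negligible {a. w \<bullet> a = - k}"
      using negligible_hyperplane assms(1) by blast
    ultimately have "negligible (\<Inter>n. S n)"
      using negligible_subset by blast
    then have "emeasure lebesgue (\<Inter>n. S n) = 0"
      by (simp add: negligible_iff_null_sets null_sets_def)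
    moreover have "closed (\<Inter>n. S n)" using S_closed by (intro closed_INT) auto
    ultimately show ?thesis by (simp add: borel_closed)
  qed
  ultimately have "(\<lambda>n. emeasure lborel (S n)) \<longlonglongrightarrow> 0" by simp
  from order_tendstoD(2)[OF this \<open>\<eta> > 0\<close>] obtain n where "emeasure lborel (S n) < \<eta>"
    by (auto simp: eventually_sequentially)
  then show thesis
    by (intro that[of "1 / (real n + 2)"]) (auto simp: S_def)
qed

text \<open>
  The ordering principle of Brezis and Browder. Build a chain in which each member gains more than
  half of what can still be gained. The value of an upper bound of the chain cannot be exceeded by any
  larger element, as this gain would have been available at all earlier steps.
\<close>
lemma exists_maximal_of_increasing_chains:
  fixes \<phi> :: "'a \<Rightarrow> real"
  assumes p0: "p0 \<in> S"
    and trans: "\<And>p q r. le p q \<Longrightarrow> le q r \<Longrightarrow> le p r"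
    and mono: "\<And>p q. p \<in> S \<Longrightarrow> q \<in> S \<Longrightarrow> le p q \<Longrightarrow> \<phi> p \<le> \<phi> q"
    and bound: "\<And>p. p \<in> S \<Longrightarrow> \<phi> p \<le> b"
    and chain: "\<And>u :: nat \<Rightarrow> 'a. (\<And>n. u n \<in> S) \<Longrightarrow> (\<And>n. le (u n) (u (Suc n))) \<Longrightarrow> \<exists>q\<in>S. \<forall>n. le (u n) q"
  shows "\<exists>p\<in>S. \<forall>q\<in>S. le p q \<longrightarrow> \<phi> q \<le> \<phi> p"
proof (rule ccontr)
  assume "\<not> ?thesis"
  then have contra: "\<exists>q\<in>S. le p q \<and> \<phi> p < \<phi> q" if "p \<in> S" for p
    using that by (meson linorder_not_le)
  define above where "above p = {q \<in> S. le p q}" for p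
  define s where "s p = (SUP q\<in>above p. \<phi> q)" for p
  have bdd: "bdd_above (\<phi> ` above p)" for p
    using bound by (intro bdd_aboveI[of _ b]) (auto simp: above_def)
  have step: "\<exists>q. q \<in> S \<and> le p q \<and> \<phi> q > (\<phi> p + s p) / 2" if "p \<in> S" for p
  proof -
    obtain q where q: "q \<in> above p" "\<phi> p < \<phi> q"
      using contra[OF \<open>p \<in> S\<close>] unfolding above_def by auto
    then have "\<phi> q \<le> s p" unfolding s_def by (intro cSUP_upper bdd)
    then have "(\<phi> p + s p) / 2 < s p" using q by simp
    then obtain r where "r \<in> above p" "(\<phi> p + s p) / 2 < \<phi> r"
      unfolding s_def using less_cSUP_iff[OF _ bdd, of p] q(1) by blast
    then show ?thesis by (auto simp: above_def)
  qed
  obtain u where u: "\<And>n. u n \<in> S \<and> (le (u n) (u (Suc n)) \<and> \<phi> (u (Suc n)) > (\<phi> (u n) + s (u n)) / 2)"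
    using dependent_nat_choice[of "\<lambda>_ p. p \<in> S" "\<lambda>_ p q. le p q \<and> \<phi> q > (\<phi> p + s p) / 2"] p0 step by metis
  obtain q where q: "q \<in> S" "\<And>n. le (u n) q"
    using chain[of u] u by blast
  obtain r where r: "r \<in> S" "le q r" "\<phi> q < \<phi> r"
    using contra[OF q(1)] by auto
  have grow: "\<phi> (u (Suc n)) > (\<phi> (u n) + \<phi> r) / 2" for n
  proof -
    have "\<phi> r \<le> s (u n)"
      unfolding s_def using r trans[OF q(2)[of n] r(2)] by (intro cSUP_upper bdd) (auto simp: above_def)
    then show ?thesis using u[of n] by auto
  qed
  have "incseq (\<lambda>n. \<phi> (u n))" using u mono by (intro incseq_SucI) blast
  moreover have "\<phi> (u n) \<le> \<phi> q" for n using u q mono by blast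
  ultimately obtain L where L: "(\<lambda>n. \<phi> (u n)) \<longlonglongrightarrow> L" "L \<le> \<phi> q"
    using incseq_convergent[of "\<lambda>n. \<phi> (u n)" "\<phi> q"] by (metis LIMSEQ_le_const2)
  have "(L + \<phi> r) / 2 \<le> L"
  proof (rule LIMSEQ_le)
    show "(\<lambda>n. (\<phi> (u n) + \<phi> r) / 2) \<longlonglongrightarrow> (L + \<phi> r) / 2" by (intro tendsto_intros L) auto
    show "(\<lambda>n. \<phi> (u (Suc n))) \<longlonglongrightarrow> L" using L(1) by (rule LIMSEQ_Suc)
    show "\<exists>N. \<forall>n\<ge>N. (\<phi> (u n) + \<phi> r) / 2 \<le> \<phi> (u (Suc n))" using grow less_imp_le by blast
  qed
  then show False using L(2) r(3) by (simp add: field_simps)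
qed

section \<open>Small sets that absorb dilated flat pieces\<close>

context preserving_action begin

definition absorbs :: "(real ^ 'd) set \<Rightarrow> real \<Rightarrow> 'x set \<Rightarrow> 'x \<Rightarrow> bool" where
  "absorbs P T A x \<longleftrightarrow> (\<exists>t\<ge>T. \<forall>p\<in>P. act (t *\<^sub>R p) x \<in> A)"

lemma absorbs_mono: "absorbs P T A x \<Longrightarrow> A \<subseteq> A' \<Longrightarrow> absorbs P T A' x"
  unfolding absorbs_def by blast

text \<open>
  Sets \<open>A\<close> that are tiny compared with the set \<open>E\<close> of points that they absorb.

  Take \<open>C \<subseteq> X\<close> without returns at times of norm in \<open>[\<delta> / |w|, 2]\<close>. The visits of \<open>x\<close> to \<open>C\<close> during the
  unit ball then lie close together, so that \<open>a \<bullet> w\<close> varies by at most \<open>\<delta>\<close> among them. Since \<open>p \<bullet> w = 1\<close>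
  on \<open>P\<close>, all points \<open>act (t *\<^sub>R p) x\<close> with \<open>p \<in> P\<close> see these visits inside one and the same slab \<open>S\<close> of
  half-width \<open>\<delta>\<close>, provided that \<open>t\<close> matches the position of the cluster. Hence they spend in \<open>C\<close> during
  \<open>S\<close> at least the time that \<open>x\<close> spends there during the unit ball. The total time spent during \<open>S\<close> is
  proportional to the volume of \<open>S\<close>, which is as small as desired, and the level \<open>s\<close> that turns the
  comparison of occupation times into one of sets comes from the layer cake formula.
\<close>
lemma flat_pieces_absorbed_locally:
  assumes sep: "countably_separated \<mu>" and aper: "aperiodic_action \<mu> act"
    and P: "bounded P" "\<And>p. p \<in> P \<Longrightarrow> p \<bullet> w = 1" and w: "w \<noteq> 0"
    and \<epsilon>: "\<epsilon> > 0" and T: "T \<ge> 0"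
    and Z [measurable]: "Z \<in> sets \<mu>" and pos: "emeasure \<mu> Z > 0"
  obtains A E where "A \<in> sets \<mu>" "E \<in> sets \<mu>" "E \<subseteq> Z" "emeasure \<mu> E > 0"
    "emeasure \<mu> A \<le> ennreal \<epsilon> * emeasure \<mu> E" "\<And>x. x \<in> E \<Longrightarrow> absorbs P T A x"
proof -
  have Zsp: "Z \<subseteq> space \<mu>" using sets.sets_into_space[OF Z] .
  define B where "B = (cball 0 1 :: (real ^ 'd) set)"
  have [measurable]: "B \<in> sets borel" by (simp add: B_def)
  define \<psi> where "\<psi> x = (\<integral>\<^sup>+a. indicator B a * indicator Z (act (- a) x) \<partial>lborel)" for x
  have [measurable]: "\<psi> \<in> borel_measurable \<mu>"
    unfolding \<psi>_def[abs_def] by measurable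
  have B_pos: "emeasure lborel B > 0"
  proof -
    have "0 < measure lborel B" unfolding B_def by (rule content_cball_pos) simp
    then show ?thesis by (cases "emeasure lborel B = 0") (auto simp: measure_def zero_less_iff_neq_zero)
  qed
  \<comment> \<open>To keep \<open>E\<close> inside \<open>Z\<close>, the set \<open>C\<close> is placed where the backward orbit spends at least time
    \<open>\<beta>\<close> in \<open>Z\<close>. The slab is chosen after \<open>\<beta>\<close> is known.\<close>
  obtain \<beta> where \<beta>: "\<beta> > 0" "emeasure \<mu> {x \<in> space \<mu>. ennreal \<beta> < \<psi> x} > 0"
  proof -
    interpret PP: pair_sigma_finite "lborel :: (real ^ 'd) measure" \<mu> ..
    have "(\<integral>\<^sup>+x. \<psi> x \<partial>\<mu>) = (\<integral>\<^sup>+a. \<integral>\<^sup>+x. indicator B a * indicator Z (act (- a) x) \<partial>\<mu> \<partial>lborel)"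
      unfolding \<psi>_def by (rule PP.Fubini') measurable
    also have "\<dots> = (\<integral>\<^sup>+a. indicator B a * emeasure \<mu> Z \<partial>lborel)"
      by (intro nn_integral_cong) (simp add: nn_integral_cmult nn_integral_act[where f = "indicator Z"])
    also have "\<dots> = emeasure lborel B * emeasure \<mu> Z"
      by (simp add: nn_integral_multc)
    also have "\<dots> > 0" using B_pos pos by (simp add: ennreal_zero_less_mult_iff)
    finally have "(\<integral>\<^sup>+x. 0 \<partial>\<mu>) < 1 * (\<integral>\<^sup>+x. \<psi> x \<partial>\<mu>)" by simp
    from exists_superlevel_less[OF _ _ this] show thesis
      using that by auto
  qed
  obtain \<rho> where \<rho>: "\<rho> > 0" "\<And>p. p \<in> P \<Longrightarrow> norm p \<le> \<rho>"
    using P(1) unfolding bounded_pos by auto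
  \<comment> \<open>The position of the slab makes \<open>t = k + b \<bullet> w \<ge> T\<close> for all \<open>b\<close> in the unit ball, and
    its radius covers the visits shifted by \<open>t *\<^sub>R p\<close>.\<close>
  define k where "k = T + norm w"
  define R where "R = 1 + (k + norm w) * \<rho>"
  obtain \<delta> where \<delta>: "0 < \<delta>" "\<delta> < 1"
    and S_small: "emeasure lborel {a. norm a \<le> R \<and> \<bar>a \<bullet> w + k\<bar> \<le> \<delta>} < ennreal (\<epsilon> * \<beta>)"
    by (rule thin_slab_exists[OF w, of "ennreal (\<epsilon> * \<beta>)" R k]) (use \<epsilon> \<beta> in auto)
  define S where "S = {a. norm a \<le> R \<and> \<bar>a \<bullet> w + k\<bar> \<le> \<delta>}"
  have "closed S"
  proof -
    have "S = cball 0 R \<inter> {a. \<bar>a \<bullet> w + k\<bar> \<le> \<delta>}" by (auto simp: S_def)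
    then show ?thesis by (auto intro!: closed_Int closed_Collect_le continuous_intros)
  qed
  then have [measurable]: "S \<in> sets borel" by auto
  define K where "K = {a :: real ^ 'd. \<delta> / norm w \<le> norm a \<and> norm a \<le> 2}"
  have "compact K" "0 \<notin> K"
  proof -
    have "K = cball 0 2 \<inter> {a. \<delta> / norm w \<le> norm a}" by (auto simp: K_def)
    then show "compact K" by (auto intro!: compact_Int_closed closed_Collect_le continuous_intros)
    show "0 \<notin> K" using \<delta> w by (auto simp: K_def field_simps)
  qed
  have "{x \<in> space \<mu>. ennreal \<beta> < \<psi> x} \<in> sets \<mu>" by measurable
  then obtain C where C [measurable]: "C \<in> sets \<mu>" and C_sub: "C \<subseteq> {x \<in> space \<mu>. ennreal \<beta> < \<psi> x}"
    and C_pos: "emeasure \<mu> C > 0" and nonret: "\<And>x a. x \<in> C \<Longrightarrow> a \<in> K \<Longrightarrow> act a x \<notin> C"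
    by (rule exists_nonreturning_subset[OF sep aper \<open>compact K\<close> \<open>0 \<notin> K\<close> _ \<beta>(2)]) (rule that)
  have lower: "ennreal \<beta> * emeasure \<mu> C \<le> (\<integral>\<^sup>+x. indicator Z x * occupation B C x \<partial>\<mu>)"
  proof -
    interpret PP: pair_sigma_finite "lborel :: (real ^ 'd) measure" \<mu> ..
    have "(\<integral>\<^sup>+x. indicator Z x * occupation B C x \<partial>\<mu>)
        = (\<integral>\<^sup>+x. \<integral>\<^sup>+a. indicator Z x * (indicator B a * indicator C (act a x)) \<partial>lborel \<partial>\<mu>)"
      unfolding occupation_def by (intro nn_integral_cong nn_integral_cmult[symmetric]) measurable
    also have "\<dots> = (\<integral>\<^sup>+a. \<integral>\<^sup>+x. indicator Z x * (indicator B a * indicator C (act a x)) \<partial>\<mu> \<partial>lborel)"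
      by (rule PP.Fubini') measurable
    also have "\<dots> = (\<integral>\<^sup>+a. \<integral>\<^sup>+y. indicator Z (act (- a) y) * (indicator B a * indicator C y) \<partial>\<mu> \<partial>lborel)"
    proof (rule nn_integral_cong)
      fix a :: "real ^ 'd"
      have "(\<integral>\<^sup>+x. indicator Z x * (indicator B a * indicator C (act a x)) \<partial>\<mu>)
          = (\<integral>\<^sup>+x. indicator Z (act (- a) (act a x)) * (indicator B a * indicator C (act a x)) \<partial>\<mu>)"
        by (intro nn_integral_cong) simp
      also have "\<dots> = (\<integral>\<^sup>+y. indicator Z (act (- a) y) * (indicator B a * indicator C y) \<partial>\<mu>)"
        by (rule nn_integral_act[where f = "\<lambda>y. indicator Z (act (- a) y) * (indicator B a * indicator C y)"]) measurable
      finally show "(\<integral>\<^sup>+x. indicator Z x * (indicator B a * indicator C (act a x)) \<partial>\<mu>)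
          = (\<integral>\<^sup>+y. indicator Z (act (- a) y) * (indicator B a * indicator C y) \<partial>\<mu>)" .
    qed
    also have "\<dots> = (\<integral>\<^sup>+y. \<integral>\<^sup>+a. indicator Z (act (- a) y) * (indicator B a * indicator C y) \<partial>lborel \<partial>\<mu>)"
      by (rule PP.Fubini'[symmetric]) measurable
    also have "\<dots> = (\<integral>\<^sup>+y. \<psi> y * indicator C y \<partial>\<mu>)"
      unfolding \<psi>_def
      by (intro nn_integral_cong, subst nn_integral_multc[symmetric]) (auto simp: ac_simps)
    also have "\<dots> \<ge> (\<integral>\<^sup>+y. ennreal \<beta> * indicator C y \<partial>\<mu>)"
      by (intro nn_integral_mono) (use C_sub in \<open>auto split: split_indicator\<close>)
    finally show ?thesis
      by (simp add: nn_integral_cmult)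
  qed
  \<comment> \<open>The measure of \<open>C\<close> cancels from this comparison, so nothing is lost by its being small.\<close>
  have "(\<integral>\<^sup>+x. occupation S C x \<partial>\<mu>) < ennreal \<epsilon> * (\<integral>\<^sup>+x. indicator Z x * occupation B C x \<partial>\<mu>)"
  proof -
    have "(\<integral>\<^sup>+x. occupation S C x \<partial>\<mu>) = emeasure lborel S * emeasure \<mu> C"
      by (simp add: nn_integral_occupation)
    also have "\<dots> < ennreal (\<epsilon> * \<beta>) * emeasure \<mu> C"
      using S_small C_pos unfolding S_def[symmetric]
      by (intro ennreal_mult_strict_right_mono) (auto simp: less_top[symmetric])
    also have "\<dots> = ennreal \<epsilon> * (ennreal \<beta> * emeasure \<mu> C)"
      using \<epsilon> \<beta>(1) by (simp add: ennreal_mult mult.assoc)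
    also have "\<dots> \<le> ennreal \<epsilon> * (\<integral>\<^sup>+x. indicator Z x * occupation B C x \<partial>\<mu>)"
      by (intro mult_left_mono lower) simp
    finally show ?thesis .
  qed
  from exists_superlevel_less[OF _ _ this] obtain s where s: "s > 0"
    "emeasure \<mu> {x \<in> space \<mu>. ennreal s < occupation S C x}
      < ennreal \<epsilon> * emeasure \<mu> {x \<in> space \<mu>. ennreal s < indicator Z x * occupation B C x}"
    by auto
  define A where "A = {x \<in> space \<mu>. ennreal s < occupation S C x}"
  define E where "E = {x \<in> space \<mu>. ennreal s < indicator Z x * occupation B C x}"
  show thesis
  proof (rule that[of A E])
    show "A \<in> sets \<mu>" "E \<in> sets \<mu>" unfolding A_def E_def by measurable
    show "E \<subseteq> Z" by (auto simp: E_def split: split_indicator_asm)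
    show "emeasure \<mu> A \<le> ennreal \<epsilon> * emeasure \<mu> E" using s(2) unfolding A_def E_def by simp
    show "emeasure \<mu> E > 0"
      using s(2) unfolding E_def[symmetric] A_def[symmetric]
      by (cases "emeasure \<mu> E = 0") (auto simp: zero_less_iff_neq_zero)
    fix x assume "x \<in> E"
    then have x: "x \<in> space \<mu>" and occ: "ennreal s < occupation B C x"
      by (auto simp: E_def split: split_indicator_asm)
    have occ': "ennreal s < emeasure lborel ({b. act b x \<in> C} \<inter> B)"
      using occ x by (simp add: occupation_eq_emeasure)
    then have "{b. act b x \<in> C} \<inter> B \<noteq> {}" by auto
    then obtain b where b: "act b x \<in> C" "norm b \<le> 1" by (auto simp: B_def)
    define t where "t = k + b \<bullet> w"
    have bw: "\<bar>b \<bullet> w\<bar> \<le> norm w"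
      using Cauchy_Schwarz_ineq2[of b w] b(2) mult_right_mono[of "norm b" 1 "norm w"] by simp
    then have t: "T \<le> t" "0 \<le> t" "t \<le> k + norm w" using T by (auto simp: t_def k_def)
    have close: "\<bar>a \<bullet> w - b \<bullet> w\<bar> \<le> \<delta>" if a: "act a x \<in> C" "norm a \<le> 1" for a
    proof -
      have "act (a - b) (act b x) = act a x" using x by simp
      then have "a - b \<notin> K" using nonret[OF b(1), of "a - b"] a(1) by auto
      moreover have "norm (a - b) \<le> 2" using norm_triangle_ineq4[of a b] a(2) b(2) by simp
      ultimately have "norm (a - b) < \<delta> / norm w" by (auto simp: K_def)
      then have "norm (a - b) * norm w \<le> \<delta>" using w by (simp add: field_simps)
      moreover have "\<bar>(a - b) \<bullet> w\<bar> \<le> norm (a - b) * norm w" by (rule Cauchy_Schwarz_ineq2)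
      ultimately show ?thesis by (simp add: inner_diff_left)
    qed
    show "absorbs P T A x"
      unfolding absorbs_def
    proof (intro exI conjI ballI)
      show "t \<ge> T" by (rule t)
      fix p assume p: "p \<in> P"
      have "emeasure lborel ({b. act b x \<in> C} \<inter> B)
          = emeasure (distr lborel borel ((+) (t *\<^sub>R p))) ({b. act b x \<in> C} \<inter> B)"
        by (simp only: lborel_distr_plus)
      also have "\<dots> = emeasure lborel {a. act (t *\<^sub>R p + a) x \<in> C \<and> t *\<^sub>R p + a \<in> B}"
        using x by (subst emeasure_distr) (auto simp: vimage_def)
      also have "\<dots> \<le> emeasure lborel ({a. act a (act (t *\<^sub>R p) x) \<in> C} \<inter> S)"
      proof (rule emeasure_mono)
        show "{a. act a (act (t *\<^sub>R p) x) \<in> C} \<inter> S \<in> sets lborel" using x by measurable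
        show "{a. act (t *\<^sub>R p + a) x \<in> C \<and> t *\<^sub>R p + a \<in> B} \<subseteq> {a. act a (act (t *\<^sub>R p) x) \<in> C} \<inter> S"
        proof (intro subsetI IntI CollectI)
          fix a assume "a \<in> {a. act (t *\<^sub>R p + a) x \<in> C \<and> t *\<^sub>R p + a \<in> B}"
          then have a: "act (t *\<^sub>R p + a) x \<in> C" "norm (t *\<^sub>R p + a) \<le> 1" by (auto simp: B_def)
          show "act a (act (t *\<^sub>R p) x) \<in> C" using a x by (simp add: add.commute)
          have "norm a \<le> norm (t *\<^sub>R p + a) + norm (t *\<^sub>R p)"
            using norm_triangle_ineq4[of "t *\<^sub>R p + a" "t *\<^sub>R p"] by simp
          also have "\<dots> \<le> R"
          proof -
            have "norm (t *\<^sub>R p) \<le> (k + norm w) * \<rho>"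
              using t \<rho>(2)[OF p] by (simp add: mult_mono)
            then show ?thesis using a(2) by (simp add: R_def)
          qed
          finally have "norm a \<le> R" .
          moreover have "(t *\<^sub>R p + a) \<bullet> w - b \<bullet> w = a \<bullet> w + k"
            using P(2)[OF p] by (simp add: inner_add_left t_def)
          ultimately show "a \<in> S" using close[OF a] by (simp add: S_def)
        qed
      qed
      finally show "act (t *\<^sub>R p) x \<in> A"
        using occ' x by (simp add: A_def occupation_eq_emeasure)
    qed
  qed
qed


text \<open>
  Exhaustion: among the pairs \<open>(A, E)\<close> with \<open>\<mu> A \<le> \<epsilon> \<mu> E\<close> in which \<open>A\<close> absorbs \<open>E\<close>, one with maximal
  \<open>\<mu> E\<close> has \<open>E\<close> of full measure, since otherwise the local construction in the complement of \<open>E\<close> would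
  enlarge it.
\<close>
lemma flat_pieces_absorbed_ae:
  assumes sep: "countably_separated \<mu>" and aper: "aperiodic_action \<mu> act"
    and P: "bounded P" "\<And>p. p \<in> P \<Longrightarrow> p \<bullet> w = 1" and w: "w \<noteq> 0"
    and \<epsilon>: "\<epsilon> > 0" and T: "T \<ge> 0"
  obtains A where "A \<in> sets \<mu>" "emeasure \<mu> A \<le> ennreal \<epsilon>" "AE x in \<mu>. absorbs P T A x"
proof -
  define \<P> where "\<P> = {p. fst p \<in> sets \<mu> \<and> snd p \<in> sets \<mu> \<and> measure \<mu> (fst p) \<le> \<epsilon> * measure \<mu> (snd p)
      \<and> (\<forall>x\<in>snd p. absorbs P T (fst p) x)}"
  define le where "le p q \<longleftrightarrow> fst p \<subseteq> fst q \<and> snd p \<subseteq> snd q" for p q :: "'x set \<times> 'x set"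
  have "\<exists>p\<in>\<P>. \<forall>q\<in>\<P>. le p q \<longrightarrow> measure \<mu> (snd q) \<le> measure \<mu> (snd p)"
  proof (rule exists_maximal_of_increasing_chains[where le = le and b = 1])
    show "({}, {}) \<in> \<P>" by (simp add: \<P>_def)
    show "le p r" if "le p q" "le q r" for p q r using that by (auto simp: le_def)
    show "measure \<mu> (snd p) \<le> measure \<mu> (snd q)" if "p \<in> \<P>" "q \<in> \<P>" "le p q" for p q
      using that by (intro finite_measure_mono) (auto simp: le_def \<P>_def)
    show "measure \<mu> (snd p) \<le> 1" for p by (rule prob_le_1)
    fix u :: "nat \<Rightarrow> 'x set \<times> 'x set"
    assume u: "\<And>n. u n \<in> \<P>" and le_u: "\<And>n. le (u n) (u (Suc n))"
    let ?q = "(\<Union>n. fst (u n), \<Union>n. snd (u n))"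
    have inc: "incseq (\<lambda>n. fst (u n))" "incseq (\<lambda>n. snd (u n))"
      using le_u by (auto simp: incseq_Suc_iff le_def)
    have sets: "range (\<lambda>n. fst (u n)) \<subseteq> sets \<mu>" "range (\<lambda>n. snd (u n)) \<subseteq> sets \<mu>"
      using u by (auto simp: \<P>_def)
    have "measure \<mu> (fst ?q) \<le> \<epsilon> * measure \<mu> (snd ?q)"
    proof (rule LIMSEQ_le)
      show "(\<lambda>n. measure \<mu> (fst (u n))) \<longlonglongrightarrow> measure \<mu> (fst ?q)"
        using finite_Lim_measure_incseq[OF sets(1) inc(1)] by simp
      show "(\<lambda>n. \<epsilon> * measure \<mu> (snd (u n))) \<longlonglongrightarrow> \<epsilon> * measure \<mu> (snd ?q)"
        using finite_Lim_measure_incseq[OF sets(2) inc(2)] by (intro tendsto_mult_left) simp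
      show "\<exists>N. \<forall>n\<ge>N. measure \<mu> (fst (u n)) \<le> \<epsilon> * measure \<mu> (snd (u n))"
        using u by (auto simp: \<P>_def)
    qed
    moreover have "absorbs P T (fst ?q) x" if "x \<in> snd (u n)" for x n
    proof (rule absorbs_mono)
      show "absorbs P T (fst (u n)) x" using u[of n] that by (auto simp: \<P>_def)
    qed auto
    ultimately have "?q \<in> \<P>"
      using sets by (auto simp: \<P>_def)
    then show "\<exists>q\<in>\<P>. \<forall>n. le (u n) q" by (rule bexI[rotated]) (auto simp: le_def)
  qed
  then obtain p where p: "p \<in> \<P>" and max: "\<And>q. q \<in> \<P> \<Longrightarrow> le p q \<Longrightarrow> measure \<mu> (snd q) \<le> measure \<mu> (snd p)"
    by blast
  obtain A E where AE: "p = (A, E)" by fastforce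
  have [measurable]: "A \<in> sets \<mu>" "E \<in> sets \<mu>" and A_le: "measure \<mu> A \<le> \<epsilon> * measure \<mu> E"
    and E: "\<And>x. x \<in> E \<Longrightarrow> absorbs P T A x"
    using p by (auto simp: \<P>_def AE)
  have full: "emeasure \<mu> (space \<mu> - E) = 0"
  proof (rule ccontr)
    assume "emeasure \<mu> (space \<mu> - E) \<noteq> 0"
    then have rest: "emeasure \<mu> (space \<mu> - E) > 0" by (simp add: zero_less_iff_neq_zero)
    have rest_sets: "space \<mu> - E \<in> sets \<mu>" by measurable
    obtain A' E' where [measurable]: "A' \<in> sets \<mu>" "E' \<in> sets \<mu>" and E': "E' \<subseteq> space \<mu> - E" "emeasure \<mu> E' > 0"
      and A': "emeasure \<mu> A' \<le> ennreal \<epsilon> * emeasure \<mu> E'" and ab: "\<And>x. x \<in> E' \<Longrightarrow> absorbs P T A' x"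
      by (rule flat_pieces_absorbed_locally[OF sep aper P w \<epsilon> T rest_sets rest]) (assumption, rule that)
    have A'_le: "measure \<mu> A' \<le> \<epsilon> * measure \<mu> E'"
      using A' \<epsilon> by (simp add: emeasure_eq_measure ennreal_mult[symmetric])
    have sum: "measure \<mu> (E \<union> E') = measure \<mu> E + measure \<mu> E'"
      using E'(1) by (intro finite_measure_Union) auto
    have "measure \<mu> (A \<union> A') \<le> measure \<mu> A + measure \<mu> A'"
      by (intro measure_Un_le) auto
    also have "\<dots> \<le> \<epsilon> * measure \<mu> (E \<union> E')"
      unfolding sum using A_le A'_le by (simp add: distrib_left)
    finally have "(A \<union> A', E \<union> E') \<in> \<P>"
      using E ab by (auto simp: \<P>_def intro: absorbs_mono)
    then have "measure \<mu> (E \<union> E') \<le> measure \<mu> E"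
      using max[of "(A \<union> A', E \<union> E')"] by (auto simp: le_def AE)
    then show False using sum E'(2) by (simp add: emeasure_eq_measure)
  qed
  show thesis
  proof (rule that[of A])
    have "measure \<mu> A \<le> \<epsilon>"
      using A_le \<epsilon> mult_left_mono[OF prob_le_1[of E], of \<epsilon>] by linarith
    then show "emeasure \<mu> A \<le> ennreal \<epsilon>" using \<epsilon> by (simp add: emeasure_eq_measure)
    have "AE x in \<mu>. x \<in> E"
      using full by (subst AE_iff_measurable[OF _ refl]) (auto simp: set_diff_eq)
    then show "AE x in \<mu>. absorbs P T A x" by (rule AE_mp) (auto intro!: AE_I2 E)
  qed auto
qed

text \<open>
  Absorption passes to larger sets and to smaller \<open>T\<close>, so the union of the sets found for \<open>T = n\<close> with
  tolerance \<open>\<eta> / 2 ^ (n + 1)\<close> has the property for all \<open>T\<close>.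
\<close>
lemma flat_pieces_absorbed_infinitely_often:
  assumes sep: "countably_separated \<mu>" and aper: "aperiodic_action \<mu> act"
    and P: "bounded P" "\<And>p. p \<in> P \<Longrightarrow> p \<bullet> w = 1" and w: "w \<noteq> 0" and \<eta>: "\<eta> > 0"
  obtains A where "A \<in> sets \<mu>" "measure \<mu> A \<le> \<eta>" "AE x in \<mu>. \<forall>T. absorbs P T A x"
proof -
  have "\<exists>A. A \<in> sets \<mu> \<and> emeasure \<mu> A \<le> ennreal (\<eta> * (1/2) ^ Suc n) \<and> (AE x in \<mu>. absorbs P (real n) A x)" for n
    by (rule flat_pieces_absorbed_ae[OF sep aper P w, of "\<eta> * (1/2) ^ Suc n" "real n"]) (use \<eta> in auto)
  then obtain A where A: "\<And>n. A n \<in> sets \<mu>" "\<And>n. emeasure \<mu> (A n) \<le> ennreal (\<eta> * (1/2) ^ Suc n)"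
    and ab: "\<And>n. AE x in \<mu>. absorbs P (real n) (A n) x"
    by metis
  show thesis
  proof (rule that[of "\<Union>n. A n"])
    show "(\<Union>n. A n) \<in> sets \<mu>" using A by auto
    have "emeasure \<mu> (\<Union>n. A n) \<le> (\<Sum>n. emeasure \<mu> (A n))"
      using A by (intro emeasure_subadditive_countably) auto
    also have "\<dots> \<le> (\<Sum>n. ennreal (\<eta> * (1/2) ^ Suc n))"
      by (intro suminf_le A) auto
    also have "\<dots> = ennreal \<eta>"
    proof (rule suminf_ennreal_eq)
      show "(\<lambda>n. \<eta> * (1/2) ^ Suc n) sums \<eta>"
        using sums_mult[OF power_half_series, of \<eta>] by simp
    qed (use \<eta> in auto)
    finally show "measure \<mu> (\<Union>n. A n) \<le> \<eta>"
      using \<eta> by (simp add: emeasure_eq_measure)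
    have "AE x in \<mu>. \<forall>n. absorbs P (real n) (A n) x"
      using ab by (simp add: AE_all_countable)
    then show "AE x in \<mu>. \<forall>T. absorbs P T (\<Union>n. A n) x"
    proof eventually_elim
      case (elim x)
      show ?case
      proof
        fix T :: real
        obtain n where "T \<le> real n" using real_arch_simple by blast
        with elim have "absorbs P T (A n) x" unfolding absorbs_def by (meson order_trans)
        then show "absorbs P T (\<Union>n. A n) x" by (rule absorbs_mono) auto
      qed
    qed
  qed
qed

end

section \<open>Change of variables for an arbitrary finite index type\<close>

text \<open>
  The change of variables theorem is stated for coordinates indexed by a well-ordered finite type, while
  charts have an arbitrary finite index type. A copy of the index type that is well-ordered through an
  injection into \<open>nat\<close>, together with the relabelling of coordinates, mediates between the two.
\<close>
typedef 'a wellordered = "UNIV :: 'a set"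
  by auto

instance wellordered :: (finite) finite
proof
  have "finite (Abs_wellordered ` (UNIV :: 'a set))" by simp
  moreover have "Abs_wellordered ` UNIV = (UNIV :: 'a wellordered set)"
    by (metis Abs_wellordered_cases surjI surj_def UNIV_I)
  ultimately show "finite (UNIV :: 'a wellordered set)" by simp
qed

lemma bij_Rep_wellordered: "bij Rep_wellordered"
  by (metis Abs_wellordered_inverse Rep_wellordered_inverse UNIV_I bijI')

definition wellordered_rank :: "'a::finite wellordered \<Rightarrow> nat" where
  "wellordered_rank = (SOME f. inj f)"

lemma inj_wellordered_rank: "inj wellordered_rank"
proof -
  have "\<exists>f :: 'a wellordered \<Rightarrow> nat. inj f"
    using finite_imp_inj_to_nat_seg[of "UNIV :: 'a wellordered set"] by auto
  then show ?thesis unfolding wellordered_rank_def by (rule someI_ex)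
qed

instantiation wellordered :: (finite) wellorder
begin

definition "x \<le> y \<longleftrightarrow> wellordered_rank x \<le> wellordered_rank y"
definition "x < y \<longleftrightarrow> wellordered_rank x < wellordered_rank y"

instance
proof
  fix P :: "'a wellordered \<Rightarrow> bool" and a :: "'a wellordered"
  assume "\<And>x. (\<And>y. y < x \<Longrightarrow> P y) \<Longrightarrow> P x"
  then show "P a"
    unfolding less_wellordered_def by (rule measure_induct_rule[of wellordered_rank P a])
qed (auto simp: less_eq_wellordered_def less_wellordered_def dest: injD[OF inj_wellordered_rank])

end

text \<open>
  Relabelling conjugates the permutations in the Leibniz formula, which does not change their signs.
\<close>
lemma det_reindex:
  fixes A :: "real ^ 'm ^ 'm" and \<beta> :: "'n::finite \<Rightarrow> 'm::finite"
  assumes \<beta>: "bij \<beta>"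
  shows "det (\<chi> i j. A $ \<beta> i $ \<beta> j :: real ^ 'n ^ 'n) = det A"
proof -
  have inj: "inj \<beta>" and surj: "surj \<beta>" using \<beta> by (auto simp: bij_def)
  have conj: "map_permutation UNIV \<beta> p = \<beta> \<circ> p \<circ> inv \<beta>" for p
    using surj by (auto simp: map_permutation_def restrict_id_def fun_eq_iff)
  have "det (\<chi> i j. A $ \<beta> i $ \<beta> j :: real ^ 'n ^ 'n)
      = (\<Sum>p | p permutes UNIV. of_int (sign p) * (\<Prod>i\<in>UNIV. A $ \<beta> i $ \<beta> (p i)))"
    by (simp add: det_def)
  also have "\<dots> = (\<Sum>p | p permutes UNIV. of_int (sign p) * (\<Prod>i\<in>UNIV. A $ i $ p i))"
  proof (rule sum.reindex_bij_witness[of _ "\<lambda>q. inv \<beta> \<circ> q \<circ> \<beta>" "\<lambda>p. \<beta> \<circ> p \<circ> inv \<beta>"])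
    fix p :: "'n \<Rightarrow> 'n" assume "p \<in> {p. p permutes UNIV}"
    then have p: "p permutes UNIV" by simp
    show "inv \<beta> \<circ> (\<beta> \<circ> p \<circ> inv \<beta>) \<circ> \<beta> = p"
      using inj by (auto simp: fun_eq_iff)
    show "\<beta> \<circ> p \<circ> inv \<beta> \<in> {p. p permutes UNIV}"
      using permutes_bij[OF p] \<beta> by (auto intro!: bij_imp_permutes bij_comp bij_imp_bij_inv)
    have "sign (\<beta> \<circ> p \<circ> inv \<beta>) = sign p"
      using sign_map_permutation[OF inj p] by (simp add: conj)
    moreover have "(\<Prod>i\<in>UNIV. A $ i $ (\<beta> \<circ> p \<circ> inv \<beta>) i) = (\<Prod>i\<in>UNIV. A $ \<beta> i $ \<beta> (p i))"
      by (rule prod.reindex_bij_betw[OF \<beta>, symmetric, THEN trans]) (simp add: inj)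
    ultimately show "of_int (sign (\<beta> \<circ> p \<circ> inv \<beta>)) * (\<Prod>i\<in>UNIV. A $ i $ (\<beta> \<circ> p \<circ> inv \<beta>) i)
        = of_int (sign p) * (\<Prod>i\<in>UNIV. A $ \<beta> i $ \<beta> (p i))" by simp
  next
    fix q :: "'m \<Rightarrow> 'm" assume "q \<in> {p. p permutes UNIV}"
    then have q: "q permutes UNIV" by simp
    show "\<beta> \<circ> (inv \<beta> \<circ> q \<circ> \<beta>) \<circ> inv \<beta> = q"
      using surj by (auto simp: fun_eq_iff surj_f_inv_f)
    show "inv \<beta> \<circ> q \<circ> \<beta> \<in> {p. p permutes UNIV}"
      using permutes_bij[OF q] \<beta> by (auto intro!: bij_imp_permutes bij_comp bij_imp_bij_inv)
  qed
  also have "\<dots> = det A" by (simp add: det_def)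
  finally show ?thesis .
qed

definition reindex_vec :: "('n \<Rightarrow> 'm) \<Rightarrow> real ^ 'm \<Rightarrow> real ^ 'n" where
  "reindex_vec \<beta> x = (\<chi> i. x $ \<beta> i)"

lemma reindex_vec_nth [simp]: "reindex_vec \<beta> x $ i = x $ \<beta> i"
  by (simp add: reindex_vec_def)

lemma linear_reindex_vec: "linear (reindex_vec \<beta> :: real ^ 'm::finite \<Rightarrow> real ^ 'n::finite)"
  by (auto intro!: linearI simp: vec_eq_iff)

lemma reindex_vec_inv:
  assumes "bij \<beta>"
  shows "reindex_vec (inv \<beta>) (reindex_vec \<beta> x) = x" "reindex_vec \<beta> (reindex_vec (inv \<beta>) y) = y"
  using assms by (auto simp: vec_eq_iff bij_is_surj surj_f_inv_f bij_is_inj)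

lemma borel_measurable_reindex_vec [measurable]:
  "(reindex_vec \<beta> :: real ^ 'm::finite \<Rightarrow> real ^ 'n::finite) \<in> borel_measurable borel"
  by (intro borel_measurable_continuous_onI linear_continuous_on linear_conv_bounded_linear[THEN iffD1] linear_reindex_vec)

lemma emeasure_lborel_box_cart:
  fixes l u :: "real ^ 'm::finite"
  assumes "\<And>i. l $ i \<le> u $ i"
  shows "emeasure lborel (box l u) = (\<Prod>i\<in>UNIV. u $ i - l $ i)"
proof -
  have le: "l \<bullet> b \<le> u \<bullet> b" if "b \<in> Basis" for b
    using that assms by (auto simp: Basis_vec_def inner_axis)
  have ne: "cbox l u \<noteq> {}" using assms by (auto simp: interval_ne_empty_cart)
  have "emeasure lborel (box l u) = emeasure lborel (cbox l u)"
    using le by (simp add: emeasure_lborel_box emeasure_lborel_cbox)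
  also have "\<dots> = ennreal (measure lborel (cbox l u))"
    by (rule emeasure_eq_ennreal_measure) (use emeasure_lborel_cbox_finite[of l u] in auto)
  also have "\<dots> = (\<Prod>i\<in>UNIV. u $ i - l $ i)"
    using content_cbox_cart[OF ne] by simp
  finally show ?thesis .
qed

text \<open>
  Relabelling permutes the side lengths of a box.
\<close>
lemma lborel_distr_reindex_vec:
  fixes \<beta> :: "'n::finite \<Rightarrow> 'm::finite"
  assumes \<beta>: "bij \<beta>"
  shows "distr lborel borel (reindex_vec \<beta> :: real ^ 'm \<Rightarrow> real ^ 'n) = lborel"
proof (rule lborel_eqI[symmetric])
  fix l u :: "real ^ 'n" assume le: "\<And>b. b \<in> Basis \<Longrightarrow> l \<bullet> b \<le> u \<bullet> b"
  have le': "l $ i \<le> u $ i" for i using le[of "axis i 1"] by (simp add: inner_axis)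
  have "reindex_vec \<beta> -` box l u = box (reindex_vec (inv \<beta>) l) (reindex_vec (inv \<beta>) u)"
  proof (intro set_eqI)
    fix x :: "real ^ 'm"
    have "(\<forall>i. l $ i < x $ \<beta> i \<and> x $ \<beta> i < u $ i) \<longleftrightarrow> (\<forall>j. l $ inv \<beta> j < x $ j \<and> x $ j < u $ inv \<beta> j)"
      using \<beta> by (metis bij_inv_eq_iff)
    then show "x \<in> reindex_vec \<beta> -` box l u \<longleftrightarrow> x \<in> box (reindex_vec (inv \<beta>) l) (reindex_vec (inv \<beta>) u)"
      by (simp add: mem_box_cart)
  qed
  then have "emeasure (distr lborel borel (reindex_vec \<beta>)) (box l u)
      = emeasure lborel (box (reindex_vec (inv \<beta>) l) (reindex_vec (inv \<beta>) u :: real ^ 'm))"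
    by (simp add: emeasure_distr)
  also have "\<dots> = (\<Prod>j\<in>UNIV. u $ inv \<beta> j - l $ inv \<beta> j)"
    using le' by (subst emeasure_lborel_box_cart) auto
  also have "(\<Prod>j\<in>UNIV. u $ inv \<beta> j - l $ inv \<beta> j) = (\<Prod>i\<in>UNIV. u $ i - l $ i)"
    using prod.reindex_bij_betw[OF bij_imp_bij_inv[OF \<beta>], of "\<lambda>i. u $ i - l $ i"] .
  also have "ennreal (\<Prod>i\<in>UNIV. u $ i - l $ i) = emeasure lborel (box l u)"
    using le' by (simp add: emeasure_lborel_box_cart)
  also have "\<dots> = (\<Prod>b\<in>Basis. (u - l) \<bullet> b)"
    using le by (rule emeasure_lborel_box)
  finally show "emeasure (distr lborel borel (reindex_vec \<beta>)) (box l u) = (\<Prod>b\<in>Basis. (u - l) \<bullet> b)" .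
qed simp

text \<open>
  There is nothing to prove when the right-hand side is infinite. Otherwise \<open>g\<close> is absolutely integrable
  over the image, and the change of variables theorem for vector-valued functions applies through
  \<open>real ^ 1\<close>.
\<close>
lemma nn_integral_change_of_variables_wellordered:
  fixes \<theta> :: "real ^ 'm::{finite,wellorder} \<Rightarrow> real ^ 'm::_" and g :: "real ^ 'm::_ \<Rightarrow> real"
  assumes S: "S \<in> sets borel"
    and der: "\<And>x. x \<in> S \<Longrightarrow> (\<theta> has_derivative \<theta>' x) (at x within S)"
    and inj: "inj_on \<theta> S"
    and g: "\<And>y. 0 \<le> g y" "(\<lambda>y. g y * indicator (\<theta> ` S) y) \<in> borel_measurable borel"
  shows "(\<integral>\<^sup>+x. ennreal (\<bar>det (matrix (\<theta>' x))\<bar> * g (\<theta> x)) * indicator S x \<partial>lborel)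
       \<le> (\<integral>\<^sup>+y. ennreal (g y) * indicator (\<theta> ` S) y \<partial>lborel)" (is "?L \<le> ?R")
proof (cases "?R = \<infinity>")
  case False
  let ?h = "\<lambda>x. \<bar>det (matrix (\<theta>' x))\<bar> * g (\<theta> x)"
  have R: "?R = (\<integral>\<^sup>+y. ennreal (g y * indicator (\<theta> ` S) y) \<partial>lborel)"
    by (intro nn_integral_cong) (auto split: split_indicator)
  have "integrable lborel (\<lambda>y. g y * indicator (\<theta> ` S) y)"
    by (rule integrableI_nonneg) (use g False R in \<open>auto simp: less_top[symmetric]\<close>)
  then have g_int: "g absolutely_integrable_on \<theta> ` S"
    unfolding set_integrable_def by (intro integrable_completion[THEN iffD2]) (auto simp: mult.commute)
  then have "(\<lambda>y. vec (g y) :: real ^ 1) absolutely_integrable_on \<theta> ` S"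
    using absolutely_integrable_linear[OF g_int, of "vec :: real \<Rightarrow> real ^ 1"]
    by (simp add: o_def linear_conv_bounded_linear[symmetric] linear_iff vec_eq_iff)
  then have *: "(\<lambda>x. \<bar>det (matrix (\<theta>' x))\<bar> *\<^sub>R (vec (g (\<theta> x)) :: real ^ 1)) absolutely_integrable_on S \<and>
      integral S (\<lambda>x. \<bar>det (matrix (\<theta>' x))\<bar> *\<^sub>R (vec (g (\<theta> x)) :: real ^ 1)) = integral (\<theta> ` S) (\<lambda>y. vec (g y))"
    using has_absolute_integral_change_of_variables[OF _ der inj, of "\<lambda>y. vec (g y) :: real ^ 1"] S by auto
  have bl: "bounded_linear (\<lambda>v::real^1. v $ 1)" by (rule bounded_linear_vec_nth)
  have h_int: "?h absolutely_integrable_on S"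
    using absolutely_integrable_linear[OF conjunct1[OF *] bl] by (simp add: o_def)
  have "integral S ?h = integral S ((\<lambda>v::real^1. v $ 1) \<circ> (\<lambda>x. \<bar>det (matrix (\<theta>' x))\<bar> *\<^sub>R vec (g (\<theta> x))))"
    by (simp add: o_def)
  also have "\<dots> = integral S (\<lambda>x. \<bar>det (matrix (\<theta>' x))\<bar> *\<^sub>R (vec (g (\<theta> x)) :: real ^ 1)) $ 1"
    using * by (intro integral_linear bl) (auto simp: absolutely_integrable_on_def)
  also have "\<dots> = integral (\<theta> ` S) (\<lambda>y. vec (g y) :: real ^ 1) $ 1"
    using * by simp
  also have "\<dots> = integral (\<theta> ` S) ((\<lambda>v::real^1. v $ 1) \<circ> (\<lambda>y. vec (g y)))"
    using \<open>(\<lambda>y. vec (g y) :: real ^ 1) absolutely_integrable_on \<theta> ` S\<close>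
    by (intro integral_linear[symmetric] bl) (auto simp: absolutely_integrable_on_def)
  finally have eq: "integral S ?h = integral (\<theta> ` S) g" by (simp add: o_def)
  have nn: "(\<integral>\<^sup>+x. ennreal (f x) * indicator Y x \<partial>lborel) = ennreal (integral Y f)"
    if f: "f absolutely_integrable_on Y" and f0: "\<And>x. 0 \<le> f x" for f :: "real ^ 'm::_ \<Rightarrow> real" and Y
  proof -
    have "(\<integral>\<^sup>+x. ennreal (f x) * indicator Y x \<partial>lborel) = (\<integral>\<^sup>+x. ennreal (indicator Y x *\<^sub>R f x) \<partial>lebesgue)"
      unfolding nn_integral_completion by (intro nn_integral_cong) (auto split: split_indicator)
    also have "\<dots> = ennreal (\<integral>x. indicator Y x *\<^sub>R f x \<partial>lebesgue)"
      using f f0 unfolding set_integrable_def by (intro nn_integral_eq_integral) auto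
    also have "(\<integral>x. indicator Y x *\<^sub>R f x \<partial>lebesgue) = integral Y f"
      using set_lebesgue_integral_eq_integral(2)[OF f] by (simp add: set_lebesgue_integral_def)
    finally show ?thesis .
  qed
  show ?thesis using nn[OF h_int] nn[OF g_int] g(1) eq by simp
qed simp

text \<open>
  Conjugating \<open>\<theta>\<close> with the relabelling of coordinates changes neither Lebesgue measure nor the
  Jacobian determinant.
\<close>
lemma nn_integral_change_of_variables_le:
  fixes \<theta> :: "real ^ 'm::finite \<Rightarrow> real ^ 'm::finite" and g :: "real ^ 'm \<Rightarrow> real"
  assumes S: "S \<in> sets borel"
    and der: "\<And>x. x \<in> S \<Longrightarrow> (\<theta> has_derivative \<theta>' x) (at x within S)"
    and inj: "inj_on \<theta> S"
    and g: "\<And>y. 0 \<le> g y" "(\<lambda>y. g y * indicator (\<theta> ` S) y) \<in> borel_measurable borel"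
    and h: "(\<lambda>x. ennreal (\<bar>det (matrix (\<theta>' x))\<bar> * g (\<theta> x)) * indicator S x) \<in> borel_measurable borel"
  shows "(\<integral>\<^sup>+x. ennreal (\<bar>det (matrix (\<theta>' x))\<bar> * g (\<theta> x)) * indicator S x \<partial>lborel)
       \<le> (\<integral>\<^sup>+y. ennreal (g y) * indicator (\<theta> ` S) y \<partial>lborel)"
proof -
  define \<rho> where "\<rho> = (reindex_vec Rep_wellordered :: real ^ 'm \<Rightarrow> real ^ 'm wellordered)"
  define \<sigma> where "\<sigma> = (reindex_vec (inv Rep_wellordered) :: real ^ 'm wellordered \<Rightarrow> real ^ 'm)"
  have [simp]: "\<sigma> (\<rho> x) = x" "\<rho> (\<sigma> y) = y" for x y
    unfolding \<rho>_def \<sigma>_def by (simp_all add: reindex_vec_inv bij_Rep_wellordered)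
  have [measurable]: "\<rho> \<in> borel_measurable borel" "\<sigma> \<in> borel_measurable borel"
    unfolding \<rho>_def \<sigma>_def by measurable
  have lin: "bounded_linear \<rho>" "bounded_linear \<sigma>"
    unfolding \<rho>_def \<sigma>_def by (simp_all add: linear_conv_bounded_linear[symmetric] linear_reindex_vec)
  have transfer: "(\<integral>\<^sup>+y. F (\<sigma> y) \<partial>lborel) = (\<integral>\<^sup>+x. F x \<partial>lborel)" if "F \<in> borel_measurable borel" for F
  proof -
    have "(\<integral>\<^sup>+y. F (\<sigma> y) \<partial>lborel) = (\<integral>\<^sup>+y. F (\<sigma> y) \<partial>distr lborel borel \<rho>)"
      unfolding \<rho>_def by (simp add: lborel_distr_reindex_vec bij_Rep_wellordered)
    also have "\<dots> = (\<integral>\<^sup>+x. F x \<partial>lborel)"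
      using that by (subst nn_integral_distr) auto
    finally show ?thesis .
  qed
  define \<Theta> where "\<Theta> = \<rho> \<circ> \<theta> \<circ> \<sigma>"
  define \<Theta>' where "\<Theta>' y = \<rho> \<circ> \<theta>' (\<sigma> y) \<circ> \<sigma>" for y
  have im: "\<Theta> ` (\<sigma> -` S) = \<sigma> -` (\<theta> ` S)"
  proof (intro set_eqI iffI)
    fix y assume "y \<in> \<sigma> -` (\<theta> ` S)"
    then obtain x where "x \<in> S" "\<sigma> y = \<theta> x" by auto
    then have "\<rho> (\<sigma> y) = \<Theta> (\<rho> x)" "\<rho> x \<in> \<sigma> -` S" by (simp_all add: \<Theta>_def)
    then show "y \<in> \<Theta> ` (\<sigma> -` S)" by simp
  qed (auto simp: \<Theta>_def)
  have det: "det (matrix (\<Theta>' y)) = det (matrix (\<theta>' (\<sigma> y)))" for y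
  proof -
    have basis: "\<sigma> (axis j 1) = axis (Rep_wellordered j) 1" for j
      by (simp add: \<sigma>_def vec_eq_iff axis_def bij_inv_eq_iff[OF bij_Rep_wellordered] eq_commute)
    have "matrix (\<Theta>' y) $ i $ j = matrix (\<theta>' (\<sigma> y)) $ Rep_wellordered i $ Rep_wellordered j" for i j
      by (simp add: matrix_def \<Theta>'_def \<rho>_def basis)
    then have "matrix (\<Theta>' y) = (\<chi> i j. matrix (\<theta>' (\<sigma> y)) $ Rep_wellordered i $ Rep_wellordered j)"
      by (simp add: vec_eq_iff)
    then show ?thesis by (simp add: det_reindex bij_Rep_wellordered)
  qed
  have "(\<integral>\<^sup>+y. ennreal (\<bar>det (matrix (\<Theta>' y))\<bar> * g (\<sigma> (\<Theta> y))) * indicator (\<sigma> -` S) y \<partial>lborel)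
      \<le> (\<integral>\<^sup>+z. ennreal (g (\<sigma> z)) * indicator (\<Theta> ` (\<sigma> -` S)) z \<partial>lborel)"
  proof (rule nn_integral_change_of_variables_wellordered)
    show "\<sigma> -` S \<in> sets borel" using measurable_sets[of \<sigma> borel borel S] S by simp
    show "inj_on \<Theta> (\<sigma> -` S)"
    proof (rule inj_onI)
      fix a b assume ab: "a \<in> \<sigma> -` S" "b \<in> \<sigma> -` S" "\<Theta> a = \<Theta> b"
      then have "\<sigma> (\<rho> (\<theta> (\<sigma> a))) = \<sigma> (\<rho> (\<theta> (\<sigma> b)))" by (simp add: \<Theta>_def)
      then have "\<sigma> a = \<sigma> b" using ab inj by (auto dest: inj_onD)
      then have "\<rho> (\<sigma> a) = \<rho> (\<sigma> b)" by simp
      then show "a = b" by simp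
    qed
    show "0 \<le> g (\<sigma> y)" for y by (rule g)
    have "(\<lambda>z. (\<lambda>y. g y * indicator (\<theta> ` S) y) (\<sigma> z)) \<in> borel_measurable borel"
      by (rule measurable_compose[OF _ g(2)]) measurable
    then show "(\<lambda>z. g (\<sigma> z) * indicator (\<Theta> ` (\<sigma> -` S)) z) \<in> borel_measurable borel"
      by (simp add: im indicator_vimage[unfolded comp_def])
    fix y assume y: "y \<in> \<sigma> -` S"
    have sub: "\<sigma> ` (\<sigma> -` S) \<subseteq> S" and yS: "\<sigma> y \<in> S" using y by auto
    have 1: "((\<lambda>y. \<theta> (\<sigma> y)) has_derivative (\<lambda>h. \<theta>' (\<sigma> y) (\<sigma> h))) (at y within \<sigma> -` S)"
      by (rule has_derivative_in_compose[OF bounded_linear_imp_has_derivative[OF lin(2)]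
            has_derivative_subset[OF der[OF yS] sub]])
    show "(\<Theta> has_derivative \<Theta>' y) (at y within \<sigma> -` S)"
      using bounded_linear.has_derivative[OF lin(1) 1] by (simp add: \<Theta>_def \<Theta>'_def o_def)
  qed
  also have "\<dots> = (\<integral>\<^sup>+z. (\<lambda>y. ennreal (g y) * indicator (\<theta> ` S) y) (\<sigma> z) \<partial>lborel)"
    by (intro nn_integral_cong) (auto simp: im split: split_indicator)
  also have "\<dots> = (\<integral>\<^sup>+y. ennreal (g y) * indicator (\<theta> ` S) y \<partial>lborel)"
  proof (rule transfer)
    have "(\<lambda>y. ennreal (g y * indicator (\<theta> ` S) y)) \<in> borel_measurable borel" using g(2) by measurable
    also have "(\<lambda>y. ennreal (g y * indicator (\<theta> ` S) y)) = (\<lambda>y. ennreal (g y) * indicator (\<theta> ` S) y)"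
      by (auto simp: fun_eq_iff split: split_indicator)
    finally show "(\<lambda>y. ennreal (g y) * indicator (\<theta> ` S) y) \<in> borel_measurable borel" .
  qed
  also have "(\<integral>\<^sup>+y. ennreal (\<bar>det (matrix (\<Theta>' y))\<bar> * g (\<sigma> (\<Theta> y))) * indicator (\<sigma> -` S) y \<partial>lborel)
      = (\<integral>\<^sup>+y. (\<lambda>x. ennreal (\<bar>det (matrix (\<theta>' x))\<bar> * g (\<theta> x)) * indicator S x) (\<sigma> y) \<partial>lborel)"
    by (intro nn_integral_cong) (auto simp: det \<Theta>_def split: split_indicator)
  also have "\<dots> = (\<integral>\<^sup>+x. ennreal (\<bar>det (matrix (\<theta>' x))\<bar> * g (\<theta> x)) * indicator S x \<partial>lborel)"
    by (rule transfer) (rule h)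
  finally show ?thesis .
qed

section \<open>Charts and transition maps\<close>

text \<open>
  A continuous lift of a differentiable map through an immersion is differentiable. After composing with a
  left inverse of \<open>g'\<close> one may assume that \<open>g\<close> has derivative \<open>id\<close>. Then \<open>g (\<theta> y) - g (\<theta> x)\<close> differs
  from \<open>\<theta> y - \<theta> x\<close> by at most half of its norm for \<open>y\<close> near \<open>x\<close>, which makes \<open>\<theta>\<close> Lipschitz at \<open>x\<close>, and with this the
  error terms are of the required order. Applied to transition maps between charts it replaces the
  inverse function theorem.
\<close>
lemma has_derivative_lift:
  fixes g :: "'b::euclidean_space \<Rightarrow> 'c::euclidean_space" and h :: "'a::real_normed_vector \<Rightarrow> 'c"
  assumes g: "(g has_derivative g') (at (\<theta> x))" and inj: "inj g'"
    and h: "(h has_derivative h') (at x)" and cont: "isCont \<theta> x"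
    and U: "open U" "x \<in> U" "\<And>y. y \<in> U \<Longrightarrow> g (\<theta> y) = h y"
  obtains \<theta>' where "(\<theta> has_derivative \<theta>') (at x)" "g' \<circ> \<theta>' = h'"
proof -
  obtain L where L: "linear L" "L \<circ> g' = id"
    using linear_injective_left_inverse[OF has_derivative_linear[OF g] inj] by auto
  have bL: "bounded_linear L" using L(1) by (rule linear_conv_bounded_linear[THEN iffD1])
  define G where "G = L \<circ> g"
  define H where "H = L \<circ> h"
  have "(G has_derivative (L \<circ> g')) (at (\<theta> x))"
    unfolding G_def o_def by (rule bounded_linear.has_derivative[OF bL g])
  then have G: "(G has_derivative (\<lambda>v. v)) (at (\<theta> x))" by (simp add: L(2) id_def)
  have H: "(H has_derivative (L \<circ> h')) (at x)"
    unfolding H_def o_def by (rule bounded_linear.has_derivative[OF bL h])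
  have bLh: "bounded_linear (L \<circ> h')" by (rule has_derivative_bounded_linear[OF H])
  obtain B where B: "B > 0" "\<And>v. norm ((L \<circ> h') v) \<le> B * norm v"
    using bounded_linear.pos_bounded[OF bLh] by (metis mult.commute)
  have GH: "G (\<theta> y) = H y" if "y \<in> U" for y using U(3)[OF that] by (simp add: G_def H_def)
  have \<theta>: "(\<theta> has_derivative (L \<circ> h')) (at x)"
    unfolding has_derivative_at_alt
  proof (intro conjI allI impI bLh)
    fix e :: real assume e: "e > 0"
    \<comment> \<open>With \<open>a\<close> the norm of \<open>\<theta> y - \<theta> x\<close> and \<open>n\<close> that of \<open>y - x\<close>, the bound \<open>a \<le> 2 * (B + 1) * n\<close>
      turns the error \<open>e2 * n + e1 * a\<close> into at most \<open>e * n\<close>.\<close>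
    define e1 where "e1 = min (1/2) (e / (4 * (B + 1)))"
    define e2 where "e2 = min 1 (e / 4)"
    have e1: "e1 > 0" "e1 \<le> 1/2" "e1 * (2 * (B + 1)) \<le> e / 2"
    proof -
      show "e1 > 0" using e B(1) by (auto simp: e1_def)
      show "e1 \<le> 1/2" unfolding e1_def by (rule min.cobounded1)
      have "e1 * (2 * (B + 1)) \<le> e / (4 * (B + 1)) * (2 * (B + 1))"
        using B(1) by (intro mult_right_mono) (auto simp: e1_def)
      also have "\<dots> = e / 2" using B(1) by (simp add: field_simps)
      finally show "e1 * (2 * (B + 1)) \<le> e / 2" .
    qed
    have e2: "e2 > 0" "e2 \<le> 1" "e2 \<le> e / 4" using e by (auto simp: e2_def)
    obtain d1 where d1: "d1 > 0"
      "\<forall>z. norm (z - \<theta> x) < d1 \<longrightarrow> norm (G z - G (\<theta> x) - (z - \<theta> x)) \<le> e1 * norm (z - \<theta> x)"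
      using conjunct2[OF G[unfolded has_derivative_at_alt], rule_format, OF e1(1)] by blast
    obtain d2 where d2: "d2 > 0"
      "\<forall>y. norm (y - x) < d2 \<longrightarrow> norm (H y - H x - (L \<circ> h') (y - x)) \<le> e2 * norm (y - x)"
      using conjunct2[OF H[unfolded has_derivative_at_alt], rule_format, OF e2(1)] by blast
    obtain d3 where d3: "d3 > 0" "\<forall>y. norm (y - x) < d3 \<longrightarrow> norm (\<theta> y - \<theta> x) < d1"
      using cont[unfolded continuous_at_eps_delta dist_norm, rule_format, OF d1(1)] by blast
    obtain d4 where d4: "d4 > 0" "\<forall>y. norm (y - x) < d4 \<longrightarrow> y \<in> U"
      using U(1)[unfolded open_dist dist_norm, rule_format, OF U(2)] by blast
    show "\<exists>d>0. \<forall>y. norm (y - x) < d \<longrightarrow> norm (\<theta> y - \<theta> x - (L \<circ> h') (y - x)) \<le> e * norm (y - x)"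
    proof (intro exI[of _ "min d2 (min d3 d4)"] conjI allI impI)
      show "0 < min d2 (min d3 d4)" using d2 d3 d4 by simp
      fix y assume "norm (y - x) < min d2 (min d3 d4)"
      then have y: "norm (y - x) < d2" "norm (y - x) < d3" "norm (y - x) < d4" by auto
      define a where "a = norm (\<theta> y - \<theta> x)"
      define n where "n = norm (y - x)"
      have *: "norm (H y - H x - (\<theta> y - \<theta> x)) \<le> e1 * a"
        using d1(2)[rule_format, OF d3(2)[rule_format, OF y(2)]] GH[OF d4(2)[rule_format, OF y(3)]] GH[OF U(2)] by (simp add: a_def)
      have **: "norm (H y - H x - (L \<circ> h') (y - x)) \<le> e2 * n"
        using d2(2)[rule_format, OF y(1)] by (simp add: n_def)
      have Hn: "norm (H y - H x) \<le> (B + 1) * n"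
      proof -
        have "norm (H y - H x) \<le> norm (H y - H x - (L \<circ> h') (y - x)) + norm ((L \<circ> h') (y - x))"
          using norm_triangle_sub[of "H y - H x" "(L \<circ> h') (y - x)"] by simp
        also have "\<dots> \<le> e2 * n + B * n" using ** B(2)[of "y - x"] by (simp add: n_def)
        also have "\<dots> \<le> (B + 1) * n" using e2(2) mult_right_mono[of e2 1 n] by (simp add: n_def algebra_simps)
        finally show ?thesis .
      qed
      have "a \<le> norm (H y - H x) + norm (H y - H x - (\<theta> y - \<theta> x))"
        unfolding a_def using norm_triangle_ineq4[of "H y - H x" "H y - H x - (\<theta> y - \<theta> x)"] by simp
      also have "\<dots> \<le> (B + 1) * n + e1 * a" using Hn * by simp
      also have "e1 * a \<le> 1/2 * a" by (rule mult_right_mono[OF e1(2)]) (simp add: a_def)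
      finally have a: "a \<le> 2 * (B + 1) * n" by (simp add: algebra_simps)
      have "\<theta> y - \<theta> x - (L \<circ> h') (y - x) = (H y - H x - (L \<circ> h') (y - x)) - (H y - H x - (\<theta> y - \<theta> x))"
        by simp
      then have "norm (\<theta> y - \<theta> x - (L \<circ> h') (y - x))
          \<le> norm (H y - H x - (L \<circ> h') (y - x)) + norm (H y - H x - (\<theta> y - \<theta> x))"
        by (simp only: norm_triangle_ineq4)
      also have "\<dots> \<le> e2 * n + e1 * a" using * ** by linarith
      also have "e2 * n + e1 * a \<le> e / 4 * n + e / 2 * n"
      proof (intro add_mono)
        show "e2 * n \<le> e / 4 * n" by (rule mult_right_mono[OF e2(3)]) (simp add: n_def)
        have "e1 * a \<le> e1 * (2 * (B + 1) * n)" by (rule mult_left_mono[OF a]) (use e1(1) in simp)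
        also have "\<dots> = e1 * (2 * (B + 1)) * n" by simp
        also have "\<dots> \<le> e / 2 * n" by (rule mult_right_mono[OF e1(3)]) (simp add: n_def)
        finally show "e1 * a \<le> e / 2 * n" .
      qed
      also have "\<dots> \<le> e * n"
        using e mult_nonneg_nonneg[of e n] by (simp add: n_def)
      finally show "norm (\<theta> y - \<theta> x - (L \<circ> h') (y - x)) \<le> e * norm (y - x)" by (simp add: n_def)
    qed
  qed
  have "((\<lambda>y. g (\<theta> y)) has_derivative (\<lambda>v. g' ((L \<circ> h') v))) (at x)"
    by (rule has_derivative_compose[OF \<theta> g])
  then have "(h has_derivative (\<lambda>v. g' ((L \<circ> h') v))) (at x)"
    by (rule has_derivative_transform_within_open[OF _ U(1,2)]) (rule U(3))
  then have "h' = (\<lambda>v. g' ((L \<circ> h') v))" by (rule has_derivative_unique[OF h])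
  then show thesis using that[OF \<theta>] by (auto simp: o_def)
qed

lemma borel_Int_vimage:
  assumes "W \<in> sets borel" "continuous_on W f" "B \<in> sets borel"
  shows "W \<inter> f -` B \<in> sets borel"
proof -
  have "f \<in> borel_measurable (restrict_space borel W)"
    using assms(2) by (rule borel_measurable_continuous_on_restrict)
  from measurable_sets[OF this assms(3)] show ?thesis
    using assms(1) by (auto simp: space_restrict_space sets_restrict_space_iff Int_commute)
qed

locale chart =
  fixes M :: "(real ^ 'd::finite) set" and W :: "(real ^ 'm::finite) set" and \<phi> :: "real ^ 'm \<Rightarrow> real ^ 'd"
  assumes chart: "C1_chart M W \<phi>"
begin

abbreviation deriv_at :: "real ^ 'm \<Rightarrow> real ^ 'm \<Rightarrow> real ^ 'd" where
  "deriv_at x \<equiv> frechet_derivative \<phi> (at x)"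

lemmas chart_unfolded = chart[unfolded C1_chart_def]

lemma image_open: "openin (top_of_set M) (\<phi> ` W)"
  using chart_unfolded by (elim conjE)

lemma image_subset: "\<phi> ` W \<subseteq> M"
  by (rule openin_imp_subset[OF image_open])

lemma halfspace: obtains i V where "open V" "W = {x. 0 \<le> x $ i} \<inter> V"
proof -
  have "\<exists>i. openin (top_of_set {x. 0 \<le> x $ i}) W"
    using chart_unfolded by (elim conjE)
  then show thesis using that by (auto simp: openin_open)
qed

lemma W_borel [measurable]: "W \<in> sets borel"
proof -
  obtain i V where V: "open V" "W = {x. 0 \<le> x $ i} \<inter> V" by (rule halfspace)
  have "closed {x :: real ^ 'm. 0 \<le> x $ i}" by (intro closed_Collect_le continuous_intros)
  then show ?thesis using V by (auto intro: borel_closed borel_open)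
qed

lemma differentiable_nbhd:
  obtains U where "open U" "W \<subseteq> U" "\<And>x. x \<in> U \<Longrightarrow> (\<phi> has_derivative deriv_at x) (at x)"
    "continuous_on U (\<lambda>x. jacobian \<phi> (at x))"
proof -
  obtain U where U: "open U" "W \<subseteq> U" "\<phi> differentiable_on U" "continuous_on U (\<lambda>x. jacobian \<phi> (at x))"
    using conjunct1[OF conjunct2[OF chart_unfolded]] by auto
  then have "(\<phi> has_derivative deriv_at x) (at x)" if "x \<in> U" for x
    using that frechet_derivative_works at_within_open[OF that U(1)] by (metis differentiable_on_def)
  with U show thesis by (intro that)
qed

lemma has_deriv_at: "x \<in> W \<Longrightarrow> (\<phi> has_derivative deriv_at x) (at x)"
  by (rule differentiable_nbhd) blast

lemma inj_deriv: "x \<in> W \<Longrightarrow> inj (deriv_at x)"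
  using conjunct1[OF conjunct2[OF conjunct2[OF chart_unfolded]]] by auto

lemma homeo: obtains \<psi> where "homeomorphism W (\<phi> ` W) \<phi> \<psi>"
  using conjunct1[OF conjunct2[OF conjunct2[OF conjunct2[OF chart_unfolded]]]] by auto

lemma cont: "continuous_on W \<phi>"
  by (rule homeo) (simp add: homeomorphism_def)

lemma inverse: obtains \<psi> where "continuous_on (\<phi> ` W) \<psi>" "\<And>x. x \<in> W \<Longrightarrow> \<psi> (\<phi> x) = x"
proof -
  obtain \<psi> where "homeomorphism W (\<phi> ` W) \<phi> \<psi>" by (rule homeo)
  then show thesis using that[of \<psi>] by (simp add: homeomorphism_def)
qed

lemma vimage_borel: "B \<in> sets borel \<Longrightarrow> W \<inter> \<phi> -` B \<in> sets borel"
  by (rule borel_Int_vimage[OF W_borel cont])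

lemma image_eq_open: obtains T where "open T" "\<phi> ` W = M \<inter> T"
  using image_open that by (auto simp: openin_open)

lemma density_continuous: "continuous_on W (volume_density \<phi>)"
proof -
  obtain U where U: "open U" "W \<subseteq> U" "continuous_on U (\<lambda>x. jacobian \<phi> (at x))"
    by (rule differentiable_nbhd)
  have c: "continuous_on W (\<lambda>x. jacobian \<phi> (at x))" using U continuous_on_subset by blast
  have entries: "continuous_on W (\<lambda>x. jacobian \<phi> (at x) $ i $ j)" for i j
    by (intro continuous_intros c)
  show ?thesis
    unfolding volume_density_def[abs_def] det_def matrix_matrix_mult_def transpose_def vec_lambda_beta
    by (intro continuous_on_real_sqrt continuous_on_sum continuous_on_prod continuous_on_mult
        continuous_on_const entries)
qed

lemma density_measurable:
  assumes "Y \<in> sets borel" "Y \<subseteq> W"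
  shows "(\<lambda>x. volume_density \<phi> x * indicator Y x) \<in> borel_measurable borel"
    "(\<lambda>x. ennreal (volume_density \<phi> x) * indicator Y x) \<in> borel_measurable borel"
proof -
  have "volume_density \<phi> \<in> borel_measurable (restrict_space borel Y)"
    by (intro borel_measurable_continuous_on_restrict continuous_on_subset[OF density_continuous] assms)
  then show *: "(\<lambda>x. volume_density \<phi> x * indicator Y x) \<in> borel_measurable borel"
    by (subst (asm) borel_measurable_restrict_space_iff) (use assms in \<open>auto simp: mult.commute\<close>)
  have "(\<lambda>x. ennreal (volume_density \<phi> x * indicator Y x)) \<in> borel_measurable borel" using * by measurable
  also have "(\<lambda>x. ennreal (volume_density \<phi> x * indicator Y x)) = (\<lambda>x. ennreal (volume_density \<phi> x) * indicator Y x)"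
    by (auto simp: fun_eq_iff split: split_indicator)
  finally show "(\<lambda>x. ennreal (volume_density \<phi> x) * indicator Y x) \<in> borel_measurable borel" .
qed

end

text \<open>
  The Gram matrix of \<open>\<phi>1\<close> is that of \<open>\<phi>2\<close> multiplied by \<open>A\<close> and its transpose.
\<close>
lemma volume_density_transition:
  fixes \<phi>1 :: "real ^ 'm::finite \<Rightarrow> real ^ 'd::finite" and \<phi>2 :: "real ^ 'm \<Rightarrow> real ^ 'd"
  assumes "linear (frechet_derivative \<phi>2 (at y))" "linear A"
    "frechet_derivative \<phi>2 (at y) \<circ> A = frechet_derivative \<phi>1 (at x)"
  shows "volume_density \<phi>1 x = \<bar>det (matrix A)\<bar> * volume_density \<phi>2 y"
proof -
  let ?J = "jacobian \<phi>2 (at y)"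
  have "jacobian \<phi>1 (at x) = ?J ** matrix A"
    unfolding jacobian_def assms(3)[symmetric] by (rule matrix_compose[OF assms(2,1)])
  then have "transpose (jacobian \<phi>1 (at x)) ** jacobian \<phi>1 (at x)
      = transpose (matrix A) ** ((transpose ?J ** ?J) ** matrix A)"
    by (simp add: matrix_transpose_mul matrix_mul_assoc)
  then have "det (transpose (jacobian \<phi>1 (at x)) ** jacobian \<phi>1 (at x))
      = (det (matrix A))\<^sup>2 * det (transpose ?J ** ?J)"
    by (simp add: det_mul power2_eq_square)
  then show ?thesis by (simp add: volume_density_def real_sqrt_mult)
qed

lemma AE_coordinate_nonzero: "AE x :: real ^ 'm::finite in lborel. x $ i \<noteq> 0"
proof -
  have "negligible {x :: real ^ 'm. axis i 1 \<bullet> x = 0}"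
    by (rule negligible_hyperplane) simp
  then have "{x :: real ^ 'm. x $ i = 0} \<in> null_sets lebesgue"
    by (simp add: inner_axis' negligible_iff_null_sets)
  moreover have "closed {x :: real ^ 'm. x $ i = 0}"
    by (intro closed_Collect_eq continuous_intros)
  ultimately have "{x :: real ^ 'm. x $ i = 0} \<in> null_sets lborel"
    by (simp add: null_sets_def borel_closed)
  then show ?thesis by (auto dest: AE_not_in)
qed

text \<open>
  Change of variables for the transition map \<open>\<theta>\<close>, used at parameters \<open>x\<close> in the interior of the
  half-space only; the bounding hyperplane is a null set. There \<open>\<theta>\<close> is differentiable as the lift of
  \<open>\<phi>1\<close> through the immersion \<open>\<phi>2\<close>. As the claim is an inequality, it does not matter whether \<open>\<theta>\<close> maps
  interior parameters to interior ones; the reverse inequality comes from exchanging the charts.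
\<close>
lemma chart_integral_le:
  fixes \<phi>1 :: "real ^ 'm::finite \<Rightarrow> real ^ 'd::finite" and \<phi>2 :: "real ^ 'm \<Rightarrow> real ^ 'd"
  assumes c1: "C1_chart M W1 \<phi>1" and c2: "C1_chart M W2 \<phi>2"
    and B: "B \<in> sets borel" "B \<subseteq> \<phi>1 ` W1 \<inter> \<phi>2 ` W2"
  shows "(\<integral>\<^sup>+x\<in>W1 \<inter> \<phi>1 -` B. ennreal (volume_density \<phi>1 x) \<partial>lborel)
       \<le> (\<integral>\<^sup>+x\<in>W2 \<inter> \<phi>2 -` B. ennreal (volume_density \<phi>2 x) \<partial>lborel)"
proof -
  interpret c1: chart M W1 \<phi>1 by unfold_locales (rule c1)
  interpret c2: chart M W2 \<phi>2 by unfold_locales (rule c2)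
  obtain i V where V: "open V" "W1 = {x. 0 \<le> x $ i} \<inter> V" by (rule c1.halfspace)
  obtain T where T: "open T" "\<phi>2 ` W2 = M \<inter> T" by (rule c2.image_eq_open)
  obtain \<psi>1 where \<psi>1: "continuous_on (\<phi>1 ` W1) \<psi>1" "\<And>x. x \<in> W1 \<Longrightarrow> \<psi>1 (\<phi>1 x) = x" by (rule c1.inverse) (rule that)
  obtain \<psi>2 where \<psi>2: "continuous_on (\<phi>2 ` W2) \<psi>2" "\<And>x. x \<in> W2 \<Longrightarrow> \<psi>2 (\<phi>2 x) = x" by (rule c2.inverse) (rule that)
  define \<theta> where "\<theta> = \<psi>2 \<circ> \<phi>1"
  define I where "I = {x. 0 < x $ i} \<inter> V"
  have I: "open I" "I \<subseteq> W1"
    using V by (auto simp: I_def intro!: open_Int open_Collect_less continuous_intros)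
  define \<Omega> where "\<Omega> = I \<inter> \<phi>1 -` T"
  have \<Omega>: "open \<Omega>"
    unfolding \<Omega>_def by (rule continuous_open_preimage[OF continuous_on_subset[OF c1.cont I(2)] I(1) T(1)])
  have \<Omega>_im: "\<phi>1 x \<in> \<phi>2 ` W2" if "x \<in> \<Omega>" for x
  proof -
    have "\<phi>1 x \<in> \<phi>1 ` W1" "\<phi>1 x \<in> T" using that I(2) by (auto simp: \<Omega>_def)
    then show ?thesis using T(2) c1.image_subset by blast
  qed
  have \<theta>: "\<theta> x \<in> W2" "\<phi>2 (\<theta> x) = \<phi>1 x" if "x \<in> \<Omega>" for x
    using \<Omega>_im[OF that] \<psi>2(2) by (auto simp: \<theta>_def)
  have \<Omega>W: "\<Omega> \<subseteq> W1" using I(2) by (auto simp: \<Omega>_def)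
  have "continuous_on \<Omega> \<theta>"
    unfolding \<theta>_def
    by (rule continuous_on_compose[OF continuous_on_subset[OF c1.cont \<Omega>W]])
       (rule continuous_on_subset[OF \<psi>2(1)], use \<Omega>_im in auto)
  then have \<theta>_cont: "isCont \<theta> x" if "x \<in> \<Omega>" for x
    using that \<Omega> by (simp add: continuous_on_eq_continuous_at)
  have "\<exists>\<theta>'. (\<theta> has_derivative \<theta>') (at x) \<and> c2.deriv_at (\<theta> x) \<circ> \<theta>' = c1.deriv_at x" if x: "x \<in> \<Omega>" for x
  proof -
    have "x \<in> W1" using x \<Omega>W by auto
    show ?thesis
      by (rule has_derivative_lift[OF c2.has_deriv_at c2.inj_deriv c1.has_deriv_at \<theta>_cont \<Omega> x])
         (use x \<theta> \<open>x \<in> W1\<close> in auto)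
  qed
  then obtain \<theta>' where \<theta>': "\<And>x. x \<in> \<Omega> \<Longrightarrow> (\<theta> has_derivative \<theta>' x) (at x)"
    "\<And>x. x \<in> \<Omega> \<Longrightarrow> c2.deriv_at (\<theta> x) \<circ> \<theta>' x = c1.deriv_at x"
    by metis
  have J: "volume_density \<phi>1 x = \<bar>det (matrix (\<theta>' x))\<bar> * volume_density \<phi>2 (\<theta> x)" if "x \<in> \<Omega>" for x
    using that \<theta> \<theta>' by (intro volume_density_transition has_derivative_linear[OF c2.has_deriv_at] has_derivative_linear[OF \<theta>'(1)]) auto
  define S where "S = \<Omega> \<inter> \<phi>1 -` B"
  have S: "S \<in> sets borel"
  proof -
    have "S = \<Omega> \<inter> (W1 \<inter> \<phi>1 -` B)" using \<Omega>W by (auto simp: S_def)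
    then show ?thesis using \<Omega> c1.vimage_borel[OF B(1)] by (auto intro: borel_open)
  qed
  have W2B: "W2 \<inter> \<phi>2 -` B \<in> sets borel" by (rule c2.vimage_borel[OF B(1)])
  have im: "\<theta> ` S = (W2 \<inter> \<phi>2 -` B) \<inter> (\<lambda>y. \<psi>1 (\<phi>2 y)) -` {x. 0 < x $ i}"
  proof (intro set_eqI iffI)
    fix y assume "y \<in> \<theta> ` S"
    then obtain x where x: "x \<in> S" "y = \<theta> x" by auto
    then have "\<phi>2 y = \<phi>1 x" "y \<in> W2" "x \<in> W1" using \<theta> \<Omega>W by (auto simp: S_def)
    then show "y \<in> (W2 \<inter> \<phi>2 -` B) \<inter> (\<lambda>y. \<psi>1 (\<phi>2 y)) -` {x. 0 < x $ i}"
      using x \<psi>1(2) by (auto simp: S_def \<Omega>_def I_def)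
  next
    fix y assume y: "y \<in> (W2 \<inter> \<phi>2 -` B) \<inter> (\<lambda>y. \<psi>1 (\<phi>2 y)) -` {x. 0 < x $ i}"
    then obtain x where x: "x \<in> W1" "\<phi>2 y = \<phi>1 x" using B(2) by auto
    then have "x = \<psi>1 (\<phi>2 y)" using \<psi>1(2) by simp
    then have "x \<in> I" using y x V by (auto simp: I_def)
    moreover have "\<phi>1 x \<in> T" using x y T by (metis IntD1 IntD2 image_eqI)
    ultimately have "x \<in> S" using x y by (auto simp: S_def \<Omega>_def)
    moreover have "y = \<theta> x" using x y \<psi>2(2) by (auto simp: \<theta>_def simp flip: x(2))
    ultimately show "y \<in> \<theta> ` S" by auto
  qed
  have imS: "\<theta> ` S \<in> sets borel"
    unfolding im
  proof (rule borel_Int_vimage[OF W2B])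
    show "continuous_on (W2 \<inter> \<phi>2 -` B) (\<lambda>y. \<psi>1 (\<phi>2 y))"
      by (rule continuous_on_compose2[OF \<psi>1(1) continuous_on_subset[OF c2.cont]]) (use B(2) in auto)
    show "{x :: real ^ 'm. 0 < x $ i} \<in> sets borel" by (intro borel_open open_Collect_less continuous_intros)
  qed
  have imW2: "\<theta> ` S \<subseteq> W2" by (subst im) (rule subset_trans[OF Int_lower1 Int_lower1])
  \<comment> \<open>The maximum with \<open>0\<close> supplies the sign condition of the change of variables formula and is
    invisible after the conversion to \<open>ennreal\<close>.\<close>
  have dens: "ennreal (\<bar>det (matrix (\<theta>' x))\<bar> * max 0 (volume_density \<phi>2 (\<theta> x))) = ennreal (volume_density \<phi>1 x)"
    if "x \<in> \<Omega>" for x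
  proof (cases "0 \<le> volume_density \<phi>2 (\<theta> x)")
    case True
    then show ?thesis by (simp add: J[OF that])
  next
    case False
    then have "volume_density \<phi>1 x \<le> 0"
      by (simp only: J[OF that]) (intro mult_nonneg_nonpos, auto)
    with False show ?thesis by (simp add: ennreal_neg max_absorb1)
  qed
  have "(\<integral>\<^sup>+x\<in>W1 \<inter> \<phi>1 -` B. ennreal (volume_density \<phi>1 x) \<partial>lborel)
      = (\<integral>\<^sup>+x. ennreal (\<bar>det (matrix (\<theta>' x))\<bar> * max 0 (volume_density \<phi>2 (\<theta> x))) * indicator S x \<partial>lborel)"
  proof (rule nn_integral_cong_AE)
    show "AE x in lborel. ennreal (volume_density \<phi>1 x) * indicator (W1 \<inter> \<phi>1 -` B) x
        = ennreal (\<bar>det (matrix (\<theta>' x))\<bar> * max 0 (volume_density \<phi>2 (\<theta> x))) * indicator S x"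
      using AE_coordinate_nonzero[of i]
    proof eventually_elim
      case (elim x)
      have "x \<in> W1 \<inter> \<phi>1 -` B \<longleftrightarrow> x \<in> S"
        using elim V B(2) T(2) by (auto simp: S_def \<Omega>_def I_def)
      then show ?case using dens[of x] by (auto simp: S_def split: split_indicator)
    qed
  qed
  also have "\<dots> \<le> (\<integral>\<^sup>+y. ennreal (max 0 (volume_density \<phi>2 y)) * indicator (\<theta> ` S) y \<partial>lborel)"
  proof (rule nn_integral_change_of_variables_le[OF S])
    show "(\<theta> has_derivative \<theta>' x) (at x within S)" if "x \<in> S" for x
      using that \<theta>'(1) by (auto simp: S_def intro: has_derivative_at_withinI)
    show "inj_on \<theta> S"
    proof (rule inj_onI)
      fix a b assume ab: "a \<in> S" "b \<in> S" "\<theta> a = \<theta> b"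
      then have "\<phi>1 a = \<phi>1 b" using \<theta>(2) by (metis IntD1 S_def)
      then show "a = b" using \<psi>1(2) ab \<Omega>W by (metis IntD1 S_def subsetD)
    qed
    show "0 \<le> max 0 (volume_density \<phi>2 y)" for y by simp
    have "(\<lambda>y. max 0 (volume_density \<phi>2 y * indicator (\<theta> ` S) y)) \<in> borel_measurable borel"
      using c2.density_measurable(1)[OF imS imW2] by measurable
    also have "(\<lambda>y. max 0 (volume_density \<phi>2 y * indicator (\<theta> ` S) y)) = (\<lambda>y. max 0 (volume_density \<phi>2 y) * indicator (\<theta> ` S) y)"
      by (auto simp: fun_eq_iff split: split_indicator)
    finally show "(\<lambda>y. max 0 (volume_density \<phi>2 y) * indicator (\<theta> ` S) y) \<in> borel_measurable borel" .
    have "(\<lambda>x. ennreal (volume_density \<phi>1 x) * indicator S x) \<in> borel_measurable borel"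
      by (rule c1.density_measurable(2)[OF S]) (use \<Omega>W in \<open>auto simp: S_def\<close>)
    also have "(\<lambda>x. ennreal (volume_density \<phi>1 x) * indicator S x)
        = (\<lambda>x. ennreal (\<bar>det (matrix (\<theta>' x))\<bar> * max 0 (volume_density \<phi>2 (\<theta> x))) * indicator S x)"
      using dens by (auto simp: fun_eq_iff S_def split: split_indicator)
    finally show "(\<lambda>x. ennreal (\<bar>det (matrix (\<theta>' x))\<bar> * max 0 (volume_density \<phi>2 (\<theta> x))) * indicator S x) \<in> borel_measurable borel" .
  qed
  also have "\<dots> \<le> (\<integral>\<^sup>+x\<in>W2 \<inter> \<phi>2 -` B. ennreal (volume_density \<phi>2 x) \<partial>lborel)"
    by (intro nn_integral_mono) (use im in \<open>auto simp: max_def ennreal_neg split: split_indicator\<close>)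
  finally show ?thesis .
qed

section \<open>Existence and uniqueness of the volume measure\<close>

lemma chart_integral_eq:
  fixes \<phi>1 :: "real ^ 'm::finite \<Rightarrow> real ^ 'd::finite" and \<phi>2 :: "real ^ 'm \<Rightarrow> real ^ 'd"
  assumes "C1_chart M W1 \<phi>1" "C1_chart M W2 \<phi>2" "B \<in> sets borel" "B \<subseteq> \<phi>1 ` W1 \<inter> \<phi>2 ` W2"
  shows "(\<integral>\<^sup>+x\<in>W1 \<inter> \<phi>1 -` B. ennreal (volume_density \<phi>1 x) \<partial>lborel)
       = (\<integral>\<^sup>+x\<in>W2 \<inter> \<phi>2 -` B. ennreal (volume_density \<phi>2 x) \<partial>lborel)"
  using assms by (intro antisym chart_integral_le) auto

lemma (in chart) integral_UN_disjoint:
  assumes A: "range A \<subseteq> sets borel" "disjoint_family A"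
  shows "(\<integral>\<^sup>+x\<in>W \<inter> \<phi> -` (\<Union>n. A n). ennreal (volume_density \<phi> x) \<partial>lborel)
       = (\<Sum>n. \<integral>\<^sup>+x\<in>W \<inter> \<phi> -` A n. ennreal (volume_density \<phi> x) \<partial>lborel)"
proof -
  have disj: "disjoint_family (\<lambda>n. W \<inter> \<phi> -` A n)" using A(2) unfolding disjoint_family_on_def by blast
  have union: "W \<inter> \<phi> -` (\<Union>n. A n) = (\<Union>n. W \<inter> \<phi> -` A n)" by blast
  have ind: "indicator (W \<inter> \<phi> -` (\<Union>n. A n)) x = (\<Sum>n. indicator (W \<inter> \<phi> -` A n) x :: ennreal)" for x
    by (simp only: union suminf_indicator[OF disj])
  have "(\<integral>\<^sup>+x\<in>W \<inter> \<phi> -` (\<Union>n. A n). ennreal (volume_density \<phi> x) \<partial>lborel)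
      = (\<integral>\<^sup>+x. (\<Sum>n. ennreal (volume_density \<phi> x) * indicator (W \<inter> \<phi> -` A n) x) \<partial>lborel)"
    by (simp only: ind ennreal_suminf_cmult)
  also have "\<dots> = (\<Sum>n. \<integral>\<^sup>+x\<in>W \<inter> \<phi> -` A n. ennreal (volume_density \<phi> x) \<partial>lborel)"
  proof (rule nn_integral_suminf)
    fix n
    have "W \<inter> \<phi> -` A n \<in> sets borel" using A(1) by (intro vimage_borel) auto
    from density_measurable(2)[OF this]
    show "(\<lambda>x. ennreal (volume_density \<phi> x) * indicator (W \<inter> \<phi> -` A n) x) \<in> borel_measurable lborel"
      by simp
  qed
  finally show ?thesis .
qed

lemma C1_submanifold_atlas:
  fixes M :: "(real ^ 'd::finite) set"
  assumes "C1_submanifold TYPE('m::finite) M"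
  obtains W :: "nat \<Rightarrow> (real ^ 'm) set" and \<phi> where "\<And>k. C1_chart M (W k) (\<phi> k)" "M = (\<Union>k. \<phi> k ` W k)"
proof -
  define \<F> where "\<F> = {\<phi> ` W | (W :: (real ^ 'm) set) \<phi>. C1_chart M W \<phi>}"
  have op: "openin (top_of_set M) S" if "S \<in> \<F>" for S
    using that by (auto simp: \<F>_def intro: chart.image_open chart.intro)
  obtain \<G> where \<G>: "\<G> \<subseteq> \<F>" "countable \<G>" "\<Union>\<G> = \<Union>\<F>"
    by (rule Lindelof_openin[of \<F> M]) (erule op, rule that)
  have "\<Union>\<F> = M"
  proof
    show "\<Union>\<F> \<subseteq> M" using op openin_imp_subset by blast
    show "M \<subseteq> \<Union>\<F>" using assms unfolding C1_submanifold_def \<F>_def by blast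
  qed
  moreover have "M \<noteq> {}" using assms by (simp add: C1_submanifold_def)
  ultimately have "\<G> \<noteq> {}" using \<G>(3) by auto
  have "from_nat_into \<G> k \<in> \<F>" for k
    using from_nat_into[OF \<open>\<G> \<noteq> {}\<close>] \<G>(1) by blast
  then have "\<exists>W \<phi>. C1_chart M W \<phi> \<and> from_nat_into \<G> k = \<phi> ` (W :: (real ^ 'm) set)" for k
    by (force simp: \<F>_def)
  then obtain W :: "nat \<Rightarrow> (real ^ 'm) set" and \<phi> where
    W: "\<And>k. C1_chart M (W k) (\<phi> k)" "\<And>k. from_nat_into \<G> k = \<phi> k ` W k"
    by metis
  have "(\<Union>k. \<phi> k ` W k) = \<Union>(range (from_nat_into \<G>))" by (simp add: W(2))
  also have "\<dots> = M"
    using \<open>\<Union>\<F> = M\<close> \<G>(3) range_from_nat_into[OF \<open>\<G> \<noteq> {}\<close> \<G>(2)] by simp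
  finally show thesis by (intro that[of W \<phi>]) (simp_all add: W(1))
qed

lemma C1_submanifold_disjoint_atlas:
  fixes M :: "(real ^ 'd::finite) set"
  assumes sub: "C1_submanifold TYPE('m::finite) M" and M: "M \<in> sets borel"
  obtains W :: "nat \<Rightarrow> (real ^ 'm) set" and \<phi> D where "\<And>k. C1_chart M (W k) (\<phi> k)"
    "range D \<subseteq> sets borel" "disjoint_family D" "(\<Union>k. D k) = M" "\<And>k. D k \<subseteq> \<phi> k ` W k"
proof -
  obtain W :: "nat \<Rightarrow> (real ^ 'm) set" and \<phi> where
    W: "\<And>k. C1_chart M (W k) (\<phi> k)" "M = (\<Union>k. \<phi> k ` W k)"
    using C1_submanifold_atlas[OF sub] by blast
  define D where "D = disjointed (\<lambda>k. \<phi> k ` W k)"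
  have "\<phi> k ` W k \<in> sets borel" for k
  proof -
    interpret chart M "W k" "\<phi> k" by unfold_locales (rule W)
    obtain T where "open T" "\<phi> k ` W k = M \<inter> T" by (rule image_eq_open)
    then show ?thesis using M by auto
  qed
  then have "range D \<subseteq> sets borel"
    unfolding D_def by (intro sets.range_disjointed_sets) auto
  moreover have "(\<Union>k. D k) = M" unfolding W(2) D_def by (rule UN_disjointed_eq)
  moreover have "D k \<subseteq> \<phi> k ` W k" for k unfolding D_def by (rule disjointed_subset)
  moreover have "disjoint_family D" unfolding D_def by (rule disjoint_family_disjointed)
  ultimately show thesis by (intro that[OF W(1)])
qed

text \<open>
  Cut \<open>M\<close> into countably many disjoint Borel pieces \<open>D k\<close>, each inside a chart, and add up the chart
  integrals over the pieces. Since chart integrals agree on overlaps, the sum has the prescribed value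
  in every chart, and no other measure can.
\<close>
lemma ex1_volume_measure:
  fixes M :: "(real ^ 'd::finite) set"
  assumes sub: "C1_submanifold TYPE('m::finite) M" and M: "M \<in> sets borel"
  shows "\<exists>!V. is_volume_measure TYPE('m) M V"
proof -
  obtain W :: "nat \<Rightarrow> (real ^ 'm) set" and \<phi> D where W: "\<And>k. C1_chart M (W k) (\<phi> k)"
    and D: "range D \<subseteq> sets borel" "disjoint_family D" "(\<Union>k. D k) = M" "\<And>k. D k \<subseteq> \<phi> k ` W k"
    by (rule C1_submanifold_disjoint_atlas[OF sub M]) (rule that)
  have Dk: "D k \<in> sets borel" for k using D(1) by auto
  define I where "I W \<phi> B = (\<integral>\<^sup>+x\<in>W \<inter> \<phi> -` B. ennreal (volume_density \<phi> x) \<partial>lborel)"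
    for W :: "(real ^ 'm) set" and \<phi> :: "real ^ 'm \<Rightarrow> real ^ 'd" and B
  have I_UN: "I W' \<phi>' (\<Union>n. A n) = (\<Sum>n. I W' \<phi>' (A n))"
    if "C1_chart M W' \<phi>'" "range A \<subseteq> sets borel" "disjoint_family A" for W' \<phi>' and A :: "nat \<Rightarrow> _"
    unfolding I_def using chart.integral_UN_disjoint[OF chart.intro[OF that(1)] that(2,3)] .
  define \<nu> where "\<nu> B = (\<Sum>k. I (W k) (\<phi> k) (B \<inter> D k))" for B
  have split: "B \<inter> M = (\<Union>k. B \<inter> D k)" for B using D(3) by auto
  have pieces: "range (\<lambda>k. B \<inter> D k) \<subseteq> sets borel" "disjoint_family (\<lambda>k. B \<inter> D k)"
    if "B \<in> sets borel" for B
    using that Dk D(2) unfolding disjoint_family_on_def by auto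
  define V where "V = measure_of UNIV (sets borel) \<nu>"
  have V: "emeasure V B = \<nu> B" if "B \<in> sets borel" for B
    unfolding V_def
  proof (rule emeasure_measure_of_sigma)
    show "sigma_algebra UNIV (sets (borel :: (real ^ 'd) measure))"
      using sets.sigma_algebra_axioms[of "borel :: (real ^ 'd) measure"] by simp
    show "positive (sets borel) \<nu>" by (simp add: positive_def \<nu>_def I_def)
    show "countably_additive (sets borel) \<nu>"
    proof (rule countably_additiveI)
      fix A :: "nat \<Rightarrow> (real ^ 'd) set"
      assume A: "range A \<subseteq> sets borel" "disjoint_family A"
      \<comment> \<open>Exchanging two infinite sums is monotone convergence for the counting measure.\<close>
      have "(\<Sum>n. \<nu> (A n)) = (\<Sum>n. \<integral>\<^sup>+k. I (W k) (\<phi> k) (A n \<inter> D k) \<partial>count_space UNIV)"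
        by (simp add: \<nu>_def nn_integral_count_space_nat)
      also have "\<dots> = (\<integral>\<^sup>+k. (\<Sum>n. I (W k) (\<phi> k) (A n \<inter> D k)) \<partial>count_space UNIV)"
        by (rule nn_integral_suminf[symmetric]) simp
      also have "\<dots> = (\<integral>\<^sup>+k. I (W k) (\<phi> k) ((\<Union>n. A n) \<inter> D k) \<partial>count_space UNIV)"
      proof (rule nn_integral_cong)
        fix k :: nat
        have "I (W k) (\<phi> k) (\<Union>n. A n \<inter> D k) = (\<Sum>n. I (W k) (\<phi> k) (A n \<inter> D k))"
        proof (rule I_UN[OF W])
          show "range (\<lambda>n. A n \<inter> D k) \<subseteq> sets borel" using A(1) Dk by auto
          show "disjoint_family (\<lambda>n. A n \<inter> D k)" using A(2) unfolding disjoint_family_on_def by blast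
        qed
        then show "(\<Sum>n. I (W k) (\<phi> k) (A n \<inter> D k)) = I (W k) (\<phi> k) ((\<Union>n. A n) \<inter> D k)"
          by (simp add: Int_UN_distrib2)
      qed
      also have "\<dots> = \<nu> (\<Union>n. A n)"
        by (simp add: \<nu>_def nn_integral_count_space_nat)
      finally show "(\<Sum>n. \<nu> (A n)) = \<nu> (\<Union>n. A n)" .
    qed
  qed (use that in simp)
  have "is_volume_measure TYPE('m) M V"
    unfolding is_volume_measure_def
  proof (intro conjI allI impI)
    show "sets V = sets borel"
      by (simp add: V_def sets.sigma_sets_eq[of borel, simplified])
    have "- M \<inter> D k = {}" for k using D(3) by auto
    then show "emeasure V (- M) = 0" using M by (simp add: V \<nu>_def I_def)
    fix W' and \<phi>' :: "real ^ 'm \<Rightarrow> real ^ 'd" and B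
    assume a: "C1_chart M W' \<phi>' \<and> B \<in> sets borel \<and> B \<subseteq> \<phi>' ` W'"
    have "B \<subseteq> M" using a chart.image_subset[OF chart.intro] by blast
    have "emeasure V B = (\<Sum>k. I (W k) (\<phi> k) (B \<inter> D k))" using a by (simp add: V \<nu>_def)
    also have "\<dots> = (\<Sum>k. I W' \<phi>' (B \<inter> D k))"
    proof (intro suminf_cong)
      fix k
      show "I (W k) (\<phi> k) (B \<inter> D k) = I W' \<phi>' (B \<inter> D k)"
        unfolding I_def by (rule chart_integral_eq[OF W]) (use a Dk[of k] D(4)[of k] in auto)
    qed
    also have "\<dots> = I W' \<phi>' (B \<inter> M)"
      unfolding split by (rule I_UN[symmetric]) (use a pieces in auto)
    also have "B \<inter> M = B" using \<open>B \<subseteq> M\<close> by auto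
    finally show "emeasure V B = (\<integral>\<^sup>+x\<in>W' \<inter> \<phi>' -` B. ennreal (volume_density \<phi>' x) \<partial>lborel)"
      by (simp add: I_def)
  qed
  moreover have "V1 = V2" if V1: "is_volume_measure TYPE('m) M V1" and V2: "is_volume_measure TYPE('m) M V2" for V1 V2
  proof -
    have val: "emeasure V' B = \<nu> B" if V': "is_volume_measure TYPE('m) M V'" and B: "B \<in> sets borel" for V' B
    proof -
      have s: "sets V' = sets borel" and z: "emeasure V' (- M) = 0"
        and ch: "\<And>(W :: (real ^ 'm) set) \<phi> B. C1_chart M W \<phi> \<Longrightarrow> B \<in> sets borel \<Longrightarrow> B \<subseteq> \<phi> ` W \<Longrightarrow> emeasure V' B = I W \<phi> B"
        using V' by (auto simp: is_volume_measure_def I_def)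
      have "- M \<in> null_sets V'" using M z s by (auto simp: null_sets_def)
      then have "emeasure V' B = emeasure V' (B - (- M))"
        using B s by (intro emeasure_Diff_null_set[symmetric]) auto
      also have "B - (- M) = (\<Union>k. B \<inter> D k)" using D(3) by auto
      also have "emeasure V' (\<Union>k. B \<inter> D k) = (\<Sum>k. emeasure V' (B \<inter> D k))"
        by (rule suminf_emeasure[symmetric]) (use pieces[OF B] s in auto)
      also have "\<dots> = \<nu> B"
        unfolding \<nu>_def by (intro suminf_cong ch[OF W]) (use B Dk D(4) in auto)
      finally show ?thesis .
    qed
    have "sets V1 = sets borel" "sets V2 = sets borel" using V1 V2 by (auto simp: is_volume_measure_def)
    then show ?thesis
      by (intro measure_eqI) (auto simp: val[OF V1] val[OF V2])
  qed
  ultimately show ?thesis by blast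
qed

lemma sets_volume_measure: "is_volume_measure m M V \<Longrightarrow> sets V = sets borel"
  by (simp add: is_volume_measure_def)

lemma emeasure_volume_measure_chart:
  fixes \<phi> :: "real ^ 'm::finite \<Rightarrow> real ^ 'd::finite"
  assumes "is_volume_measure TYPE('m) M V" "C1_chart M W \<phi>" "B \<in> sets borel" "B \<subseteq> \<phi> ` W"
  shows "emeasure V B = (\<integral>\<^sup>+x\<in>W \<inter> \<phi> -` B. ennreal (volume_density \<phi> x) \<partial>lborel)"
  using assms by (simp add: is_volume_measure_def)

lemma is_volume_measure_vol:
  fixes M :: "(real ^ 'd::finite) set"
  assumes "C1_submanifold TYPE('m::finite) M" "M \<in> sets borel"
  shows "is_volume_measure TYPE('m) M (vol TYPE('m) M)"
  unfolding vol_def by (rule theI'[OF ex1_volume_measure[OF assms]])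

lemma vol_eqI:
  fixes M :: "(real ^ 'd::finite) set"
  assumes "C1_submanifold TYPE('m::finite) M" "M \<in> sets borel" "is_volume_measure TYPE('m) M V"
  shows "vol TYPE('m) M = V"
  unfolding vol_def by (rule the1_equality[OF ex1_volume_measure[OF assms(1,2)] assms(3)])

section \<open>Dilations and positivity of the volume\<close>

text \<open>
  The derivative of the dilated chart is that of \<open>\<phi>\<close> composed with the dilation by \<open>t\<close> of the
  parameter domain, so the density changes by the determinant of the latter, in absolute value.
\<close>
lemma C1_chart_scaleR:
  fixes \<phi> :: "real ^ 'm::finite \<Rightarrow> real ^ 'd::finite"
  assumes c: "C1_chart M W \<phi>" and t: "t \<noteq> 0"
  shows "C1_chart ((*\<^sub>R) t ` M) W (\<lambda>x. t *\<^sub>R \<phi> x)"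
    and "x \<in> W \<Longrightarrow> volume_density (\<lambda>x. t *\<^sub>R \<phi> x) x = \<bar>t\<bar> ^ CARD('m) * volume_density \<phi> x"
proof -
  interpret chart M W \<phi> by unfold_locales (rule c)
  obtain U where U: "open U" "W \<subseteq> U" "\<And>x. x \<in> U \<Longrightarrow> (\<phi> has_derivative deriv_at x) (at x)"
    "continuous_on U (\<lambda>x. jacobian \<phi> (at x))"
    by (rule differentiable_nbhd) (rule that)
  have d: "((\<lambda>x. t *\<^sub>R \<phi> x) has_derivative (\<lambda>h. t *\<^sub>R deriv_at x h)) (at x)" if "x \<in> U" for x
    by (rule has_derivative_scaleR_right[OF U(3)[OF that]])
  have f: "frechet_derivative (\<lambda>x. t *\<^sub>R \<phi> x) (at x) = (\<lambda>h. t *\<^sub>R deriv_at x h)" if "x \<in> U" for x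
    using frechet_derivative_at[OF d[OF that]] by simp
  have j: "jacobian (\<lambda>x. t *\<^sub>R \<phi> x) (at x) = t *\<^sub>R jacobian \<phi> (at x)" if "x \<in> U" for x
    by (simp add: jacobian_def f[OF that] matrix_def vec_eq_iff)
  obtain \<psi> where \<psi>: "homeomorphism W (\<phi> ` W) \<phi> \<psi>" by (rule homeo)
  obtain i where i: "openin (top_of_set {x. 0 \<le> x $ i}) W"
    using halfspace by (metis openin_open_Int)
  obtain T where T: "open T" "\<phi> ` W = M \<inter> T" by (rule image_eq_open)
  show "C1_chart ((*\<^sub>R) t ` M) W (\<lambda>x. t *\<^sub>R \<phi> x)"
    unfolding C1_chart_def
  proof (intro conjI)
    show "\<exists>i. openin (top_of_set {x. 0 \<le> x $ i}) W" using i by blast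
    show "\<exists>U. open U \<and> W \<subseteq> U \<and> (\<lambda>x. t *\<^sub>R \<phi> x) differentiable_on U \<and>
          continuous_on U (\<lambda>x. jacobian (\<lambda>x. t *\<^sub>R \<phi> x) (at x))"
    proof (intro exI[of _ U] conjI U(1,2))
      show "(\<lambda>x. t *\<^sub>R \<phi> x) differentiable_on U"
        using d unfolding differentiable_on_def differentiable_def by (blast intro: has_derivative_at_withinI)
      have "continuous_on U (\<lambda>x. t *\<^sub>R jacobian \<phi> (at x))" by (intro continuous_intros U(4))
      then show "continuous_on U (\<lambda>x. jacobian (\<lambda>x. t *\<^sub>R \<phi> x) (at x))"
        by (rule continuous_on_eq) (simp add: j)
    qed
    show "\<forall>x\<in>W. inj (frechet_derivative (\<lambda>x. t *\<^sub>R \<phi> x) (at x))"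
    proof
      fix x assume "x \<in> W"
      then have "inj (deriv_at x)" "x \<in> U" using inj_deriv U(2) by auto
      then show "inj (frechet_derivative (\<lambda>x. t *\<^sub>R \<phi> x) (at x))"
        using t by (simp add: f inj_def)
    qed
    have "homeomorphism W ((\<lambda>x. t *\<^sub>R \<phi> x) ` W) (\<lambda>x. t *\<^sub>R \<phi> x) (\<lambda>y. \<psi> (inverse t *\<^sub>R y))"
      unfolding homeomorphism_def
    proof (intro conjI)
      show "\<forall>x\<in>W. \<psi> (inverse t *\<^sub>R t *\<^sub>R \<phi> x) = x" using \<psi> t by (simp add: homeomorphism_def)
      then show "(\<lambda>y. \<psi> (inverse t *\<^sub>R y)) ` (\<lambda>x. t *\<^sub>R \<phi> x) ` W = W" by (force simp: image_image)
      show "continuous_on W (\<lambda>x. t *\<^sub>R \<phi> x)" by (intro continuous_intros cont)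
      show "\<forall>y\<in>(\<lambda>x. t *\<^sub>R \<phi> x) ` W. t *\<^sub>R \<phi> (\<psi> (inverse t *\<^sub>R y)) = y"
        using \<psi> t by (auto simp: homeomorphism_def)
      show "continuous_on ((\<lambda>x. t *\<^sub>R \<phi> x) ` W) (\<lambda>y. \<psi> (inverse t *\<^sub>R y))"
      proof (rule continuous_on_compose2[of "\<phi> ` W" \<psi>])
        show "continuous_on (\<phi> ` W) \<psi>" using \<psi> by (simp add: homeomorphism_def)
        show "continuous_on ((\<lambda>x. t *\<^sub>R \<phi> x) ` W) (\<lambda>y. inverse t *\<^sub>R y)" by (intro continuous_intros)
      qed (use t in auto)
    qed simp
    then show "\<exists>\<psi>. homeomorphism W ((\<lambda>x. t *\<^sub>R \<phi> x) ` W) (\<lambda>x. t *\<^sub>R \<phi> x) \<psi>" by blast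
    have "(\<lambda>x. t *\<^sub>R \<phi> x) ` W = (*\<^sub>R) t ` (M \<inter> T)" unfolding T(2)[symmetric] by (simp add: image_image)
    also have "\<dots> = (*\<^sub>R) t ` M \<inter> (*\<^sub>R) t ` T" using t by (intro image_Int) (simp add: inj_def)
    finally show "openin (top_of_set ((*\<^sub>R) t ` M)) ((\<lambda>x. t *\<^sub>R \<phi> x) ` W)"
      using open_scaling[OF t T(1)] by (simp add: openin_open_Int)
  qed
  assume x: "x \<in> W"
  then have "x \<in> U" using U(2) by auto
  have lin: "linear (deriv_at x)" using has_deriv_at[OF x] by (rule has_derivative_linear)
  have "volume_density (\<lambda>x. t *\<^sub>R \<phi> x) x = \<bar>det (matrix ((*\<^sub>R) t :: real ^ 'm \<Rightarrow> real ^ 'm))\<bar> * volume_density \<phi> x"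
    by (rule volume_density_transition[OF lin])
       (use lin in \<open>auto simp: f[OF \<open>x \<in> U\<close>] fun_eq_iff linear_cmul intro: linear_scaleR\<close>)
  then show "volume_density (\<lambda>x. t *\<^sub>R \<phi> x) x = \<bar>t\<bar> ^ CARD('m) * volume_density \<phi> x"
    by (simp add: power_abs)
qed

lemma C1_submanifold_scaleR:
  fixes M :: "(real ^ 'd::finite) set"
  assumes sub: "C1_submanifold TYPE('m::finite) M" and t: "t \<noteq> 0"
  shows "C1_submanifold TYPE('m) ((*\<^sub>R) t ` M)"
  unfolding C1_submanifold_def
proof (intro conjI ballI)
  show "(*\<^sub>R) t ` M \<noteq> {}" using sub by (simp add: C1_submanifold_def)
  fix p assume "p \<in> (*\<^sub>R) t ` M"
  then obtain q where q: "q \<in> M" "p = t *\<^sub>R q" by auto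
  then obtain W and \<phi> :: "real ^ 'm \<Rightarrow> real ^ 'd" where c: "C1_chart M W \<phi>" and "q \<in> \<phi> ` W"
    using sub unfolding C1_submanifold_def by blast
  then have "p \<in> (\<lambda>x. t *\<^sub>R \<phi> x) ` W" using q(2) by auto
  then show "\<exists>W (\<phi> :: real ^ 'm \<Rightarrow> real ^ 'd). C1_chart ((*\<^sub>R) t ` M) W \<phi> \<and> p \<in> \<phi> ` W"
    using C1_chart_scaleR(1)[OF c t] by blast
qed

text \<open>
  The image of the volume of \<open>M\<close> under dilation, scaled by \<open>t ^ m\<close>, has the defining property of the
  volume of the dilated submanifold, because charts of the latter become charts of \<open>M\<close> when divided by
  \<open>t\<close>.
\<close>
lemma vol_scaleR:
  fixes M :: "(real ^ 'd::finite) set"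
  assumes sub: "C1_submanifold TYPE('m::finite) M" and M: "M \<in> sets borel" and t: "t > 0"
    and B: "B \<in> sets borel"
  shows "emeasure (vol TYPE('m) ((*\<^sub>R) t ` M)) ((*\<^sub>R) t ` B) = ennreal (t ^ CARD('m)) * emeasure (vol TYPE('m) M) B"
proof -
  have img: "(*\<^sub>R) t ` Y = (*\<^sub>R) (inverse t) -` Y" for Y :: "(real ^ 'd) set"
  proof (intro set_eqI iffI)
    fix y assume "y \<in> (*\<^sub>R) (inverse t) -` Y"
    then show "y \<in> (*\<^sub>R) t ` Y" using t by (intro image_eqI[of _ _ "inverse t *\<^sub>R y"]) auto
  qed (use t in auto)
  have img_borel: "(*\<^sub>R) t ` Y \<in> sets borel" if "Y \<in> sets borel" for Y :: "(real ^ 'd) set"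
    unfolding img using measurable_sets[of "(*\<^sub>R) (inverse t)" borel borel Y] that by simp
  define V where "V = scale_measure (ennreal (t ^ CARD('m))) (distr (vol TYPE('m) M) borel ((*\<^sub>R) t))"
  have vm: "is_volume_measure TYPE('m) M (vol TYPE('m) M)" by (rule is_volume_measure_vol[OF sub M])
  then have s: "sets (vol TYPE('m) M) = sets borel" by (simp add: is_volume_measure_def)
  then have sp: "space (vol TYPE('m) M) = UNIV" using sets_eq_imp_space_eq[OF s] by simp
  have meas: "(*\<^sub>R) t \<in> vol TYPE('m) M \<rightarrow>\<^sub>M borel"
    by (subst measurable_cong_sets[OF s refl]) simp
  have V: "emeasure V Y = ennreal (t ^ CARD('m)) * emeasure (vol TYPE('m) M) ((*\<^sub>R) t -` Y)" if "Y \<in> sets borel" for Y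
    using that by (simp add: V_def emeasure_distr[OF meas] sp)
  have pre: "(*\<^sub>R) t -` (*\<^sub>R) t ` Y = Y" for Y :: "(real ^ 'd) set"
    using t by (intro inj_vimage_image_eq) (simp add: inj_def)
  have "is_volume_measure TYPE('m) ((*\<^sub>R) t ` M) V"
    unfolding is_volume_measure_def
  proof (intro conjI allI impI)
    show "sets V = sets borel" by (simp add: V_def)
    have "(*\<^sub>R) t -` (- (*\<^sub>R) t ` M) = - M" using pre[of M] by (simp add: vimage_Compl)
    then show "emeasure V (- (*\<^sub>R) t ` M) = 0"
      using vm img_borel[OF M] by (simp add: V is_volume_measure_def)
    fix W and \<phi> :: "real ^ 'm \<Rightarrow> real ^ 'd" and Y
    assume a: "C1_chart ((*\<^sub>R) t ` M) W \<phi> \<and> Y \<in> sets borel \<and> Y \<subseteq> \<phi> ` W"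
    let ?\<phi> = "\<lambda>x. inverse t *\<^sub>R \<phi> x"
    have "(*\<^sub>R) (inverse t) ` (*\<^sub>R) t ` M = M" using t by (simp add: image_image)
    then have c: "C1_chart M W ?\<phi>" using C1_chart_scaleR(1)[of "(*\<^sub>R) t ` M" W \<phi> "inverse t"] a t by simp
    have tY: "(*\<^sub>R) t -` Y \<in> sets borel" using measurable_sets[of "(*\<^sub>R) t" borel borel Y] a by simp
    have "(*\<^sub>R) t -` Y \<subseteq> ?\<phi> ` W"
    proof
      fix y assume "y \<in> (*\<^sub>R) t -` Y"
      then obtain x where "x \<in> W" "t *\<^sub>R y = \<phi> x" using a by auto
      then show "y \<in> ?\<phi> ` W" using t by (intro image_eqI[of _ _ x]) (simp_all flip: \<open>t *\<^sub>R y = \<phi> x\<close>)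
    qed
    then have "emeasure (vol TYPE('m) M) ((*\<^sub>R) t -` Y)
        = (\<integral>\<^sup>+x\<in>W \<inter> ?\<phi> -` ((*\<^sub>R) t -` Y). ennreal (volume_density ?\<phi> x) \<partial>lborel)"
      using vm c tY unfolding is_volume_measure_def by blast
    also have "W \<inter> ?\<phi> -` ((*\<^sub>R) t -` Y) = W \<inter> \<phi> -` Y" using t by auto
    finally have "emeasure V Y = ennreal (t ^ CARD('m)) * (\<integral>\<^sup>+x\<in>W \<inter> \<phi> -` Y. ennreal (volume_density ?\<phi> x) \<partial>lborel)"
      using a by (simp add: V)
    also have "\<dots> = (\<integral>\<^sup>+x. ennreal (t ^ CARD('m)) * (ennreal (volume_density ?\<phi> x) * indicator (W \<inter> \<phi> -` Y) x) \<partial>lborel)"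
    proof (rule nn_integral_cmult[symmetric])
      have "W \<inter> \<phi> -` Y \<in> sets borel"
        by (rule chart.vimage_borel[OF chart.intro]) (use a in auto)
      from chart.density_measurable(2)[OF chart.intro[OF c] this]
      show "(\<lambda>x. ennreal (volume_density ?\<phi> x) * indicator (W \<inter> \<phi> -` Y) x) \<in> borel_measurable lborel" by simp
    qed
    also have "\<dots> = (\<integral>\<^sup>+x\<in>W \<inter> \<phi> -` Y. ennreal (volume_density \<phi> x) \<partial>lborel)"
    proof (rule nn_integral_cong)
      fix x
      have "t ^ CARD('m) * volume_density ?\<phi> x = volume_density \<phi> x" if "x \<in> W"
        using C1_chart_scaleR(2)[OF c less_imp_neq[OF t, symmetric] that] t by simp
      then show "ennreal (t ^ CARD('m)) * (ennreal (volume_density ?\<phi> x) * indicator (W \<inter> \<phi> -` Y) x)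
          = ennreal (volume_density \<phi> x) * indicator (W \<inter> \<phi> -` Y) x"
        using t by (auto simp: ennreal_mult''[symmetric] mult.assoc[symmetric] ennreal_mult'[symmetric] split: split_indicator)
    qed
    finally show "emeasure V Y = (\<integral>\<^sup>+x\<in>W \<inter> \<phi> -` Y. ennreal (volume_density \<phi> x) \<partial>lborel)" .
  qed
  then have "vol TYPE('m) ((*\<^sub>R) t ` M) = V"
    using t by (intro vol_eqI C1_submanifold_scaleR sub img_borel M) auto
  then show ?thesis by (simp add: V img_borel[OF B] pre)
qed

text \<open>
  On the segment from the identity to \<open>G\<close> all matrices are positive definite, hence invertible, and the
  determinant cannot change sign.
\<close>
lemma det_pos_of_pos_definite:
  fixes G :: "real ^ 'n::finite ^ 'n"
  assumes pd: "\<And>x. x \<noteq> 0 \<Longrightarrow> 0 < x \<bullet> (G *v x)"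
  shows "det G > 0"
proof (rule ccontr)
  assume "\<not> det G > 0"
  define H where "H s = (1 - s) *\<^sub>R mat 1 + s *\<^sub>R G" for s :: real
  have Hv: "H s *v x = (1 - s) *\<^sub>R x + s *\<^sub>R (G *v x)" for s x
    by (simp add: H_def matrix_vector_mult_add_rdistrib scaleR_matrix_vector_assoc[symmetric])
  have nz: "det (H s) \<noteq> 0" if s: "0 \<le> s" "s \<le> 1" for s
  proof -
    have "x = 0" if "H s *v x = 0" for x
    proof (rule ccontr)
      assume "x \<noteq> 0"
      have "0 = x \<bullet> (H s *v x)" using that by simp
      also have "\<dots> = (1 - s) * (x \<bullet> x) + s * (x \<bullet> (G *v x))" by (simp add: Hv inner_add_right)
      also have "\<dots> > 0"
      proof (cases "s = 0")
        case False
        then have "0 < s * (x \<bullet> (G *v x))" using s pd[OF \<open>x \<noteq> 0\<close>] by simp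
        moreover have "0 \<le> (1 - s) * (x \<bullet> x)" using s by simp
        ultimately show ?thesis by linarith
      qed (use \<open>x \<noteq> 0\<close> in simp)
      finally show False by simp
    qed
    then have "inj ((*v) (H s))" by (simp add: linear_injective_0)
    then have "invertible (H s)" using matrix_left_invertible_injective invertible_left_inverse by blast
    then show ?thesis by (simp add: invertible_det_nz)
  qed
  have "continuous_on {0..1} (\<lambda>s. det (H s))"
    unfolding H_def det_def by (auto intro!: continuous_intros)
  moreover have "det (H 0) = 1" by (simp add: H_def)
  moreover have "det (H 1) \<le> 0" using \<open>\<not> det G > 0\<close> by (simp add: H_def)
  ultimately have "\<exists>s\<ge>0. s \<le> 1 \<and> det (H s) = 0"
    by (intro IVT2') auto
  then show False using nz by blast
qed

lemma (in chart) volume_density_pos: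
  assumes x: "x \<in> W"
  shows "volume_density \<phi> x > 0"
proof -
  let ?J = "jacobian \<phi> (at x)"
  have lin: "linear (deriv_at x)" using has_deriv_at[OF x] by (rule has_derivative_linear)
  have Jv: "?J *v v = deriv_at x v" for v
    unfolding jacobian_def by (rule fun_cong[OF matrix_vector_mul(2)[OF lin]])
  have "det (transpose ?J ** ?J) > 0"
  proof (rule det_pos_of_pos_definite)
    fix v :: "real ^ 'm" assume "v \<noteq> 0"
    then have "?J *v v \<noteq> 0"
      using inj_deriv[OF x] linear_0[OF lin] unfolding Jv by (metis injD)
    have "v \<bullet> ((transpose ?J ** ?J) *v v) = v \<bullet> ((?J *v v) v* ?J)"
      by (simp add: matrix_vector_mul_assoc[symmetric])
    also have "\<dots> = (?J *v v) \<bullet> (?J *v v)"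
      by (subst inner_commute) (simp add: dot_lmul_matrix)
    finally show "0 < v \<bullet> ((transpose ?J ** ?J) *v v)" using \<open>?J *v v \<noteq> 0\<close> by simp
  qed
  then show ?thesis by (simp add: volume_density_def)
qed

text \<open>
  In a chart a nonempty relatively open subset contains an open set of interior parameters, on which the
  density is positive.
\<close>
lemma vol_relatively_open_pos:
  fixes M :: "(real ^ 'd::finite) set"
  assumes sub: "C1_submanifold TYPE('m::finite) M" and M: "M \<in> sets borel"
    and P: "openin (top_of_set M) P" "P \<noteq> {}"
  shows "emeasure (vol TYPE('m) M) P > 0"
proof -
  obtain T where T: "open T" "P = M \<inter> T" using P(1) by (auto simp: openin_open)
  obtain p where p: "p \<in> P" using P(2) by auto
  then obtain W and \<phi> :: "real ^ 'm \<Rightarrow> real ^ 'd" where c: "C1_chart M W \<phi>" and "p \<in> \<phi> ` W"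
    using sub T(2) unfolding C1_submanifold_def by blast
  then obtain x0 where x0: "x0 \<in> W" "\<phi> x0 \<in> T" using p T(2) by auto
  interpret chart M W \<phi> by unfold_locales (rule c)
  obtain i V where V: "open V" "W = {x. 0 \<le> x $ i} \<inter> V" by (rule halfspace)
  obtain N where N: "open N" "W \<inter> \<phi> -` T = W \<inter> N"
    using continuous_openin_preimage_gen[OF cont T(1)] by (auto simp: openin_open)
  define Q where "Q = {x. 0 < x $ i} \<inter> (V \<inter> N)"
  have "open Q"
    unfolding Q_def by (intro open_Int V(1) N(1) open_Collect_less continuous_intros)
  have QW: "Q \<subseteq> W" using V(2) by (auto simp: Q_def)
  have "Q \<noteq> {}"
  proof -
    have "x0 \<in> V \<inter> N" using x0 V N by auto
    then obtain e where e: "e > 0" "ball x0 e \<subseteq> V \<inter> N"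
      using open_contains_ball open_Int[OF V(1) N(1)] by blast
    have "x0 + (e / 2) *\<^sub>R axis i 1 \<in> ball x0 e" using e(1) by (simp add: dist_norm)
    moreover have "0 < (x0 + (e / 2) *\<^sub>R axis i 1) $ i" using x0(1) V(2) e(1) by (auto simp: axis_def)
    ultimately have "x0 + (e / 2) *\<^sub>R axis i 1 \<in> Q" using e(2) unfolding Q_def by blast
    then show ?thesis by blast
  qed
  have "emeasure lborel Q > 0"
  proof -
    have "\<not> negligible Q" using \<open>open Q\<close> \<open>Q \<noteq> {}\<close> open_not_negligible by blast
    then show ?thesis
      using \<open>open Q\<close> by (simp add: negligible_iff_emeasure0 zero_less_iff_neq_zero borel_open)
  qed
  define B where "B = P \<inter> \<phi> ` W"
  have "P \<in> sets borel" using M T by auto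
  obtain T' where "open T'" "\<phi> ` W = M \<inter> T'" by (rule image_eq_open)
  then have "\<phi> ` W \<in> sets borel" using M by auto
  have B: "B \<in> sets borel" "B \<subseteq> \<phi> ` W" using \<open>P \<in> sets borel\<close> \<open>\<phi> ` W \<in> sets borel\<close> by (auto simp: B_def)
  have QB: "Q \<subseteq> W \<inter> \<phi> -` B"
  proof
    fix x assume "x \<in> Q"
    then have "x \<in> W" "x \<in> W \<inter> N" using QW by (auto simp: Q_def)
    then have "\<phi> x \<in> T" "\<phi> x \<in> M" using N(2) image_subset by auto
    then show "x \<in> W \<inter> \<phi> -` B" using \<open>x \<in> W\<close> T(2) by (auto simp: B_def)
  qed
  have vm: "is_volume_measure TYPE('m) M (vol TYPE('m) M)" by (rule is_volume_measure_vol[OF sub M])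
  have "0 < (\<integral>\<^sup>+x\<in>W \<inter> \<phi> -` B. ennreal (volume_density \<phi> x) \<partial>lborel)"
  proof (rule ccontr)
    assume "\<not> ?thesis"
    then have "(\<integral>\<^sup>+x\<in>W \<inter> \<phi> -` B. ennreal (volume_density \<phi> x) \<partial>lborel) = 0" by simp
    then have "AE x in lborel. ennreal (volume_density \<phi> x) * indicator (W \<inter> \<phi> -` B) x = 0"
      using density_measurable(2)[OF vimage_borel[OF B(1)]] by (subst (asm) nn_integral_0_iff_AE) auto
    then have "AE x in lborel. x \<notin> Q"
    proof eventually_elim
      case (elim x)
      show ?case
      proof
        assume "x \<in> Q"
        then have "x \<in> W \<inter> \<phi> -` B" using QB by auto
        then show False using elim volume_density_pos[of x] by simp
      qed
    qed
    then have "emeasure lborel Q = 0"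
      using \<open>open Q\<close> by (subst (asm) AE_iff_measurable[of Q]) auto
    then show False using \<open>emeasure lborel Q > 0\<close> by simp
  qed
  also have "\<dots> = emeasure (vol TYPE('m) M) B"
    by (rule emeasure_volume_measure_chart[OF vm c B, symmetric])
  also have "\<dots> \<le> emeasure (vol TYPE('m) M) P"
  proof (rule emeasure_mono)
    show "P \<in> sets (vol TYPE('m) M)" using \<open>P \<in> sets borel\<close> by (simp add: sets_volume_measure[OF vm])
  qed (simp add: B_def)
  finally show ?thesis .
qed

section \<open>Failure of genericity\<close>

text \<open>
  The foot \<open>v\<close> of the perpendicular from the origin is orthogonal to all directions of \<open>S\<close>, and
  \<open>w = v / |v|\<^sup>2\<close>.
\<close>
lemma affine_avoiding_origin_functional:
  fixes S :: "'a::euclidean_space set"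
  assumes S: "affine S" "0 \<notin> S"
  obtains w where "w \<noteq> 0" "\<And>p. p \<in> S \<Longrightarrow> p \<bullet> w = 1"
proof (cases "S = {}")
  case True
  obtain b :: 'a where "b \<in> Basis" using nonempty_Basis by blast
  then show thesis using that[of b] True nonzero_Basis by auto
next
  case False
  have cl: "closed S" using closed_affine_hull[of S] S(1) by (simp add: affine_hull_eq[THEN iffD2])
  define v where "v = closest_point S 0"
  have v: "v \<in> S" unfolding v_def by (rule closest_point_in_set[OF cl False])
  have dot: "0 \<le> v \<bullet> (p - v)" if "p \<in> S" for p
    using closest_point_dot[OF affine_imp_convex[OF S(1)] cl that, of 0] by (simp add: v_def)
  have "v \<bullet> p = v \<bullet> v" if p: "p \<in> S" for p
  proof -
    \<comment> \<open>The reflection of \<open>p\<close> at \<open>v\<close> lies in \<open>S\<close> as well, so that the inequality for nearest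
      points holds in both directions.\<close>
    have "2 *\<^sub>R v + (- 1) *\<^sub>R p \<in> S" using S(1) v p unfolding affine_def by (metis add.commute diff_add_cancel diff_minus_eq_add one_add_one)
    from dot[OF this] dot[OF p] show ?thesis by (simp add: inner_diff_right algebra_simps)
  qed
  moreover have "v \<noteq> 0" using v S(2) by auto
  ultimately show thesis by (intro that[of "(1 / (v \<bullet> v)) *\<^sub>R v"]) (auto simp: inner_commute)
qed

text \<open>
  Put \<open>\<kappa> = vol P / vol M\<close> for the flat piece \<open>P = M \<inter> \<pi>\<close>, and let \<open>A\<close> be a set of measure at most
  \<open>\<kappa> / 2\<close> that absorbs almost every point at arbitrarily large times. At such a time \<open>t\<close> the average of the
  indicator of \<open>A\<close> over \<open>t M\<close> is at least the proportion \<open>\<kappa>\<close> of \<open>t P\<close> in \<open>t M\<close>, so that the averages do not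
  converge to \<open>\<mu> A\<close>.
\<close>
lemma not_generic_of_flat_piece:
  fixes \<mu> :: "'x measure" and act :: "real ^ 'd::finite \<Rightarrow> 'x \<Rightarrow> 'x" and M :: "(real ^ 'd) set"
  assumes "prob_space \<mu>" and sep: "countably_separated \<mu>" and "measure_preserving_action \<mu> act"
    and aper: "aperiodic_action \<mu> act"
    and sub: "C1_submanifold TYPE('m::finite) M" and M: "compact M"
    and \<pi>: "affine \<pi>" "0 \<notin> \<pi>" "M \<inter> \<pi> \<noteq> {}" "openin (top_of_set M) (M \<inter> \<pi>)"
  shows "\<not> generic TYPE('m) \<mu> act M (L_infinity \<mu>) \<mu>"
proof
  assume gen: "generic TYPE('m) \<mu> act M (L_infinity \<mu>) \<mu>"
  interpret preserving_action \<mu> act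
    using assms(1,3) by (intro preserving_action.intro preserving_action_axioms.intro)
  define average where "average f t x = 1 / (t ^ CARD('m) * measure (vol TYPE('m) M) M) *
      (LINT a:(*\<^sub>R) t ` M|vol TYPE('m) ((*\<^sub>R) t ` M). f (act a x))" for f :: "'x \<Rightarrow> real" and t x
  have lim: "AE x in \<mu>. ((\<lambda>t. average f t x) \<longlongrightarrow> (\<integral>x. f x \<partial>\<mu>)) at_top" if "f \<in> L_infinity \<mu>" for f
    using gen that unfolding generic_def average_def by auto
  define P where "P = M \<inter> \<pi>"
  define V where "V = vol TYPE('m) M"
  have M_borel: "M \<in> sets borel" using M by (intro borel_closed compact_imp_closed)
  have vm: "is_volume_measure TYPE('m) M V" unfolding V_def by (rule is_volume_measure_vol[OF sub M_borel])
  have \<pi>_closed: "closed \<pi>" using closed_affine_hull[of \<pi>] \<pi>(1) by (simp add: affine_hull_eq[THEN iffD2])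
  have P_borel: "P \<in> sets borel" unfolding P_def using M_borel \<pi>_closed by auto
  \<comment> \<open>If \<open>measure V M = 0\<close>, which includes the case of infinite volume, then all averages vanish by
    \<open>1 / 0 = 0\<close>, and already the constant function \<open>1\<close> refutes genericity.\<close>
  have V_pos: "measure V M > 0"
  proof (rule ccontr)
    assume "\<not> measure V M > 0"
    then have "measure V M = 0" using measure_nonneg[of V M] by simp
    have "(\<lambda>_. 1) \<in> L_infinity \<mu>" unfolding L_infinity_def by auto
    from lim[OF this] have "AE x in \<mu>. ((\<lambda>t::real. 0 :: real) \<longlongrightarrow> 1) at_top"
      by (simp add: average_def V_def[symmetric] \<open>measure V M = 0\<close> prob_space)
    then have "((\<lambda>t::real. 0 :: real) \<longlongrightarrow> 1) at_top" by simp
    then show False using tendsto_unique[OF trivial_limit_at_top_linorder tendsto_const] by fastforce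
  qed
  then have V_fin: "emeasure V M < \<infinity>" by (auto simp: measure_def top.not_eq_extremum[symmetric])
  have sets_V: "sets V = sets borel" by (rule sets_volume_measure[OF vm])
  have "emeasure V P \<le> emeasure V M"
    by (rule emeasure_mono) (auto simp: P_def sets_V M_borel)
  then have P_fin: "emeasure V P < \<infinity>" using V_fin by simp
  have "emeasure V P > 0"
    unfolding V_def by (rule vol_relatively_open_pos[OF sub M_borel]) (use \<pi> in \<open>simp_all add: P_def\<close>)
  then have P_pos: "measure V P > 0"
    using P_fin by (simp add: measure_def enn2real_positive_iff)
  define \<kappa> where "\<kappa> = measure V P / measure V M"
  have \<kappa>: "\<kappa> > 0" using P_pos V_pos by (simp add: \<kappa>_def)
  obtain w where w: "w \<noteq> 0" "\<And>p. p \<in> \<pi> \<Longrightarrow> p \<bullet> w = 1"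
    by (rule affine_avoiding_origin_functional[OF \<pi>(1,2)]) (rule that)
  have P_bounded: "bounded P" unfolding P_def using M by (meson bounded_Int compact_imp_bounded)
  have P_level: "p \<bullet> w = 1" if "p \<in> P" for p using that w(2) by (simp add: P_def)
  have \<kappa>2: "\<kappa> / 2 > 0" using \<kappa> by simp
  obtain A where [measurable]: "A \<in> sets \<mu>" and A_small: "measure \<mu> A \<le> \<kappa> / 2"
    and ab: "AE x in \<mu>. \<forall>T. absorbs P T A x"
    by (rule flat_pieces_absorbed_infinitely_often[OF sep aper P_bounded P_level w(1) \<kappa>2]) (assumption, rule that)
  have "indicat_real A \<in> L_infinity \<mu>"
    unfolding L_infinity_def by (auto intro!: exI[of _ 1] AE_I2 split: split_indicator)
  from lim[OF this] have "AE x in \<mu>. ((\<lambda>t. average (indicat_real A) t x) \<longlongrightarrow> measure \<mu> A) at_top"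
    by (simp add: sets.Int_space_eq2)
  with ab AE_space have "AE x in \<mu>. x \<in> space \<mu> \<and> (\<forall>T. absorbs P T A x)
      \<and> ((\<lambda>t. average (indicat_real A) t x) \<longlongrightarrow> measure \<mu> A) at_top"
    by eventually_elim simp
  then obtain x where x: "x \<in> space \<mu>" "\<And>T. absorbs P T A x"
    "((\<lambda>t. average (indicat_real A) t x) \<longlongrightarrow> measure \<mu> A) at_top"
    using eventually_happens'[OF ae_filter_bot] by blast
  have "measure \<mu> A < \<kappa>" using A_small \<kappa> by simp
  from order_tendstoD(2)[OF x(3) this] obtain N where N: "\<And>t. t \<ge> N \<Longrightarrow> average (indicat_real A) t x < \<kappa>"
    by (auto simp: eventually_at_top_linorder)
  obtain t where t: "t \<ge> max N 1" "\<And>p. p \<in> P \<Longrightarrow> act (t *\<^sub>R p) x \<in> A"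
    using x(2)[of "max N 1"] unfolding absorbs_def by blast
  then have "t > 0" by simp
  define Vt where "Vt = vol TYPE('m) ((*\<^sub>R) t ` M)"
  have tM_borel: "(*\<^sub>R) t ` M \<in> sets borel" using compact_scaling[OF M, of t] by (intro borel_closed compact_imp_closed)
  have "is_volume_measure TYPE('m) ((*\<^sub>R) t ` M) Vt"
    unfolding Vt_def using \<open>t > 0\<close> by (intro is_volume_measure_vol C1_submanifold_scaleR sub tM_borel) simp
  then have sets_Vt: "sets Vt = sets borel" by (rule sets_volume_measure)
  have scale: "emeasure Vt ((*\<^sub>R) t ` B) = ennreal (t ^ CARD('m)) * emeasure V B" if "B \<in> sets borel" for B
    unfolding Vt_def V_def by (rule vol_scaleR[OF sub M_borel \<open>t > 0\<close> that])
  define Y where "Y = (*\<^sub>R) t ` M \<inter> {a. act a x \<in> A}"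
  have Y: "Y \<in> sets Vt" unfolding Y_def sets_Vt using tM_borel x(1) by measurable
  have "emeasure Vt Y \<le> emeasure Vt ((*\<^sub>R) t ` M)"
    by (rule emeasure_mono) (auto simp: Y_def sets_Vt tM_borel)
  also have "\<dots> < \<infinity>" using scale[OF M_borel] V_fin by (simp add: ennreal_mult_less_top)
  finally have Y_fin: "emeasure Vt Y < \<infinity>" .
  have "ennreal (t ^ CARD('m)) * emeasure V P \<le> emeasure Vt Y"
    unfolding scale[OF P_borel, symmetric] by (rule emeasure_mono[OF _ Y]) (use t(2) in \<open>auto simp: Y_def P_def\<close>)
  then have "ennreal (t ^ CARD('m) * measure V P) \<le> ennreal (measure Vt Y)"
    using P_fin Y_fin \<open>t > 0\<close> by (simp add: emeasure_eq_ennreal_measure ennreal_mult less_top[symmetric])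
  then have ge: "t ^ CARD('m) * measure V P \<le> measure Vt Y" by (simp add: ennreal_le_iff)
  have "(LINT a:(*\<^sub>R) t ` M|Vt. indicat_real A (act a x)) = (\<integral>a. indicat_real Y a \<partial>Vt)"
    unfolding set_lebesgue_integral_def
    by (intro Bochner_Integration.integral_cong) (auto simp: Y_def split: split_indicator)
  also have "\<dots> = measure Vt Y" using Y by (simp add: sets.Int_space_eq2)
  finally have "average (indicat_real A) t x = 1 / (t ^ CARD('m) * measure V M) * measure Vt Y"
    by (simp add: average_def V_def Vt_def)
  also have "\<dots> \<ge> 1 / (t ^ CARD('m) * measure V M) * (t ^ CARD('m) * measure V P)"
    using ge \<open>t > 0\<close> by (intro mult_left_mono) auto
  finally have "\<kappa> \<le> average (indicat_real A) t x" using \<open>t > 0\<close> by (simp add: \<kappa>_def)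
  with N[of t] t(1) show False by simp
qed

section \<open>A flat ball as a submanifold with boundary\<close>

text \<open>
  The inversion in the sphere of radius \<open>sqrt 2\<close> around \<open>- e\<close>. For a unit vector \<open>e\<close> it exchanges the
  half-space \<open>{x. 0 \<le> x \<bullet> e}\<close> and the closed unit ball without the point \<open>- e\<close>, and so is a boundary chart
  of the ball.
\<close>
definition ball_inversion :: "'a::real_inner \<Rightarrow> 'a \<Rightarrow> 'a" where
  "ball_inversion e x = (2 / ((x + e) \<bullet> (x + e))) *\<^sub>R (x + e) - e"

definition ball_inversion_deriv :: "'a::real_inner \<Rightarrow> 'a \<Rightarrow> 'a \<Rightarrow> 'a" where
  "ball_inversion_deriv e x h = (let z = x + e in
     (2 / (z \<bullet> z)) *\<^sub>R h - (4 * (z \<bullet> h) / (z \<bullet> z)\<^sup>2) *\<^sub>R z)"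

lemma ball_inversion_neq: "x \<noteq> - e \<Longrightarrow> ball_inversion e x \<noteq> - e"
  by (auto simp: ball_inversion_def add_eq_0_iff2)

lemma ball_inversion_involution:
  assumes "x \<noteq> - e"
  shows "ball_inversion e (ball_inversion e x) = x"
proof -
  define z where "z = x + e"
  have z: "z \<bullet> z \<noteq> 0" using assms by (simp add: z_def add_eq_0_iff2)
  have shift: "ball_inversion e x + e = (2 / (z \<bullet> z)) *\<^sub>R z" by (simp add: ball_inversion_def z_def)
  have "ball_inversion e (ball_inversion e x) + e
      = (2 / ((2 / (z \<bullet> z)) * ((2 / (z \<bullet> z)) * (z \<bullet> z)))) *\<^sub>R (2 / (z \<bullet> z)) *\<^sub>R z"
    unfolding ball_inversion_def[of e "ball_inversion e x"] shift by simp
  also have "\<dots> = z" using z by (simp add: field_simps)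
  finally show ?thesis by (simp add: z_def)
qed

lemma norm_ball_inversion_le_1_iff:
  assumes "x \<noteq> - e" "norm e = 1"
  shows "norm (ball_inversion e x) \<le> 1 \<longleftrightarrow> 0 \<le> x \<bullet> e"
proof -
  define z where "z = x + e"
  have z: "z \<bullet> z > 0" using assms(1) by (simp add: z_def add_eq_0_iff2)
  have ee: "e \<bullet> e = 1" using assms(2) by (simp add: norm_eq_1)
  have ze: "z \<bullet> e = x \<bullet> e + 1" by (simp add: z_def inner_add_left ee)
  have "(norm (ball_inversion e x))\<^sup>2 = ((2 / (z \<bullet> z)) *\<^sub>R z - e) \<bullet> ((2 / (z \<bullet> z)) *\<^sub>R z - e)"
    by (simp add: ball_inversion_def z_def power2_norm_eq_inner)
  also have "\<dots> = (2 / (z \<bullet> z)) * (2 / (z \<bullet> z)) * (z \<bullet> z) - 2 * (2 / (z \<bullet> z)) * (z \<bullet> e) + 1"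
  proof -
    have "(c *\<^sub>R z - e) \<bullet> (c *\<^sub>R z - e) = c * c * (z \<bullet> z) - 2 * c * (z \<bullet> e) + 1" for c
      by (simp add: inner_diff_left inner_diff_right inner_commute[of e z] ee algebra_simps)
    then show ?thesis .
  qed
  also have "\<dots> = 1 - 4 / (z \<bullet> z) * (x \<bullet> e)"
  proof -
    have "(2 / (z \<bullet> z)) * (2 / (z \<bullet> z)) * (z \<bullet> z) = 4 / (z \<bullet> z)" using z by (simp add: field_simps)
    moreover have "x \<bullet> e = z \<bullet> e - 1" using ze by simp
    ultimately show ?thesis by (simp add: right_diff_distrib)
  qed
  finally have eq: "(norm (ball_inversion e x))\<^sup>2 = 1 - 4 / (z \<bullet> z) * (x \<bullet> e)" .
  have "norm (ball_inversion e x) \<le> 1 \<longleftrightarrow> (norm (ball_inversion e x))\<^sup>2 \<le> 1"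
    using abs_square_le_1[of "norm (ball_inversion e x)"] by simp
  also have "\<dots> \<longleftrightarrow> 0 \<le> 4 / (z \<bullet> z) * (x \<bullet> e)" unfolding eq by simp
  also have "\<dots> \<longleftrightarrow> 0 \<le> x \<bullet> e"
    using mult_le_cancel_left_pos[of "4 / (z \<bullet> z)" 0 "x \<bullet> e"] z by (simp only: mult_zero_right divide_pos_pos zero_less_numeral)
  finally show ?thesis .
qed

lemma ball_inversion_image_halfspace:
  assumes e: "norm e = 1"
  shows "ball_inversion e ` {x. 0 \<le> x \<bullet> e} = cball 0 1 - {- e}"
proof (intro set_eqI iffI)
  have ne: "x \<noteq> - e" if "0 \<le> x \<bullet> e" for x
    using that e by (auto simp: norm_eq_1)
  fix y
  { assume "y \<in> ball_inversion e ` {x. 0 \<le> x \<bullet> e}"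
    then show "y \<in> cball 0 1 - {- e}"
      using ne norm_ball_inversion_le_1_iff[OF _ e] ball_inversion_neq by auto }
  { assume y: "y \<in> cball 0 1 - {- e}"
    then have inv: "ball_inversion e (ball_inversion e y) = y" by (simp add: ball_inversion_involution)
    moreover have "0 \<le> ball_inversion e y \<bullet> e"
      using norm_ball_inversion_le_1_iff[OF ball_inversion_neq e, of y] y inv by simp
    ultimately show "y \<in> ball_inversion e ` {x. 0 \<le> x \<bullet> e}" by (metis (mono_tags) imageI mem_Collect_eq) }
qed

lemma has_derivative_ball_inversion:
  assumes "x \<noteq> - e"
  shows "(ball_inversion e has_derivative ball_inversion_deriv e x) (at x)"
proof -
  have z: "(x + e) \<bullet> (x + e) \<noteq> 0" using assms by (simp add: add_eq_0_iff2)
  have "((\<lambda>x. (2 / ((x + e) \<bullet> (x + e))) *\<^sub>R (x + e) - e) has_derivative ball_inversion_deriv e x) (at x)"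
    using z by (auto intro!: derivative_eq_intros
        simp: ball_inversion_deriv_def fun_eq_iff Let_def inner_commute power2_eq_square field_simps scaleR_diff_left)
  then show ?thesis by (simp add: ball_inversion_def[abs_def])
qed

lemma inj_ball_inversion_deriv:
  assumes "x \<noteq> - e"
  shows "inj (ball_inversion_deriv e x)"
proof -
  define z where "z = x + e"
  have z: "z \<bullet> z \<noteq> 0" using assms by (simp add: z_def add_eq_0_iff2)
  have lin: "linear (ball_inversion_deriv e x)"
    by (rule has_derivative_linear[OF has_derivative_ball_inversion[OF assms]])
  show ?thesis
  proof (rule linear_injective_0[OF lin, THEN iffD2], intro allI impI)
    fix h assume "ball_inversion_deriv e x h = 0"
    then have eq: "(2 / (z \<bullet> z)) *\<^sub>R h = (4 * (z \<bullet> h) / (z \<bullet> z)\<^sup>2) *\<^sub>R z"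
      by (simp add: ball_inversion_deriv_def z_def Let_def)
    then have "z \<bullet> ((2 / (z \<bullet> z)) *\<^sub>R h) = z \<bullet> ((4 * (z \<bullet> h) / (z \<bullet> z)\<^sup>2) *\<^sub>R z)" by simp
    then have "z \<bullet> h = 0" using z by (simp add: field_simps power2_eq_square)
    with eq z show "h = 0" by simp
  qed
qed

lemma continuous_on_matrix:
  fixes f :: "'a::topological_space \<Rightarrow> real ^ 'm \<Rightarrow> real ^ 'd"
  assumes "\<And>h. continuous_on U (\<lambda>x. f x h)"
  shows "continuous_on U (\<lambda>x. matrix (f x))"
  unfolding matrix_def by (intro continuous_on_vec_lambda continuous_intros assms)

text \<open>
  The sign \<open>s\<close> (\<open>1\<close> or \<open>- 1\<close>) selects which of two opposite points of the ball is left out, so that two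
  charts suffice. The left inverse \<open>L\<close> of the embedding provides the inverse of the chart.
\<close>
lemma C1_chart_ball_inversion:
  fixes \<iota> :: "real ^ 'm::finite \<Rightarrow> real ^ 'd::finite" and i :: 'm
  assumes \<iota>: "linear \<iota>" and L: "linear L" "\<And>x. L (\<iota> x) = x"
    and s: "s * s = (1 :: real)"
  defines "e \<equiv> axis i 1"
  shows "C1_chart ((\<lambda>y. v + \<iota> y) ` cball 0 1) {x. 0 \<le> x $ i} (\<lambda>x. v + \<iota> (s *\<^sub>R ball_inversion e x))"
    and "(\<lambda>x. v + \<iota> (s *\<^sub>R ball_inversion e x)) ` {x. 0 \<le> x $ i}
      = (\<lambda>y. v + \<iota> y) ` (cball 0 1 - {- (s *\<^sub>R e)})"
proof -
  let ?M = "(\<lambda>y. v + \<iota> y) ` cball 0 1"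
  let ?W = "{x :: real ^ 'm. 0 \<le> x $ i}"
  let ?\<phi> = "\<lambda>x. v + \<iota> (s *\<^sub>R ball_inversion e x)"
  have e: "norm e = 1" by (simp add: e_def)
  have W: "?W = {x. 0 \<le> x \<bullet> e}" by (simp add: e_def inner_axis)
  have s0: "s \<noteq> 0" and s_abs: "\<bar>s\<bar> = 1" using s by (auto simp: abs_square_eq_1 power2_eq_square[symmetric])
  have bl: "bounded_linear \<iota>" "bounded_linear L" using \<iota> L(1) by (simp_all add: linear_conv_bounded_linear)
  let ?U = "- {- e}"
  have WU: "?W \<subseteq> ?U" by (auto simp: e_def)
  define \<psi> where "\<psi> y = ball_inversion e (s *\<^sub>R L (y - v))" for y
  have \<psi>\<phi>: "s *\<^sub>R L (?\<phi> x - v) = ball_inversion e x" for x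
    by (simp add: L(2) linear_cmul[OF L(1)] linear_cmul[OF \<iota>] s)
  have der: "(?\<phi> has_derivative (\<lambda>h. \<iota> (s *\<^sub>R ball_inversion_deriv e x h))) (at x)" if "x \<in> ?U" for x
  proof -
    have "((\<lambda>x. \<iota> (s *\<^sub>R ball_inversion e x)) has_derivative (\<lambda>h. \<iota> (s *\<^sub>R ball_inversion_deriv e x h))) (at x)"
      by (rule bounded_linear.has_derivative[OF bl(1) has_derivative_scaleR_right[OF has_derivative_ball_inversion]])
         (use that in auto)
    from has_derivative_add[OF has_derivative_const this] show ?thesis by simp
  qed
  have fd: "frechet_derivative ?\<phi> (at x) = (\<lambda>h. \<iota> (s *\<^sub>R ball_inversion_deriv e x h))" if "x \<in> ?U" for x
    using frechet_derivative_at[OF der[OF that]] by simp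
  have inv_cont: "continuous_on ?U (ball_inversion e)"
    unfolding ball_inversion_def[abs_def]
    by (intro continuous_intros) (auto simp: add_eq_0_iff2)
  have cont: "continuous_on ?W ?\<phi>"
    by (intro continuous_intros bounded_linear.continuous_on[OF bl(1)] continuous_on_subset[OF inv_cont WU])
  show img: "?\<phi> ` ?W = (\<lambda>y. v + \<iota> y) ` (cball 0 1 - {- (s *\<^sub>R e)})"
  proof -
    have "?\<phi> ` ?W = (\<lambda>y. v + \<iota> y) ` (\<lambda>y. s *\<^sub>R y) ` (ball_inversion e ` ?W)" by (simp add: image_image)
    also have "ball_inversion e ` ?W = cball 0 1 - {- e}"
      unfolding W by (rule ball_inversion_image_halfspace[OF e])
    also have "(\<lambda>y. s *\<^sub>R y) ` (cball 0 1 - {- e}) = cball 0 1 - {- (s *\<^sub>R e)}"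
    proof (intro set_eqI iffI)
      fix y assume y: "y \<in> cball 0 1 - {- (s *\<^sub>R e)}"
      have "s *\<^sub>R y \<noteq> - e"
      proof
        assume "s *\<^sub>R y = - e"
        then have "s *\<^sub>R s *\<^sub>R y = s *\<^sub>R (- e)" by simp
        then show False using y s by simp
      qed
      then show "y \<in> (\<lambda>y. s *\<^sub>R y) ` (cball 0 1 - {- e})"
        using y s s_abs by (intro image_eqI[of _ _ "s *\<^sub>R y"]) auto
    next
      fix y assume "y \<in> (\<lambda>y. s *\<^sub>R y) ` (cball 0 1 - {- e})"
      then show "y \<in> cball 0 1 - {- (s *\<^sub>R e)}"
        using s0 s_abs by (auto simp flip: scaleR_minus_right)
    qed
    finally show ?thesis .
  qed
  show "C1_chart ?M ?W ?\<phi>"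
    unfolding C1_chart_def
  proof (intro conjI)
    show "\<exists>i. openin (top_of_set {x. 0 \<le> x $ i}) ?W" by (rule exI[of _ i]) simp
    show "\<exists>U. open U \<and> ?W \<subseteq> U \<and> ?\<phi> differentiable_on U \<and> continuous_on U (\<lambda>x. jacobian ?\<phi> (at x))"
    proof (intro exI[of _ ?U] conjI WU)
      show "open ?U" by auto
      show "?\<phi> differentiable_on ?U"
        unfolding differentiable_on_def differentiable_def by (blast intro: has_derivative_at_withinI der)
      have "continuous_on ?U (\<lambda>x. matrix (\<lambda>h. \<iota> (s *\<^sub>R ball_inversion_deriv e x h)))"
        unfolding ball_inversion_deriv_def Let_def
        by (intro continuous_on_matrix bounded_linear.continuous_on[OF bl(1)] continuous_intros)
           (auto simp: add_eq_0_iff2)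
      then show "continuous_on ?U (\<lambda>x. jacobian ?\<phi> (at x))"
        by (rule continuous_on_eq) (simp only: jacobian_def fd)
    qed
    show "\<forall>x\<in>?W. inj (frechet_derivative ?\<phi> (at x))"
    proof
      fix x assume "x \<in> ?W"
      then have x: "x \<in> ?U" using WU by auto
      show "inj (frechet_derivative ?\<phi> (at x))"
        unfolding fd[OF x]
      proof (rule injI)
        fix a b assume "\<iota> (s *\<^sub>R ball_inversion_deriv e x a) = \<iota> (s *\<^sub>R ball_inversion_deriv e x b)"
        then have "ball_inversion_deriv e x a = ball_inversion_deriv e x b" using L(2) s0 by (metis scaleR_cancel_left)
        then show "a = b" using inj_ball_inversion_deriv[of x e] x by (auto dest: injD)
      qed
    qed
    have "homeomorphism ?W (?\<phi> ` ?W) ?\<phi> \<psi>"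
      unfolding homeomorphism_def
    proof (intro conjI)
      show 1: "\<forall>x\<in>?W. \<psi> (?\<phi> x) = x"
        unfolding \<psi>_def \<psi>\<phi> using WU by (auto intro!: ball_inversion_involution)
      then show "\<psi> ` ?\<phi> ` ?W = ?W" by (force simp: image_image)
      show "\<forall>y\<in>?\<phi> ` ?W. ?\<phi> (\<psi> y) = y" using 1 by auto
      show "continuous_on (?\<phi> ` ?W) \<psi>"
        unfolding \<psi>_def[abs_def]
      proof (rule continuous_on_compose2[OF inv_cont])
        show "continuous_on (?\<phi> ` ?W) (\<lambda>y. s *\<^sub>R L (y - v))"
          by (intro continuous_intros bounded_linear.continuous_on[OF bl(2)])
        show "(\<lambda>y. s *\<^sub>R L (y - v)) ` ?\<phi> ` ?W \<subseteq> ?U"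
        proof
          fix y assume "y \<in> (\<lambda>y. s *\<^sub>R L (y - v)) ` ?\<phi> ` ?W"
          then obtain x where "x \<in> ?W" "y = s *\<^sub>R L (?\<phi> x - v)" by auto
          then have "y = ball_inversion e x" "x \<noteq> - e" using WU \<psi>\<phi> by auto
          then show "y \<in> ?U" using ball_inversion_neq by auto
        qed
      qed
    qed (use cont in auto)
    then show "\<exists>\<psi>. homeomorphism ?W (?\<phi> ` ?W) ?\<phi> \<psi>" by blast
    have "?\<phi> ` ?W = ?M \<inter> {y. L (y - v) \<noteq> - (s *\<^sub>R e)}"
      unfolding img by (auto simp: L(2))
    moreover have "open {y. L (y - v) \<noteq> - (s *\<^sub>R e)}"
      by (intro open_Collect_neq continuous_intros bounded_linear.continuous_on[OF bl(2)])
    ultimately show "openin (top_of_set ?M) (?\<phi> ` ?W)" by (simp add: openin_open_Int)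
  qed
qed

lemma C1_submanifold_flat_ball:
  fixes \<iota> :: "real ^ 'm::finite \<Rightarrow> real ^ 'd::finite"
  assumes "linear \<iota>" "linear L" "\<And>x. L (\<iota> x) = x"
  shows "C1_submanifold TYPE('m) ((\<lambda>y. v + \<iota> y) ` cball 0 1)"
  unfolding C1_submanifold_def
proof (intro conjI ballI)
  fix p assume "p \<in> (\<lambda>y. v + \<iota> y) ` cball 0 1"
  then obtain y where y: "y \<in> cball 0 1" "p = v + \<iota> y" by auto
  define e where "e = (axis undefined 1 :: real ^ 'm)"
  have "(- e) $ undefined \<noteq> e $ undefined" by (simp add: e_def)
  then have "- e \<noteq> e" by metis
  define s :: real where "s = (if y = - e then - 1 else 1)"
  have "y \<noteq> - (s *\<^sub>R e)" using \<open>- e \<noteq> e\<close> by (cases "y = - e") (simp_all add: s_def)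
  then have p: "p \<in> (\<lambda>y. v + \<iota> y) ` (cball 0 1 - {- (s *\<^sub>R e)})" using y by blast
  have "s * s = 1" by (simp add: s_def)
  note s = this
  show "\<exists>W (\<phi> :: real ^ 'm \<Rightarrow> real ^ 'd). C1_chart ((\<lambda>y. v + \<iota> y) ` cball 0 1) W \<phi> \<and> p \<in> \<phi> ` W"
  proof (intro exI conjI)
    show "C1_chart ((\<lambda>y. v + \<iota> y) ` cball 0 1) {x. 0 \<le> x $ undefined}
        (\<lambda>x. v + \<iota> (s *\<^sub>R ball_inversion (axis undefined 1) x))"
      by (rule C1_chart_ball_inversion(1)[OF assms s])
    show "p \<in> (\<lambda>x. v + \<iota> (s *\<^sub>R ball_inversion (axis undefined 1) x)) ` {x. 0 \<le> x $ undefined}"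
      unfolding C1_chart_ball_inversion(2)[OF assms s] using p by (simp only: e_def)
  qed
qed simp

text \<open>
  A unit ball in the coordinate directions of the range of \<open>\<sigma>\<close>, moved off the origin by a unit vector in a
  direction \<open>k\<close> that remains; there is one because \<open>m < d\<close>.
\<close>
lemma exists_flat_submanifold_off_origin:
  assumes card: "CARD('m::finite) < CARD('d::finite)"
  obtains M \<pi> :: "(real ^ 'd) set" where "C1_submanifold TYPE('m) M" "compact M"
    "affine \<pi>" "0 \<notin> \<pi>" "M \<inter> \<pi> \<noteq> {}" "openin (top_of_set M) (M \<inter> \<pi>)"
proof -
  obtain \<sigma> :: "'m \<Rightarrow> 'd" where \<sigma>: "inj \<sigma>"
    using card_le_inj[of "UNIV :: 'm set" "UNIV :: 'd set"] card by auto
  have "range \<sigma> \<noteq> UNIV" using card card_image[OF \<sigma>] by auto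
  then obtain k where k: "k \<notin> range \<sigma>" by auto
  define \<iota> :: "real ^ 'm \<Rightarrow> real ^ 'd" where "\<iota> x = (\<chi> i. if i \<in> range \<sigma> then x $ inv \<sigma> i else 0)" for x
  define L :: "real ^ 'd \<Rightarrow> real ^ 'm" where "L y = (\<chi> j. y $ \<sigma> j)" for y
  define v :: "real ^ 'd" where "v = axis k 1"
  have lin: "linear \<iota>" "linear L" by (auto intro!: linearI simp: \<iota>_def L_def vec_eq_iff)
  have L: "L (\<iota> x) = x" for x using \<sigma> by (simp add: L_def \<iota>_def vec_eq_iff)
  let ?M = "(\<lambda>y. v + \<iota> y) ` cball 0 1"
  let ?\<pi> = "range (\<lambda>y. v + \<iota> y)"
  have M\<pi>: "?M \<inter> ?\<pi> = ?M" by auto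
  show thesis
  proof (rule that[of ?M ?\<pi>])
    show "C1_submanifold TYPE('m) ?M" by (rule C1_submanifold_flat_ball[OF lin L])
    show "compact ?M"
      by (intro compact_continuous_image continuous_intros linear_continuous_on lin compact_cball
          linear_conv_bounded_linear[THEN iffD1])
    have "?\<pi> = (+) v ` range \<iota>" by (simp add: image_image)
    moreover have "affine (range \<iota>)"
      by (intro subspace_imp_affine linear_subspace_image[OF lin(1)] subspace_UNIV)
    ultimately show "affine ?\<pi>" using affine_translation by metis
    show "0 \<notin> ?\<pi>"
    proof
      assume "0 \<in> ?\<pi>"
      then obtain y where "v + \<iota> y = 0" by (metis imageE)
      then have "(v + \<iota> y) $ k = 0" by simp
      then show False using k by (simp add: v_def \<iota>_def)
    qed
    show "?M \<inter> ?\<pi> \<noteq> {}" unfolding M\<pi> by simp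
    show "openin (top_of_set ?M) (?M \<inter> ?\<pi>)" unfolding M\<pi> by simp
  qed
qed

section \<open>The theorem\<close>

theorem theorem1p7:
  assumes "1 \<le> CARD('m::finite)" and "CARD('m) \<le> CARD('d::finite) - 1"
  shows
    "(\<forall>(\<mu> :: 'x measure) (act :: real ^ 'd \<Rightarrow> 'x \<Rightarrow> 'x) (M :: (real ^ 'd) set).
        prob_space \<mu> \<and> countably_separated \<mu> \<and>
        measure_preserving_action \<mu> act \<and> ergodic_action \<mu> act \<and> aperiodic_action \<mu> act \<and>
        C1_submanifold TYPE('m) M \<and> compact M \<and>
        (\<exists>\<pi>. affine \<pi> \<and> aff_dim \<pi> = int CARD('m) \<and> 0 \<notin> \<pi> \<and>
             M \<inter> \<pi> \<noteq> {} \<and> openin (top_of_set M) (M \<inter> \<pi>))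
        \<longrightarrow> \<not> generic TYPE('m) \<mu> act M (L_infinity \<mu>) \<mu>)
     \<and> \<not> (\<exists>(\<mu> :: 'x measure) (act :: real ^ 'd \<Rightarrow> 'x \<Rightarrow> 'x).
        prob_space \<mu> \<and> countably_separated \<mu> \<and>
        measure_preserving_action \<mu> act \<and> ergodic_action \<mu> act \<and> aperiodic_action \<mu> act \<and>
        dim_generic TYPE('m) \<mu> act (L_infinity \<mu>) \<mu>)"
proof (intro conjI allI impI notI)
  fix \<mu> :: "'x measure" and act :: "real ^ 'd \<Rightarrow> 'x \<Rightarrow> 'x" and M :: "(real ^ 'd) set"
  assume a: "prob_space \<mu> \<and> countably_separated \<mu> \<and>
        measure_preserving_action \<mu> act \<and> ergodic_action \<mu> act \<and> aperiodic_action \<mu> act \<and>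
        C1_submanifold TYPE('m) M \<and> compact M \<and>
        (\<exists>\<pi>. affine \<pi> \<and> aff_dim \<pi> = int CARD('m) \<and> 0 \<notin> \<pi> \<and>
             M \<inter> \<pi> \<noteq> {} \<and> openin (top_of_set M) (M \<inter> \<pi>))"
    and gen: "generic TYPE('m) \<mu> act M (L_infinity \<mu>) \<mu>"
  from a obtain \<pi> where "affine \<pi>" "0 \<notin> \<pi>" "M \<inter> \<pi> \<noteq> {}" "openin (top_of_set M) (M \<inter> \<pi>)"
    by blast
  with a have "\<not> generic TYPE('m) \<mu> act M (L_infinity \<mu>) \<mu>"
    by (intro not_generic_of_flat_piece[where \<pi> = \<pi>]) simp_all
  with gen show False by contradiction
next
  assume "\<exists>(\<mu> :: 'x measure) (act :: real ^ 'd \<Rightarrow> 'x \<Rightarrow> 'x).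
        prob_space \<mu> \<and> countably_separated \<mu> \<and>
        measure_preserving_action \<mu> act \<and> ergodic_action \<mu> act \<and> aperiodic_action \<mu> act \<and>
        dim_generic TYPE('m) \<mu> act (L_infinity \<mu>) \<mu>"
  then obtain \<mu> :: "'x measure" and act :: "real ^ 'd \<Rightarrow> 'x \<Rightarrow> 'x" where
    a: "prob_space \<mu>" "countably_separated \<mu>" "measure_preserving_action \<mu> act" "aperiodic_action \<mu> act"
    and gen: "dim_generic TYPE('m) \<mu> act (L_infinity \<mu>) \<mu>"
    by blast
  have "CARD('m) < CARD('d)" using assms by linarith
  then obtain M \<pi> :: "(real ^ 'd) set" where M: "C1_submanifold TYPE('m) M" "compact M"
    and \<pi>: "affine \<pi>" "0 \<notin> \<pi>" "M \<inter> \<pi> \<noteq> {}" "openin (top_of_set M) (M \<inter> \<pi>)"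
    by (rule exists_flat_submanifold_off_origin)
  have "\<not> generic TYPE('m) \<mu> act M (L_infinity \<mu>) \<mu>"
    by (rule not_generic_of_flat_piece[OF a M \<pi>])
  with gen M show False by (simp add: dim_generic_def)
qed

end
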